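(* Let $\widetilde{H}$ be the affine Hecke algebra of type $G_2$, and assume $q^2=-1$ and $t=t_{1,q^2}$. Let $\mathbb{C}v_t$ be the $1$-dimensional $\widetilde{H}_{\{2\}}$-module with $T_2v_t=qv_t$, $X^\lambda v_t=t(X^\lambda)v_t$, and let $\mathbb{C}v_{s_1s_2t}$ be the $1$-dimensional $\widetilde{H}_{\{1\}}$-module with $T_1v_{s_1s_2t}=qv_{s_1s_2t}$, $X^\lambda v_{s_1s_2t}=(s_1s_2t)(X^\lambda)v_{s_1s_2t}$. Let $M=\widetilde{H}\otimes_{\widetilde{H}_{\{2\}}}\mathbb{C}v_t$ and $N=\widetilde{H}\otimes_{\widetilde{H}_{\{1\}}}\mathbb{C}v_{s_1s_2t}$. (a) $M$ and $N$ each have two $1$-dimensional modules and two $2$-dimensional modules as composition factors (counted with multiplicity). (b) The composition factors of $M$ and $N$ are the only irreducible $\widetilde{H}$-modules with central character $t$.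
   Context: The type $G_2$ root system has simple roots $\alpha_1,\alpha_2$ with $\langle\alpha_1,\alpha_2^\vee\rangle=-1$, $\langle\alpha_2,\alpha_1^\vee\rangle=-3$; $s_i\lambda=\lambda-\langle\lambda,\alpha_i^\vee\rangle\alpha_i$, and $W_0=\langle s_1,s_2\rangle$. $P=\mathbb{Z}\alpha_1+\mathbb{Z}\alpha_2$ is the weight lattice; $X=\{X^\lambda\mid\lambda\in P\}$, $X^\lambda X^\mu=X^{\lambda+\mu}$. For $q\in\mathbb{C}^\times$, $\widetilde{H}$ is the $\mathbb{C}$-algebra generated by $T_1,T_2$ and $X^\lambda$ ($\lambda\in P$), with the group algebra $\mathbb{C}[X]$ a subalgebra, subject to $T_i^2=(q-q^{-1})T_i+1$, $T_1T_2T_1T_2T_1T_2=T_2T_1T_2T_1T_2T_1$, and $X^\lambda T_i=T_iX^{s_i\lambda}+(q-q^{-1})\frac{X^\lambda-X^{s_i\lambda}}{1-X^{-\alpha_i}}$. $\widetilde{H}_{\{i\}}$ is the subalgebra generated by $T_i$ and $\mathbb{C}[X]$. Weights are elements of $T=\mathrm{Hom}(X,\mathbb{C}^\times)$, with $W_0$-action $(wt)(X^\lambda)=t(X^{w^{-1}\lambda})$; $t_{z,w}\in T$ is given by $t_{z,w}(X^{\alpha_1})=z$, $t_{z,w}(X^{\alpha_2})=w$. For a finite-dimensional $\widetilde{H}$-module $M$, $M_t^{\mathrm{gen}}=\{m\mid\forall\lambda\ \exists k>0:(X^\lambda-t(X^\lambda))^km=0\}$, and $t$ is a weight of $M$ if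 $M_t^{\mathrm{gen}}\neq0$. The weights of an irreducible $\widetilde{H}$-module lie in a single $W_0$-orbit; this orbit (or any element of it) is called its central character. (Irreducible $\widetilde{H}$-modules are finite-dimensional.) Note that $q=-q^{-1}$ when $q^2=-1$. *)

theory Defs
  imports
    "HOL-Library.Product_Plus"
    "HOL-Library.Multiset"
    "HOL-Algebra.Algebra"
    "Jordan_Normal_Form.VS_Connect"
begin

section \<open>Left modules over a not necessarily commutative ring\<close>

text \<open>
  The locale \<^locale>\<open>Module.module\<close> requires a commutative ring of scalars. The fields
  \<^const>\<open>monoid.mult\<close> and \<^const>\<open>monoid.one\<close> of the module record carry no
  information and are left undefined wherever a module is constructed.
\<close>

locale left_module = R?: ring R + M?: abelian_group M
  for R :: "('a, 'r) ring_scheme" (structure) and M :: "('a, 'm, 'x) module_scheme" (structure) +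
  assumes smult_closed:
      "\<lbrakk>a \<in> carrier R; x \<in> carrier M\<rbrakk> \<Longrightarrow> a \<odot>\<^bsub>M\<^esub> x \<in> carrier M"
    and smult_l_distr:
      "\<lbrakk>a \<in> carrier R; b \<in> carrier R; x \<in> carrier M\<rbrakk> \<Longrightarrow>
       (a \<oplus>\<^bsub>R\<^esub> b) \<odot>\<^bsub>M\<^esub> x = a \<odot>\<^bsub>M\<^esub> x \<oplus>\<^bsub>M\<^esub> b \<odot>\<^bsub>M\<^esub> x"
    and smult_r_distr:
      "\<lbrakk>a \<in> carrier R; x \<in> carrier M; y \<in> carrier M\<rbrakk> \<Longrightarrow>
       a \<odot>\<^bsub>M\<^esub> (x \<oplus>\<^bsub>M\<^esub> y) = a \<odot>\<^bsub>M\<^esub> x \<oplus>\<^bsub>M\<^esub> a \<odot>\<^bsub>M\<^esub> y"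
    and smult_assoc:
      "\<lbrakk>a \<in> carrier R; b \<in> carrier R; x \<in> carrier M\<rbrakk> \<Longrightarrow>
       (a \<otimes>\<^bsub>R\<^esub> b) \<odot>\<^bsub>M\<^esub> x = a \<odot>\<^bsub>M\<^esub> (b \<odot>\<^bsub>M\<^esub> x)"
    and smult_one: "x \<in> carrier M \<Longrightarrow> \<one>\<^bsub>R\<^esub> \<odot>\<^bsub>M\<^esub> x = x"

definition quotient_module :: "('a, 'm) module \<Rightarrow> 'm set \<Rightarrow> ('a, 'm set) module" where
  "quotient_module M N =
     \<lparr>carrier = a_rcosets\<^bsub>M\<^esub> N, monoid.mult = undefined, one = undefined,
      ring.zero = N, add = set_add M,
      smult = (\<lambda>a C. \<Union>x\<in>C. N +>\<^bsub>M\<^esub> (a \<odot>\<^bsub>M\<^esub> x))\<rparr>"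

definition irreducible_module :: "'a ring \<Rightarrow> ('a, 'm) module \<Rightarrow> bool" where
  "irreducible_module R M \<longleftrightarrow>
     left_module R M \<and> carrier M \<noteq> {\<zero>\<^bsub>M\<^esub>} \<and>
     (\<forall>N. Module.submodule N R M \<longrightarrow> N = {\<zero>\<^bsub>M\<^esub>} \<or> N = carrier M)"

definition module_isomorphic :: "'a ring \<Rightarrow> ('a, 'm) module \<Rightarrow> ('a, 'n) module \<Rightarrow> bool" where
  "module_isomorphic R M N \<longleftrightarrow>
     (\<exists>f \<in> LinearCombinations.module_hom R M N. bij_betw f (carrier M) (carrier N))"

definition series_factors :: "('a, 'm) module \<Rightarrow> 'm set list \<Rightarrow> ('a, 'm set) module list" where
  "series_factors M Ns =
     map (\<lambda>i. quotient_module (M\<lparr>carrier := Ns ! Suc i\<rparr>) (Ns ! i)) [0..<length Ns - 1]"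

definition composition_series :: "'a ring \<Rightarrow> ('a, 'm) module \<Rightarrow> 'm set list \<Rightarrow> bool" where
  "composition_series R M Ns \<longleftrightarrow>
     Ns \<noteq> [] \<and> hd Ns = {\<zero>\<^bsub>M\<^esub>} \<and> last Ns = carrier M \<and>
     (\<forall>N \<in> set Ns. Module.submodule N R M) \<and>
     (\<forall>i. Suc i < length Ns \<longrightarrow> Ns ! i \<subseteq> Ns ! Suc i) \<and>
     (\<forall>F \<in> set (series_factors M Ns). irreducible_module R F)"

definition composition_factor :: "'a ring \<Rightarrow> ('a, 'm) module \<Rightarrow> ('a, 'n) module \<Rightarrow> bool" where
  "composition_factor R M L \<longleftrightarrow>
     (\<exists>Ns. composition_series R M Ns \<and> (\<exists>F \<in> set (series_factors M Ns). module_isomorphic R L F))"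

section \<open>The induced module\<close>

text \<open>
  For a subring \<open>B\<close> of \<open>A\<close> and a left \<open>B\<close>-module \<open>V\<close>, the tensor product
  \<open>A \<otimes>\<^sub>B V\<close> is the free abelian group on \<open>A \<times> V\<close> modulo the subgroup generated by
  the relations of a balanced product, and \<open>a \<in> A\<close> acts by
  \<open>a (a' \<otimes> v) = (a a') \<otimes> v\<close>.
\<close>

definition tensor_relations ::
    "'a ring \<Rightarrow> 'a ring \<Rightarrow> ('a, 'v) module \<Rightarrow> ('a \<times> 'v \<Rightarrow>\<^sub>0 int) set" where
  "tensor_relations A B V =
     {frag_of (a \<oplus>\<^bsub>A\<^esub> a', v) - frag_of (a, v) - frag_of (a', v) | a a' v.
        a \<in> carrier A \<and> a' \<in> carrier A \<and> v \<in> carrier V} \<union>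
     {frag_of (a, v \<oplus>\<^bsub>V\<^esub> v') - frag_of (a, v) - frag_of (a, v') | a v v'.
        a \<in> carrier A \<and> v \<in> carrier V \<and> v' \<in> carrier V} \<union>
     {frag_of (a \<otimes>\<^bsub>A\<^esub> b, v) - frag_of (a, b \<odot>\<^bsub>V\<^esub> v) | a b v.
        a \<in> carrier A \<and> b \<in> carrier B \<and> v \<in> carrier V}"

definition induced_module ::
    "'a ring \<Rightarrow> 'a ring \<Rightarrow> ('a, 'v) module \<Rightarrow> ('a, ('a \<times> 'v \<Rightarrow>\<^sub>0 int) set) module" where
  "induced_module A B V =
     (let F = free_Abelian_group (carrier A \<times> carrier V);
          K = generate F (tensor_relations A B V)
      in \<lparr>carrier = carrier (F Mod K), monoid.mult = undefined, one = undefined,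
          ring.zero = \<one>\<^bsub>F Mod K\<^esub>, add = monoid.mult (F Mod K),
          smult = (\<lambda>a C. \<Union>z\<in>C. K #>\<^bsub>F\<^esub> frag_extend (\<lambda>(a', v). frag_of (a \<otimes>\<^bsub>A\<^esub> a', v)) z)\<rparr>)"

section \<open>The root system of type $G_2$\<close>

datatype node = N1 | N2

text \<open>The pair \<open>(m, n)\<close> stands for $m\alpha_1 + n\alpha_2$.\<close>

type_synonym wlattice = "int \<times> int"

fun simple_root :: "node \<Rightarrow> wlattice" where
  "simple_root N1 = (1, 0)"
| "simple_root N2 = (0, 1)"

text \<open>\<open>cartan j i\<close> is $\langle\alpha_j, \alpha_i^\vee\rangle$.\<close>

fun cartan :: "node \<Rightarrow> node \<Rightarrow> int" where
  "cartan N1 N1 = 2"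
| "cartan N1 N2 = -1"
| "cartan N2 N1 = -3"
| "cartan N2 N2 = 2"

definition coroot_pairing :: "wlattice \<Rightarrow> node \<Rightarrow> int" where
  "coroot_pairing l i = fst l * cartan N1 i + snd l * cartan N2 i"

definition reflection :: "node \<Rightarrow> wlattice \<Rightarrow> wlattice" where
  "reflection i l =
     l - (coroot_pairing l i * fst (simple_root i), coroot_pairing l i * snd (simple_root i))"

definition weyl_group :: "(wlattice \<Rightarrow> wlattice) set" where
  "weyl_group = generate (BijGroup UNIV) (range reflection)"

section \<open>The affine Hecke algebra\<close>

datatype 'g free_monoid = Word "'g list"

instantiation free_monoid :: (type) monoid_add
begin

definition zero_free_monoid :: "'a free_monoid" where
  "0 = Word []"

fun plus_free_monoid :: "'a free_monoid \<Rightarrow> 'a free_monoid \<Rightarrow> 'a free_monoid" where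
  "Word xs + Word ys = Word (xs @ ys)"

instance
proof
  fix a b c :: "'a free_monoid"
  show "a + b + c = a + (b + c)"
    by (cases a; cases b; cases c) simp
  show "0 + a = a" "a + 0 = a"
    by (cases a; simp add: zero_free_monoid_def)+
qed

end

datatype generator = GenT node | GenX wlattice

text \<open>
  With the convolution product of \<^typ>\<open>'a \<Rightarrow>\<^sub>0 'b\<close>, the following types are the free
  associative algebra on the generators and the group algebra $\mathbb{C}[X]$.
\<close>

type_synonym free_algebra = "generator free_monoid \<Rightarrow>\<^sub>0 complex"

type_synonym group_algebra = "wlattice \<Rightarrow>\<^sub>0 complex"

definition free_C :: "complex \<Rightarrow> free_algebra" where
  "free_C c = Poly_Mapping.single 0 c"

definition free_T :: "node \<Rightarrow> free_algebra" where
  "free_T i = Poly_Mapping.single (Word [GenT i]) 1"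

definition free_X :: "wlattice \<Rightarrow> free_algebra" where
  "free_X l = Poly_Mapping.single (Word [GenX l]) 1"

definition free_X_lin :: "group_algebra \<Rightarrow> free_algebra" where
  "free_X_lin f = (\<Sum>l \<in> Poly_Mapping.keys f. free_C (Poly_Mapping.lookup f l) * free_X l)"

text \<open>
  In the last family of relators, \<open>f\<close> is the quotient
  $(X^\lambda - X^{s_i\lambda})/(1 - X^{-\alpha_i})$; it exists and is unique because
  $1 - X^{-\alpha_i}$ divides the numerator and $\mathbb{C}[X]$ is a domain. That $\mathbb{C}[X]$
  embeds into the quotient algebra is a consequence of the relations (Bernstein basis).
\<close>

definition relators :: "complex \<Rightarrow> free_algebra set" where
  "relators q =
     {free_X 0 - 1} \<union>
     {free_X l * free_X m - free_X (l + m) | l m. True} \<union>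
     {free_T i ^ 2 - (free_C (q - inverse q) * free_T i + 1) | i. True} \<union>
     {free_T N1 * free_T N2 * free_T N1 * free_T N2 * free_T N1 * free_T N2
      - free_T N2 * free_T N1 * free_T N2 * free_T N1 * free_T N2 * free_T N1} \<union>
     {free_X l * free_T i
      - (free_T i * free_X (reflection i l) + free_C (q - inverse q) * free_X_lin f) | l i f.
        f * (1 - Poly_Mapping.single (- simple_root i) 1) =
        Poly_Mapping.single l 1 - Poly_Mapping.single (reflection i l) 1}"

type_synonym hecke_elem = "free_algebra set"

definition relator_ideal :: "complex \<Rightarrow> hecke_elem" where
  "relator_ideal q = genideal (class_ring :: free_algebra ring) (relators q)"

definition hecke :: "complex \<Rightarrow> hecke_elem ring" where
  "hecke q = (class_ring :: free_algebra ring) Quot relator_ideal q"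

definition hecke_proj :: "complex \<Rightarrow> free_algebra \<Rightarrow> hecke_elem" where
  "hecke_proj q x = relator_ideal q +>\<^bsub>class_ring\<^esub> x"

definition hecke_C :: "complex \<Rightarrow> complex \<Rightarrow> hecke_elem" where
  "hecke_C q c = hecke_proj q (free_C c)"

definition hecke_T :: "complex \<Rightarrow> node \<Rightarrow> hecke_elem" where
  "hecke_T q i = hecke_proj q (free_T i)"

definition hecke_X :: "complex \<Rightarrow> wlattice \<Rightarrow> hecke_elem" where
  "hecke_X q l = hecke_proj q (free_X l)"

definition parabolic :: "complex \<Rightarrow> node \<Rightarrow> hecke_elem ring" where
  "parabolic q i =
     (hecke q)\<lparr>carrier :=
       generate_ring (hecke q) (range (hecke_C q) \<union> {hecke_T q i} \<union> range (hecke_X q))\<rparr>"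

section \<open>Modules over the affine Hecke algebra\<close>

definition complex_space :: "complex \<Rightarrow> (hecke_elem, 'm) module \<Rightarrow> (complex, 'm) module" where
  "complex_space q M =
     \<lparr>carrier = carrier M, monoid.mult = monoid.mult M, one = monoid.one M,
      ring.zero = \<zero>\<^bsub>M\<^esub>, add = ring.add M,
      smult = (\<lambda>c x. hecke_C q c \<odot>\<^bsub>M\<^esub> x)\<rparr>"

definition has_dim :: "complex \<Rightarrow> (hecke_elem, 'm) module \<Rightarrow> nat \<Rightarrow> bool" where
  "has_dim q M n \<longleftrightarrow>
     vectorspace.fin_dim class_ring (complex_space q M) \<and>
     vectorspace.dim class_ring (complex_space q M) = n"

text \<open>An element \<open>t\<close> of the torus $T$ is given by the function $\lambda \mapsto t(X^\lambda)$.\<close>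

type_synonym weight = "wlattice \<Rightarrow> complex"

definition torus :: "weight set" where
  "torus = {t. (\<forall>l. t l \<noteq> 0) \<and> (\<forall>l m. t (l + m) = t l * t m)}"

definition torus_point :: "complex \<Rightarrow> complex \<Rightarrow> weight" where
  "torus_point z w = (\<lambda>(m, n). z powi m * w powi n)"

definition weyl_act :: "(wlattice \<Rightarrow> wlattice) \<Rightarrow> weight \<Rightarrow> weight" where
  "weyl_act w t = (\<lambda>l. t (inv_into UNIV w l))"

definition gen_weight_space :: "complex \<Rightarrow> (hecke_elem, 'm) module \<Rightarrow> weight \<Rightarrow> 'm set" where
  "gen_weight_space q M t =
     {x \<in> carrier M. \<forall>l. \<exists>k::nat. k > 0 \<and>
        ((hecke_X q l \<ominus>\<^bsub>hecke q\<^esub> hecke_C q (t l)) [^]\<^bsub>hecke q\<^esub> k) \<odot>\<^bsub>M\<^esub> x = \<zero>\<^bsub>M\<^esub>}"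

definition weights :: "complex \<Rightarrow> (hecke_elem, 'm) module \<Rightarrow> weight set" where
  "weights q M = {t \<in> torus. gen_weight_space q M t \<noteq> {\<zero>\<^bsub>M\<^esub>}}"

text \<open>
  The first conjunct is automatic for a nonzero finite-dimensional module over $\mathbb{C}$; it
  rules out a module without weights vacuously having every central character.
\<close>

definition has_central_character :: "complex \<Rightarrow> (hecke_elem, 'm) module \<Rightarrow> weight \<Rightarrow> bool" where
  "has_central_character q M t \<longleftrightarrow>
     weights q M \<noteq> {} \<and> weights q M \<subseteq> (\<lambda>w. weyl_act w t) ` weyl_group"

definition is_character_module ::
    "complex \<Rightarrow> node \<Rightarrow> weight \<Rightarrow> (hecke_elem, 'v) module \<Rightarrow> 'v \<Rightarrow> bool" where
  "is_character_module q i t V v \<longleftrightarrow>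
     left_module (parabolic q i) V \<and> has_dim q V 1 \<and>
     v \<in> carrier V \<and> v \<noteq> \<zero>\<^bsub>V\<^esub> \<and>
     hecke_T q i \<odot>\<^bsub>V\<^esub> v = hecke_C q q \<odot>\<^bsub>V\<^esub> v \<and>
     (\<forall>l. hecke_X q l \<odot>\<^bsub>V\<^esub> v = hecke_C q (t l) \<odot>\<^bsub>V\<^esub> v)"

end

theory Submission
  imports Defs
begin

text \<open>
  Write $T_i = q\tau_i$. Since $q^2 = -1$, the quadratic relation becomes
  $(\tau_i - 1)^2 = 0$, the braid relation keeps its form, and $q - q^{-1} = 2q$, so that the
  relations between the $\tau_i$ and the $X^\lambda$ no longer involve $q$. The orbit of $t$
  consists of the three points $a = t_{1,-1}$, $b = t_{-1,-1}$ and $c = t_{-1,1}$; the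
  reflection $s_1$ fixes $a$ and exchanges $b$ and $c$, and $s_2$ fixes $c$ and exchanges $a$
  and $b$. The module $M$ is induced from $a$, and $N$ from $c$.

  \<^emph>\<open>The two modules.\<close> The generator $v$ of an induced module and its successive images under
  $T_j$, $T_iT_j$, $T_jT_iT_j$, \dots{} span it, and six of them suffice: the Bernstein relation
  makes the span stable under $\mathbb{C}[X]$, and the quadratic and braid relations make it
  stable under the $T_i$ (\<open>cyclic_span\<close>). That six are needed is seen in an explicit family of
  modules \<open>rep6 q \<mu> \<nu>\<close>, for $\mu\nu = 0$, with two basis vectors for each point of the orbit.
  By Frobenius reciprocity $M$ maps to \<open>rep6 q 1 0\<close> and $N$ to \<open>rep6 q 0 1\<close>, and both maps are
  isomorphisms (\<open>induced_iso_rep6\<close>). The module \<open>rep6 q 0 0\<close> is the direct sum of two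
  irreducible modules \<open>simple_a\<close>, \<open>simple_c\<close> of dimension two, with the weights $a$ and $c$,
  and two copies of a module \<open>simple_b\<close> of dimension one, with the weight $b$. The parameters
  only add terms that are strictly triangular in the order $b', c, b, a$ of the coordinates
  (for $M$) or $b', a, b, c$ (for $N$), and this yields the composition series
  (\<open>series_rep6\<close>).

  \<^emph>\<open>The irreducible modules.\<close> Let $L$ be irreducible with the central character $t$. It
  contains a weight vector $x$ whose weight is $a$, $b$ or $c$. If $X^{\alpha_i}$ acts on $x$ by
  $-1$, then $(\tau_i - 1)x$ is zero or a weight vector of the reflected weight, and $\tau_i$
  fixes it (\<open>intertwiner\<close>). Starting from any of the three weights one arrives at a vector of
  weight $a$ fixed by $\tau_2$, or at one of weight $c$ fixed by $\tau_1$, or at one of weight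
  $b$ fixed by both (\<open>weight_vector_trichotomy\<close>). In the first two cases $L$ is a quotient of
  $M$ or of $N$, hence isomorphic to a factor of any composition series
  (\<open>irreducible_image_is_factor\<close>); in the third case $L$ is \<open>simple_b\<close>, which occurs at the
  bottom of both series. Conversely, three elements of $\mathbb{C}[X]$ whose common zeros in the
  torus are exactly $a$, $b$ and $c$ annihilate $M$ and $N$, hence all their composition factors.
\<close>

section \<open>Left modules and composition factors\<close>

context left_module
begin

lemma smult_zero_right [simp]: "a \<in> carrier R \<Longrightarrow> a \<odot>\<^bsub>M\<^esub> \<zero>\<^bsub>M\<^esub> = \<zero>\<^bsub>M\<^esub>"
  using smult_r_distr[of a "\<zero>\<^bsub>M\<^esub>" "\<zero>\<^bsub>M\<^esub>"] smult_closed[of a "\<zero>\<^bsub>M\<^esub>"]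
  by (simp add: M.add.l_cancel_one')

lemma smult_zero_left [simp]: "x \<in> carrier M \<Longrightarrow> \<zero>\<^bsub>R\<^esub> \<odot>\<^bsub>M\<^esub> x = \<zero>\<^bsub>M\<^esub>"
  using smult_l_distr[of "\<zero>\<^bsub>R\<^esub>" "\<zero>\<^bsub>R\<^esub>" x] smult_closed[of "\<zero>\<^bsub>R\<^esub>" x]
  by (simp add: M.add.l_cancel_one')

lemma smult_minus_one:
  assumes "x \<in> carrier M"
  shows "(\<ominus>\<^bsub>R\<^esub> \<one>\<^bsub>R\<^esub>) \<odot>\<^bsub>M\<^esub> x = \<ominus>\<^bsub>M\<^esub> x"
proof -
  have "(\<ominus>\<^bsub>R\<^esub> \<one>\<^bsub>R\<^esub>) \<odot>\<^bsub>M\<^esub> x \<oplus>\<^bsub>M\<^esub> x = (\<ominus>\<^bsub>R\<^esub> \<one>\<^bsub>R\<^esub> \<oplus>\<^bsub>R\<^esub> \<one>\<^bsub>R\<^esub>) \<odot>\<^bsub>M\<^esub> x"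
    using assms smult_l_distr[of "\<ominus>\<^bsub>R\<^esub> \<one>\<^bsub>R\<^esub>" "\<one>\<^bsub>R\<^esub>" x] smult_one by simp
  then show ?thesis
    using assms by (metis M.minus_equality R.add.inv_closed R.l_neg R.one_closed smult_closed smult_zero_left)
qed

lemma left_submoduleI:
  assumes "N \<subseteq> carrier M" and "\<zero>\<^bsub>M\<^esub> \<in> N"
    and "\<And>x y. x \<in> N \<Longrightarrow> y \<in> N \<Longrightarrow> x \<oplus>\<^bsub>M\<^esub> y \<in> N"
    and smult: "\<And>a x. a \<in> carrier R \<Longrightarrow> x \<in> N \<Longrightarrow> a \<odot>\<^bsub>M\<^esub> x \<in> N"
  shows "Module.submodule N R M"
proof (intro Module.submodule.intro subgroup.intro)
  fix x assume "x \<in> N"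
  then show "inv\<^bsub>add_monoid M\<^esub> x \<in> N"
    using smult[of "\<ominus>\<^bsub>R\<^esub> \<one>\<^bsub>R\<^esub>" x] smult_minus_one[of x] assms(1) by (auto simp: a_inv_def)
qed (use assms in \<open>auto simp: Module.submodule_axioms_def\<close>)

lemma submodule_props:
  assumes "Module.submodule N R M"
  shows "N \<subseteq> carrier M" "\<zero>\<^bsub>M\<^esub> \<in> N"
    "\<And>x y. x \<in> N \<Longrightarrow> y \<in> N \<Longrightarrow> x \<oplus>\<^bsub>M\<^esub> y \<in> N"
    "\<And>x. x \<in> N \<Longrightarrow> \<ominus>\<^bsub>M\<^esub> x \<in> N"
    "\<And>a x. a \<in> carrier R \<Longrightarrow> x \<in> N \<Longrightarrow> a \<odot>\<^bsub>M\<^esub> x \<in> N"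
  using subgroup.subset[OF Module.submodule.axioms(1)[OF assms]]
    subgroup.one_closed[OF Module.submodule.axioms(1)[OF assms]]
    subgroup.m_closed[OF Module.submodule.axioms(1)[OF assms]]
    subgroup.m_inv_closed[OF Module.submodule.axioms(1)[OF assms]]
    Module.submodule.smult_closed[OF assms]
  by (auto simp: a_inv_def)

lemma left_module_submodule:
  assumes "Module.submodule N R M"
  shows "left_module R (M\<lparr>carrier := N\<rparr>)"
proof (intro left_module.intro left_module_axioms.intro)
  note N = submodule_props[OF assms]
  show "abelian_group (M\<lparr>carrier := N\<rparr>)"
  proof (rule abelian_groupI)
    fix x assume "x \<in> carrier (M\<lparr>carrier := N\<rparr>)"
    then show "\<exists>y\<in>carrier (M\<lparr>carrier := N\<rparr>). y \<oplus>\<^bsub>M\<lparr>carrier := N\<rparr>\<^esub> x = \<zero>\<^bsub>M\<lparr>carrier := N\<rparr>\<^esub>"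
      using N by (auto intro!: bexI[of _ "\<ominus>\<^bsub>M\<^esub> x"] simp: M.l_neg subset_iff)
  qed (use N in \<open>auto simp: subset_iff M.a_assoc intro: M.a_comm\<close>)
  show "ring R" by (rule R.ring_axioms)
qed (use submodule_props[OF assms] in
    \<open>auto simp: subset_iff smult_l_distr smult_r_distr smult_assoc smult_one\<close>)

lemma submodule_carrier: "Module.submodule (carrier M) R M"
  by (rule left_submoduleI) (auto simp: smult_closed)

lemma submodule_restrict_iff:
  assumes "Module.submodule N R M"
  shows "Module.submodule K R (M\<lparr>carrier := N\<rparr>) \<longleftrightarrow> Module.submodule K R M \<and> K \<subseteq> N"
proof -
  interpret MN: left_module R "M\<lparr>carrier := N\<rparr>" by (rule left_module_submodule[OF assms])
  show ?thesis
  proof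
    assume K: "Module.submodule K R (M\<lparr>carrier := N\<rparr>)"
    have "Module.submodule K R M"
      by (rule left_submoduleI)
        (use MN.submodule_props[OF K] submodule_props(1)[OF assms] in auto)
    then show "Module.submodule K R M \<and> K \<subseteq> N"
      using MN.submodule_props[OF K] by auto
  next
    assume K: "Module.submodule K R M \<and> K \<subseteq> N"
    show "Module.submodule K R (M\<lparr>carrier := N\<rparr>)"
      by (rule MN.left_submoduleI) (use K submodule_props[of K] in auto)
  qed
qed

end

lemma module_homI:
  assumes "\<And>x. x \<in> carrier M \<Longrightarrow> f x \<in> carrier N"
    and "\<And>x y. x \<in> carrier M \<Longrightarrow> y \<in> carrier M \<Longrightarrow> f (x \<oplus>\<^bsub>M\<^esub> y) = f x \<oplus>\<^bsub>N\<^esub> f y"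
    and "\<And>a x. a \<in> carrier R \<Longrightarrow> x \<in> carrier M \<Longrightarrow> f (a \<odot>\<^bsub>M\<^esub> x) = a \<odot>\<^bsub>N\<^esub> f x"
  shows "f \<in> LinearCombinations.module_hom R M N"
  using assms unfolding LinearCombinations.module_hom_def by auto

lemma module_homD:
  assumes "f \<in> LinearCombinations.module_hom R M N"
  shows "\<And>x. x \<in> carrier M \<Longrightarrow> f x \<in> carrier N"
    and "\<And>x y. x \<in> carrier M \<Longrightarrow> y \<in> carrier M \<Longrightarrow> f (x \<oplus>\<^bsub>M\<^esub> y) = f x \<oplus>\<^bsub>N\<^esub> f y"
    and "\<And>a x. a \<in> carrier R \<Longrightarrow> x \<in> carrier M \<Longrightarrow> f (a \<odot>\<^bsub>M\<^esub> x) = a \<odot>\<^bsub>N\<^esub> f x"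
  using assms unfolding LinearCombinations.module_hom_def by auto

lemma module_hom_zero:
  assumes "left_module R M" and "left_module R N" and f: "f \<in> LinearCombinations.module_hom R M N"
  shows "f \<zero>\<^bsub>M\<^esub> = \<zero>\<^bsub>N\<^esub>"
proof -
  interpret M: left_module R M by fact
  interpret N: left_module R N by fact
  show ?thesis
    using module_homD(2)[OF f, of "\<zero>\<^bsub>M\<^esub>" "\<zero>\<^bsub>M\<^esub>"] module_homD(1)[OF f, of "\<zero>\<^bsub>M\<^esub>"]
    by (simp add: N.M.add.l_cancel_one')
qed

lemma module_hom_restrict:
  assumes f: "f \<in> LinearCombinations.module_hom R M N" and "K \<subseteq> carrier M" and "f ` K \<subseteq> L"
  shows "f \<in> LinearCombinations.module_hom R (M\<lparr>carrier := K\<rparr>) (N\<lparr>carrier := L\<rparr>)"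
  by (rule module_homI) (use assms(2,3) in \<open>auto simp: subset_iff module_homD[OF f]\<close>)

lemma module_hom_compose:
  assumes f: "f \<in> LinearCombinations.module_hom R M N" and g: "g \<in> LinearCombinations.module_hom R N L"
  shows "(\<lambda>x. g (f x)) \<in> LinearCombinations.module_hom R M L"
  by (rule module_homI) (simp_all add: module_homD[OF f] module_homD[OF g])

lemma module_hom_inverse:
  assumes M: "left_module R M" and f: "f \<in> LinearCombinations.module_hom R M N"
    and bij: "bij_betw f (carrier M) (carrier N)"
  shows "inv_into (carrier M) f \<in> LinearCombinations.module_hom R N M"
proof -
  interpret left_module R M by fact
  let ?g = "inv_into (carrier M) f"
  have g: "?g y \<in> carrier M" "f (?g y) = y" if "y \<in> carrier N" for y
    using that bij by (auto simp: bij_betw_def inv_into_into f_inv_into_f)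
  have fg: "?g (f x) = x" if "x \<in> carrier M" for x
    using that bij by (auto simp: bij_betw_def)
  show ?thesis
  proof (rule module_homI)
    fix x y assume xy: "x \<in> carrier N" "y \<in> carrier N"
    have "f (?g x \<oplus>\<^bsub>M\<^esub> ?g y) = x \<oplus>\<^bsub>N\<^esub> y" using g xy module_homD(2)[OF f] by simp
    then show "?g (x \<oplus>\<^bsub>N\<^esub> y) = ?g x \<oplus>\<^bsub>M\<^esub> ?g y" using fg g xy by (metis M.a_closed)
  next
    fix a x assume ax: "a \<in> carrier R" "x \<in> carrier N"
    have "f (a \<odot>\<^bsub>M\<^esub> ?g x) = a \<odot>\<^bsub>N\<^esub> x" using g ax module_homD(3)[OF f] by simp
    then show "?g (a \<odot>\<^bsub>N\<^esub> x) = a \<odot>\<^bsub>M\<^esub> ?g x" using fg g ax by (metis smult_closed)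
  qed (use g in auto)
qed

lemma module_isomorphic_sym:
  assumes "left_module R M" and "module_isomorphic R M N"
  shows "module_isomorphic R N M"
  using assms module_hom_inverse bij_betw_inv_into unfolding module_isomorphic_def by metis

lemma module_isomorphic_trans:
  assumes "module_isomorphic R M N" and "module_isomorphic R N L"
  shows "module_isomorphic R M L"
proof -
  obtain f g where "f \<in> LinearCombinations.module_hom R M N" "bij_betw f (carrier M) (carrier N)"
    "g \<in> LinearCombinations.module_hom R N L" "bij_betw g (carrier N) (carrier L)"
    using assms unfolding module_isomorphic_def by blast
  then show ?thesis unfolding module_isomorphic_def
    using module_hom_compose[of f R M N g L] bij_betw_trans[of f _ _ g] by (auto simp: comp_def)
qed

lemma submodule_preimage:
  assumes "left_module R M" and "left_module R N" and f: "f \<in> LinearCombinations.module_hom R M N"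
    and K: "Module.submodule K R N"
  shows "Module.submodule {x \<in> carrier M. f x \<in> K} R M"
proof -
  interpret M: left_module R M by fact
  interpret N: left_module R N by fact
  show ?thesis
    by (rule M.left_submoduleI)
      (use N.submodule_props[OF K] module_homD[OF f] module_hom_zero[OF assms(1-3)] in
        \<open>auto simp: M.smult_closed\<close>)
qed

lemma submodule_image:
  assumes "left_module R M" and "left_module R N" and f: "f \<in> LinearCombinations.module_hom R M N"
    and K: "Module.submodule K R M"
  shows "Module.submodule (f ` K) R N"
proof -
  interpret M: left_module R M by fact
  interpret N: left_module R N by fact
  note KK = M.submodule_props[OF K]
  show ?thesis
  proof (rule N.left_submoduleI)
    show "f ` K \<subseteq> carrier N" using KK(1) module_homD(1)[OF f] by auto
    show "\<zero>\<^bsub>N\<^esub> \<in> f ` K" using KK(2) module_hom_zero[OF assms(1-3)] by force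
    fix x y assume "x \<in> f ` K" "y \<in> f ` K"
    then show "x \<oplus>\<^bsub>N\<^esub> y \<in> f ` K"
      using KK(1,3) module_homD(2)[OF f] by (auto simp: subset_iff) (metis imageI)
  next
    fix a x assume "a \<in> carrier R" "x \<in> f ` K"
    then show "a \<odot>\<^bsub>N\<^esub> x \<in> f ` K"
      using KK(1,5) module_homD(3)[OF f] by (auto simp: subset_iff) (metis imageI)
  qed
qed

lemma submodule_zero: "left_module R M \<Longrightarrow> Module.submodule {\<zero>\<^bsub>M\<^esub>} R M"
proof -
  assume "left_module R M"
  then interpret left_module R M .
  show ?thesis by (rule left_submoduleI) auto
qed

lemma module_hom_inj_iff:
  assumes "left_module R M" and "left_module R N" and f: "f \<in> LinearCombinations.module_hom R M N"
  shows "inj_on f (carrier M) \<longleftrightarrow> (\<forall>x\<in>carrier M. f x = \<zero>\<^bsub>N\<^esub> \<longrightarrow> x = \<zero>\<^bsub>M\<^esub>)"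
proof
  interpret M: left_module R M by fact
  interpret N: left_module R N by fact
  note f0 = module_hom_zero[OF assms]
  show "inj_on f (carrier M) \<Longrightarrow> \<forall>x\<in>carrier M. f x = \<zero>\<^bsub>N\<^esub> \<longrightarrow> x = \<zero>\<^bsub>M\<^esub>"
    using f0 by (metis M.M.zero_closed inj_onD)
  assume ker: "\<forall>x\<in>carrier M. f x = \<zero>\<^bsub>N\<^esub> \<longrightarrow> x = \<zero>\<^bsub>M\<^esub>"
  show "inj_on f (carrier M)"
  proof (rule inj_onI)
    fix x y assume xy: "x \<in> carrier M" "y \<in> carrier M" "f x = f y"
    have y': "\<ominus>\<^bsub>M\<^esub> y \<in> carrier M" using xy by simp
    have "f (x \<oplus>\<^bsub>M\<^esub> \<ominus>\<^bsub>M\<^esub> y) = f (y \<oplus>\<^bsub>M\<^esub> \<ominus>\<^bsub>M\<^esub> y)"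
      using xy y' module_homD(2)[OF f] by simp
    also have "\<dots> = \<zero>\<^bsub>N\<^esub>" using xy f0 by (simp add: M.M.r_neg)
    finally have "x \<oplus>\<^bsub>M\<^esub> \<ominus>\<^bsub>M\<^esub> y = \<zero>\<^bsub>M\<^esub>" using ker xy y' by simp
    then show "x = y" using xy by (metis M.M.minus_equality M.M.minus_minus y')
  qed
qed

lemma schur_lemma:
  assumes M: "irreducible_module R M" and N: "irreducible_module R N"
    and f: "f \<in> LinearCombinations.module_hom R M N"
    and nz: "x \<in> carrier M" "f x \<noteq> \<zero>\<^bsub>N\<^esub>"
  shows "bij_betw f (carrier M) (carrier N)"
proof -
  have lm: "left_module R M" "left_module R N"
    using M N unfolding irreducible_module_def by auto
  interpret M: left_module R M by (rule lm)
  interpret N: left_module R N by (rule lm)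
  have "Module.submodule {x \<in> carrier M. f x \<in> {\<zero>\<^bsub>N\<^esub>}} R M"
    by (rule submodule_preimage[OF lm f submodule_zero[OF lm(2)]])
  then have "{x \<in> carrier M. f x \<in> {\<zero>\<^bsub>N\<^esub>}} = {\<zero>\<^bsub>M\<^esub>}"
    using M nz unfolding irreducible_module_def by blast
  then have "inj_on f (carrier M)" using module_hom_inj_iff[OF lm f] by blast
  moreover have "f ` carrier M = carrier N"
    using N nz submodule_image[OF lm f M.submodule_carrier] unfolding irreducible_module_def by blast
  ultimately show ?thesis by (simp add: bij_betw_def)
qed

context left_module
begin

lemma coset_mem_iff:
  assumes "Module.submodule N R M" and "x \<in> carrier M"
  shows "y \<in> N +>\<^bsub>M\<^esub> x \<longleftrightarrow> y \<in> carrier M \<and> y \<oplus>\<^bsub>M\<^esub> \<ominus>\<^bsub>M\<^esub> x \<in> N"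
proof
  note N = submodule_props[OF assms(1)]
  assume "y \<in> N +>\<^bsub>M\<^esub> x"
  then obtain n where "n \<in> N" "y = n \<oplus>\<^bsub>M\<^esub> x" unfolding a_r_coset_def' by blast
  then show "y \<in> carrier M \<and> y \<oplus>\<^bsub>M\<^esub> \<ominus>\<^bsub>M\<^esub> x \<in> N"
    using N(1) assms(2) by (auto simp: subset_iff M.a_assoc M.r_neg)
next
  assume y: "y \<in> carrier M \<and> y \<oplus>\<^bsub>M\<^esub> \<ominus>\<^bsub>M\<^esub> x \<in> N"
  then have "y = (y \<oplus>\<^bsub>M\<^esub> \<ominus>\<^bsub>M\<^esub> x) \<oplus>\<^bsub>M\<^esub> x" using assms(2) by (auto simp: M.a_assoc M.l_neg)
  then show "y \<in> N +>\<^bsub>M\<^esub> x" unfolding a_r_coset_def' using y by blast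
qed

end

text \<open>
  The module structure of the quotient is transported back from \<open>F\<close>: each factor that is computed
  below is recognized by a homomorphism onto a known irreducible module.
\<close>

theorem quotient_module_iso:
  fixes M :: "('a, 'm) module" and F :: "('a, 'n) module"
  assumes M: "left_module R M" and F: "left_module R F" and N: "Module.submodule N R M"
    and f: "f \<in> LinearCombinations.module_hom R M F"
    and surj: "f ` carrier M = carrier F" and ker: "{x \<in> carrier M. f x = \<zero>\<^bsub>F\<^esub>} = N"
  obtains g where "g \<in> LinearCombinations.module_hom R (quotient_module M N) F"
    and "bij_betw g (carrier (quotient_module M N)) (carrier F)"
    and "left_module R (quotient_module M N)"
proof -
  interpret M: left_module R M by fact
  interpret F: left_module R F by fact
  note Np = M.submodule_props[OF N]
  let ?Q = "quotient_module M N"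
  let ?c = "\<lambda>x. N +>\<^bsub>M\<^esub> x"
  have car: "carrier ?Q = ?c ` carrier M"
    by (auto simp: quotient_module_def A_RCOSETS_def')
  have fneg: "f (\<ominus>\<^bsub>M\<^esub> x) = \<ominus>\<^bsub>F\<^esub> f x" if "x \<in> carrier M" for x
    using that module_homD(2)[OF f, of "\<ominus>\<^bsub>M\<^esub> x" x] module_homD(1)[OF f] module_hom_zero[OF M F f]
    by (metis F.M.minus_equality M.M.add.inv_closed M.M.l_neg)
  have mem: "y \<in> ?c x \<longleftrightarrow> y \<in> carrier M \<and> f y = f x" if "x \<in> carrier M" for x y
  proof -
    have "f (y \<oplus>\<^bsub>M\<^esub> \<ominus>\<^bsub>M\<^esub> x) = \<zero>\<^bsub>F\<^esub> \<longleftrightarrow> f y = f x" if "y \<in> carrier M" for y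
      using that \<open>x \<in> carrier M\<close> module_homD(1,2)[OF f] fneg
      by simp (metis F.M.add.inv_closed F.M.minus_equality F.M.minus_minus F.M.r_neg)
    then show ?thesis using M.coset_mem_iff[OF N that] ker that by auto
  qed
  define g where "g C = f (SOME x. x \<in> C)" for C
  have gc: "g (?c x) = f x" if "x \<in> carrier M" for x
    unfolding g_def by (rule someI2[of _ x]) (use mem[OF that] that in auto)
  have eqc: "?c x = ?c y \<longleftrightarrow> f x = f y" if "x \<in> carrier M" "y \<in> carrier M" for x y
    using mem that by (metis gc subsetI subset_antisym)
  have addc: "?c x \<oplus>\<^bsub>?Q\<^esub> ?c y = ?c (x \<oplus>\<^bsub>M\<^esub> y)" if "x \<in> carrier M" "y \<in> carrier M" for x y
  proof (intro Set.set_eqI iffI)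
    fix z assume "z \<in> ?c x \<oplus>\<^bsub>?Q\<^esub> ?c y"
    then obtain u v where "u \<in> ?c x" "v \<in> ?c y" "z = u \<oplus>\<^bsub>M\<^esub> v"
      by (auto simp: quotient_module_def set_add_def')
    then show "z \<in> ?c (x \<oplus>\<^bsub>M\<^esub> y)"
      using mem[of x u] mem[of y v] mem[of "x \<oplus>\<^bsub>M\<^esub> y" z] that module_homD(2)[OF f] by simp
  next
    fix z assume z: "z \<in> ?c (x \<oplus>\<^bsub>M\<^esub> y)"
    have zM: "z \<in> carrier M" "f z = f x \<oplus>\<^bsub>F\<^esub> f y"
      using z mem[of "x \<oplus>\<^bsub>M\<^esub> y" z] that module_homD(2)[OF f] by auto
    have "f (z \<oplus>\<^bsub>M\<^esub> \<ominus>\<^bsub>M\<^esub> y) = f x"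
      using zM that module_homD(1,2)[OF f] fneg by (simp add: F.M.a_assoc F.M.r_neg)
    then have "z \<oplus>\<^bsub>M\<^esub> \<ominus>\<^bsub>M\<^esub> y \<in> ?c x"
      using zM that mem[of x] by simp
    moreover have "y \<in> ?c y" using mem[of y y] that by simp
    moreover have "z \<oplus>\<^bsub>M\<^esub> \<ominus>\<^bsub>M\<^esub> y \<oplus>\<^bsub>M\<^esub> y = z" using zM that by (simp add: M.M.a_assoc M.M.l_neg)
    ultimately have "\<exists>u \<in> ?c x. \<exists>v \<in> ?c y. z = u \<oplus>\<^bsub>M\<^esub> v" by (intro bexI) (rule sym)
    then show "z \<in> ?c x \<oplus>\<^bsub>?Q\<^esub> ?c y"
      by (simp add: quotient_module_def set_add_def')
  qed
  have smc: "a \<odot>\<^bsub>?Q\<^esub> ?c x = ?c (a \<odot>\<^bsub>M\<^esub> x)" if "a \<in> carrier R" "x \<in> carrier M" for a x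
  proof -
    have eq: "?c (a \<odot>\<^bsub>M\<^esub> y) = ?c (a \<odot>\<^bsub>M\<^esub> x)" if "y \<in> ?c x" for y
      using that mem[of x y] eqc[of "a \<odot>\<^bsub>M\<^esub> y" "a \<odot>\<^bsub>M\<^esub> x"] \<open>a \<in> carrier R\<close> \<open>x \<in> carrier M\<close>
        module_homD(3)[OF f] M.smult_closed
      by simp
    have "?c x \<noteq> {}" using mem[of x x] that by auto
    then have "(\<Union>y\<in>?c x. ?c (a \<odot>\<^bsub>M\<^esub> y)) = ?c (a \<odot>\<^bsub>M\<^esub> x)" by (rule SUP_eq_const) (rule eq)
    then show ?thesis by (simp add: quotient_module_def)
  qed
  have z: "\<zero>\<^bsub>?Q\<^esub> = ?c \<zero>\<^bsub>M\<^esub>"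
    using Np(1) mem[of "\<zero>\<^bsub>M\<^esub>"] ker module_hom_zero[OF M F f] by (auto simp: quotient_module_def)
  have "left_module R ?Q"
  proof (intro left_module.intro left_module_axioms.intro)
    show "abelian_group ?Q"
    proof (rule abelian_groupI)
      fix x assume "x \<in> carrier ?Q"
      then obtain u where u: "u \<in> carrier M" "x = ?c u" using car by auto
      then have "?c (\<ominus>\<^bsub>M\<^esub> u) \<oplus>\<^bsub>?Q\<^esub> x = \<zero>\<^bsub>?Q\<^esub>" using addc z by (simp add: M.M.l_neg)
      then show "\<exists>y\<in>carrier ?Q. y \<oplus>\<^bsub>?Q\<^esub> x = \<zero>\<^bsub>?Q\<^esub>" using u car by blast
    qed (auto simp: car addc z M.M.a_ac)
    show "ring R" by (rule M.R.ring_axioms)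
  qed (auto simp: car addc smc M.smult_closed M.smult_l_distr M.smult_r_distr M.smult_assoc M.smult_one)
  moreover have "g \<in> LinearCombinations.module_hom R ?Q F"
    by (rule module_homI) (auto simp: car gc addc smc module_homD[OF f] M.smult_closed)
  moreover have "bij_betw g (carrier ?Q) (carrier F)"
    unfolding bij_betw_def inj_on_def car image_image using gc eqc surj by (auto simp: image_iff)
  ultimately show ?thesis using that by blast
qed

lemma irreducible_module_iso:
  assumes M: "left_module R M" and N: "irreducible_module R N"
    and f: "f \<in> LinearCombinations.module_hom R M N" and bij: "bij_betw f (carrier M) (carrier N)"
  shows "irreducible_module R M"
  unfolding irreducible_module_def
proof (intro conjI allI impI)
  have lN: "left_module R N" using N unfolding irreducible_module_def by auto
  interpret M: left_module R M by fact
  interpret N: left_module R N by (rule lN)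
  show "left_module R M" by fact
  show "carrier M \<noteq> {\<zero>\<^bsub>M\<^esub>}"
  proof
    assume "carrier M = {\<zero>\<^bsub>M\<^esub>}"
    then have "carrier N = {\<zero>\<^bsub>N\<^esub>}" using bij module_hom_zero[OF M lN f] by (auto simp: bij_betw_def)
    then show False using N unfolding irreducible_module_def by auto
  qed
  fix K assume K: "Module.submodule K R M"
  have sub: "K \<subseteq> carrier M" using M.submodule_props(1)[OF K] .
  have inj: "inj_on f (carrier M)" using bij by (simp add: bij_betw_def)
  have "f ` K = {\<zero>\<^bsub>N\<^esub>} \<or> f ` K = carrier N"
    using N submodule_image[OF M lN f K] unfolding irreducible_module_def by blast
  then show "K = {\<zero>\<^bsub>M\<^esub>} \<or> K = carrier M"
  proof
    assume "f ` K = {\<zero>\<^bsub>N\<^esub>}"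
    then have "K \<subseteq> {\<zero>\<^bsub>M\<^esub>}" using inj sub module_hom_inj_iff[OF M lN f] by blast
    then show ?thesis using M.submodule_props(2)[OF K] by auto
  next
    assume "f ` K = carrier N"
    then have "f ` K = f ` carrier M" using bij by (simp add: bij_betw_def)
    then show ?thesis using inj sub by (simp add: inj_on_image_eq_iff)
  qed
qed

lemma series_factors_nth:
  "F \<in> set (series_factors M Ns) \<longleftrightarrow>
   (\<exists>i. Suc i < length Ns \<and> F = quotient_module (M\<lparr>carrier := Ns ! Suc i\<rparr>) (Ns ! i))"
  unfolding series_factors_def by (auto simp: less_diff_conv image_iff Bex_def)

text \<open>
  Half of the correspondence theorem: the cosets of the elements of \<open>K\<close> form a submodule of the
  quotient, and \<open>K\<close> is recovered from it because it is a union of cosets of \<open>N\<close>.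
\<close>

lemma irreducible_quotient_no_intermediate:
  fixes M :: "('a, 'm) module"
  assumes M: "left_module R M" and N: "Module.submodule N R M" and irr: "irreducible_module R (quotient_module M N)"
    and K: "Module.submodule K R M" and NK: "N \<subseteq> K" and KM: "K \<noteq> carrier M"
  shows "K = N"
proof -
  interpret M: left_module R M by fact
  note Np = M.submodule_props[OF N]
  note Kp = M.submodule_props[OF K]
  let ?Q = "quotient_module M N"
  let ?c = "\<lambda>x. N +>\<^bsub>M\<^esub> x"
  interpret Q: left_module R ?Q using irr unfolding irreducible_module_def by auto
  have car: "carrier ?Q = ?c ` carrier M"
    by (auto simp: quotient_module_def A_RCOSETS_def')
  have mem: "y \<in> ?c x \<longleftrightarrow> y \<in> carrier M \<and> y \<oplus>\<^bsub>M\<^esub> \<ominus>\<^bsub>M\<^esub> x \<in> N" if "x \<in> carrier M" for x y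
    using M.coset_mem_iff[OF N that] .
  have self: "x \<in> ?c x" if "x \<in> carrier M" for x
    using mem[OF that] that Np(2) by (simp add: M.M.r_neg)
  have inK: "?c x \<subseteq> K" if "x \<in> K" for x
  proof
    fix y assume y: "y \<in> ?c x"
    have x: "x \<in> carrier M" using that Kp(1) by auto
    have "y \<oplus>\<^bsub>M\<^esub> \<ominus>\<^bsub>M\<^esub> x \<in> K" "y \<in> carrier M" using y mem[OF x] NK by auto
    then have "y \<oplus>\<^bsub>M\<^esub> \<ominus>\<^bsub>M\<^esub> x \<oplus>\<^bsub>M\<^esub> x \<in> K" using Kp(3) that by blast
    then show "y \<in> K" using x \<open>y \<in> carrier M\<close> by (simp add: M.M.a_assoc M.M.l_neg)
  qed
  have cK: "C \<in> ?c ` K" if C: "C \<in> carrier ?Q" "y \<in> C" "y \<in> K" for C y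
  proof -
    obtain x where x: "x \<in> carrier M" "C = ?c x" using C(1) unfolding car by blast
    have y: "y \<in> carrier M" "y \<oplus>\<^bsub>M\<^esub> \<ominus>\<^bsub>M\<^esub> x \<in> N" using mem[OF x(1), of y] x(2) C(2) by simp_all
    have "x \<oplus>\<^bsub>M\<^esub> \<ominus>\<^bsub>M\<^esub> y \<in> K"
      using Kp(4)[of "y \<oplus>\<^bsub>M\<^esub> \<ominus>\<^bsub>M\<^esub> x"] y x NK
        M.M.a_comm[of x "\<ominus>\<^bsub>M\<^esub> y"] M.M.minus_add[of y "\<ominus>\<^bsub>M\<^esub> x"] by (simp add: subset_iff)
    then have "x \<oplus>\<^bsub>M\<^esub> \<ominus>\<^bsub>M\<^esub> y \<oplus>\<^bsub>M\<^esub> y \<in> K" using Kp(3) that by blast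
    then have "x \<in> K" using x y by (simp add: M.M.a_assoc M.M.l_neg)
    then show ?thesis using x by auto
  qed
  have "Module.submodule (?c ` K) R ?Q"
  proof (rule Q.left_submoduleI)
    show "?c ` K \<subseteq> carrier ?Q" using Kp(1) car by auto
    have "\<zero>\<^bsub>M\<^esub> \<in> \<zero>\<^bsub>?Q\<^esub>" using Np(2) by (simp add: quotient_module_def)
    then show "\<zero>\<^bsub>?Q\<^esub> \<in> ?c ` K" using cK[of "\<zero>\<^bsub>?Q\<^esub>"] Kp(2) by auto
  next
    fix C D assume C: "C \<in> ?c ` K" "D \<in> ?c ` K"
    then obtain x y where xy: "x \<in> K" "y \<in> K" "C = ?c x" "D = ?c y" by auto
    then have "x \<oplus>\<^bsub>M\<^esub> y \<in> C \<oplus>\<^bsub>?Q\<^esub> D"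
      using self Kp(1) by (auto simp: quotient_module_def set_add_def')
    then show "C \<oplus>\<^bsub>?Q\<^esub> D \<in> ?c ` K"
      using cK[of "C \<oplus>\<^bsub>?Q\<^esub> D" "x \<oplus>\<^bsub>M\<^esub> y"] xy Kp(1,3) Q.M.a_closed[of C D] unfolding car by auto
  next
    fix a C assume C: "a \<in> carrier R" "C \<in> ?c ` K"
    then obtain x where x: "x \<in> K" "C = ?c x" by auto
    then have "a \<odot>\<^bsub>M\<^esub> x \<in> a \<odot>\<^bsub>?Q\<^esub> C"
      using self Kp(1,5) C by (auto simp: quotient_module_def subset_iff intro!: bexI[of _ x])
    then show "a \<odot>\<^bsub>?Q\<^esub> C \<in> ?c ` K"
      using cK[of "a \<odot>\<^bsub>?Q\<^esub> C" "a \<odot>\<^bsub>M\<^esub> x"] x Kp(1,5) C car Q.smult_closed by auto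
  qed
  then have "?c ` K = {\<zero>\<^bsub>?Q\<^esub>} \<or> ?c ` K = carrier ?Q"
    using irr unfolding irreducible_module_def by blast
  then show ?thesis
  proof
    assume eq: "?c ` K = {\<zero>\<^bsub>?Q\<^esub>}"
    have "x \<in> N" if "x \<in> K" for x
    proof -
      have "?c x = N" using that eq by (auto simp: quotient_module_def)
      then show ?thesis using self[of x] that Kp(1) by auto
    qed
    then show ?thesis using NK by auto
  next
    assume eq: "?c ` K = carrier ?Q"
    have "x \<in> K" if "x \<in> carrier M" for x
    proof -
      have "?c x \<in> ?c ` K" using that eq car by auto
      then show ?thesis using self[OF that] inK by auto
    qed
    then show ?thesis using KM Kp(1) by auto
  qed
qed

text \<open>
  Consider the first member of the series that \<open>f\<close> does not annihilate. The kernel of \<open>f\<close> on it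
  contains the preceding member, hence equals it as the factor is irreducible, and the image is all
  of \<open>L\<close>. So \<open>L\<close> occurs in every composition series, and in particular in an explicitly known one.
\<close>

theorem irreducible_image_is_factor:
  fixes M :: "('a, 'm) module" and L :: "('a, 'l) module"
  assumes M: "left_module R M" and L: "irreducible_module R L" and series: "composition_series R M Ns"
    and f: "f \<in> LinearCombinations.module_hom R M L" and x: "x \<in> carrier M" "f x \<noteq> \<zero>\<^bsub>L\<^esub>"
  shows "\<exists>F \<in> set (series_factors M Ns). module_isomorphic R L F"
proof -
  interpret M: left_module R M by fact
  have lL: "left_module R L" using L unfolding irreducible_module_def by auto
  interpret L: left_module R L by (rule lL)
  have S: "Ns \<noteq> []" "hd Ns = {\<zero>\<^bsub>M\<^esub>}" "last Ns = carrier M" "\<And>N. N \<in> set Ns \<Longrightarrow> Module.submodule N R M"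
    "\<And>i. Suc i < length Ns \<Longrightarrow> Ns ! i \<subseteq> Ns ! Suc i"
    "\<And>F. F \<in> set (series_factors M Ns) \<Longrightarrow> irreducible_module R F"
    using series unfolding composition_series_def by blast+
  let ?P = "\<lambda>i. i < length Ns \<and> (\<exists>y \<in> Ns ! i. f y \<noteq> \<zero>\<^bsub>L\<^esub>)"
  have ex: "?P (length Ns - 1)" using S(1,3) x by (auto simp: last_conv_nth)
  define k where "k = (LEAST i. ?P i)"
  have k: "?P k" unfolding k_def using ex by (rule LeastI)
  have "k \<noteq> 0"
  proof
    assume "k = 0"
    then obtain y where "y \<in> hd Ns" "f y \<noteq> \<zero>\<^bsub>L\<^esub>" using k hd_conv_nth[OF S(1)] by auto
    then show False using S(2) module_hom_zero[OF M lL f] by simp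
  qed
  then obtain i where i: "k = Suc i" by (cases k) auto
  have "\<not> ?P i" using not_less_Least[of i ?P] i unfolding k_def by auto
  then have kill: "\<And>y. y \<in> Ns ! i \<Longrightarrow> f y = \<zero>\<^bsub>L\<^esub>" using k i by auto
  obtain y where y: "y \<in> Ns ! Suc i" "f y \<noteq> \<zero>\<^bsub>L\<^esub>" using k i by auto
  let ?M' = "M\<lparr>carrier := Ns ! Suc i\<rparr>"
  have len: "Suc i < length Ns" using k i by auto
  have sub: "Module.submodule (Ns ! Suc i) R M" "Module.submodule (Ns ! i) R M" using S(4) len by auto
  have lM': "left_module R ?M'" by (rule M.left_module_submodule[OF sub(1)])
  interpret M': left_module R ?M' by (rule lM')
  have f': "f \<in> LinearCombinations.module_hom R ?M' L"
    using module_hom_restrict[OF f M.submodule_props(1)[OF sub(1)], of "carrier L"]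
      module_homD(1)[OF f] M.submodule_props(1)[OF sub(1)] by auto
  let ?F = "quotient_module ?M' (Ns ! i)"
  have F: "?F \<in> set (series_factors M Ns)" using len by (auto simp: series_factors_nth)
  have subi: "Module.submodule (Ns ! i) R ?M'"
    using M.submodule_restrict_iff[OF sub(1)] sub(2) S(5)[OF len] by simp
  let ?K = "{x \<in> carrier ?M'. f x \<in> {\<zero>\<^bsub>L\<^esub>}}"
  have "?K = Ns ! i"
  proof (rule irreducible_quotient_no_intermediate[OF lM' subi S(6)[OF F]])
    show "Module.submodule ?K R ?M'" by (rule submodule_preimage[OF lM' lL f' submodule_zero[OF lL]])
    show "Ns ! i \<subseteq> ?K" using kill S(5)[OF len] by auto
    show "?K \<noteq> carrier ?M'" using y by auto
  qed
  then have ker: "{x \<in> carrier ?M'. f x = \<zero>\<^bsub>L\<^esub>} = Ns ! i" by auto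
  have surj: "f ` carrier ?M' = carrier L"
    using L y submodule_image[OF lM' lL f' M'.submodule_carrier] unfolding irreducible_module_def
    by auto
  obtain g where "g \<in> LinearCombinations.module_hom R ?F L" "bij_betw g (carrier ?F) (carrier L)"
    "left_module R ?F"
    using quotient_module_iso[OF lM' lL subi f' surj ker] by blast
  then have "module_isomorphic R L ?F"
    using module_isomorphic_sym unfolding module_isomorphic_def by blast
  then show ?thesis using F by blast
qed

text \<open>
  Annihilators can only grow on passing to submodules, quotients and isomorphic modules. An element
  of the factor is a coset, and \<open>a\<close> sends each of its members to zero.
\<close>

lemma annihilator_factor:
  fixes M :: "('a, 'm) module" and L :: "('a, 'l) module"
  assumes M: "left_module R M" and L: "left_module R L" and fac: "composition_factor R M L"
    and a: "a \<in> carrier R" "\<And>x. x \<in> carrier M \<Longrightarrow> a \<odot>\<^bsub>M\<^esub> x = \<zero>\<^bsub>M\<^esub>" and y: "y \<in> carrier L"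
  shows "a \<odot>\<^bsub>L\<^esub> y = \<zero>\<^bsub>L\<^esub>"
proof -
  interpret M: left_module R M by fact
  interpret L: left_module R L by fact
  obtain Ns F f where series: "composition_series R M Ns" and F: "F \<in> set (series_factors M Ns)"
    and f: "f \<in> LinearCombinations.module_hom R L F" and bij: "bij_betw f (carrier L) (carrier F)"
    using fac unfolding composition_factor_def module_isomorphic_def by blast
  obtain i where i: "Suc i < length Ns" "F = quotient_module (M\<lparr>carrier := Ns ! Suc i\<rparr>) (Ns ! i)"
    using F by (auto simp: series_factors_nth)
  have lF: "left_module R F" using series F unfolding composition_series_def irreducible_module_def by blast
  have sub: "Module.submodule (Ns ! Suc i) R M" "Module.submodule (Ns ! i) R M"
    using series i unfolding composition_series_def by auto
  let ?M' = "M\<lparr>carrier := Ns ! Suc i\<rparr>"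
  interpret M': left_module R ?M' by (rule M.left_module_submodule[OF sub(1)])
  have subi: "Module.submodule (Ns ! i) R ?M'"
    using M.submodule_restrict_iff[OF sub(1)] sub(2) series i unfolding composition_series_def by simp
  have "f y \<in> carrier F" using module_homD(1)[OF f y] .
  then obtain u where u: "u \<in> carrier ?M'" "f y = Ns ! i +>\<^bsub>?M'\<^esub> u"
    unfolding i(2) by (auto simp: quotient_module_def A_RCOSETS_def')
  have "Ns ! i +>\<^bsub>?M'\<^esub> (a \<odot>\<^bsub>?M'\<^esub> z) = Ns ! i" if "z \<in> carrier ?M'" for z
  proof -
    have "a \<odot>\<^bsub>?M'\<^esub> z = \<zero>\<^bsub>?M'\<^esub>" using that a M.submodule_props(1)[OF sub(1)] by auto
    then show ?thesis
      using M'.submodule_props(1)[OF subi] M'.M.a_coset_add_zero by simp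
  qed
  moreover have "z \<in> carrier ?M'" if "z \<in> f y" for z
    using that M'.coset_mem_iff[OF subi u(1)] u(2) by auto
  moreover have "u \<in> f y"
    using M'.coset_mem_iff[OF subi u(1), of u] u M'.submodule_props(2)[OF subi] M'.M.r_neg[OF u(1)] by simp
  ultimately have "a \<odot>\<^bsub>F\<^esub> f y = \<zero>\<^bsub>F\<^esub>"
    unfolding i(2) by (auto simp: quotient_module_def)
  then have "f (a \<odot>\<^bsub>L\<^esub> y) = \<zero>\<^bsub>F\<^esub>" using module_homD(3)[OF f a(1) y] by simp
  then show ?thesis
    using module_hom_inj_iff[OF L lF f] bij L.smult_closed[OF a(1) y] by (auto simp: bij_betw_def)
qed

section \<open>The Hecke algebra and its modules\<close>

lemma poly_mapping_sum_single:
  fixes p :: "'a \<Rightarrow>\<^sub>0 'b::comm_monoid_add"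
  shows "p = (\<Sum>k\<in>Poly_Mapping.keys p. Poly_Mapping.single k (Poly_Mapping.lookup p k))"
  by (rule poly_mapping_eqI)
    (auto simp: lookup_sum lookup_single when_def in_keys_iff)

lemma poly_mapping_additive_induct:
  fixes p :: "'a \<Rightarrow>\<^sub>0 'b::comm_monoid_add"
  assumes "P 0" and "\<And>a b. P a \<Longrightarrow> P b \<Longrightarrow> P (a + b)" and "\<And>k c. P (Poly_Mapping.single k c)"
  shows "P p"
proof -
  have "P (\<Sum>k\<in>S. Poly_Mapping.single k (Poly_Mapping.lookup p k))" if "finite S" for S
    using that by induction (use assms in auto)
  then show ?thesis using poly_mapping_sum_single[of p] by (metis finite_keys)
qed

lemma free_C_simps:
  "free_C 0 = 0" "free_C 1 = 1" "free_C (c + d) = free_C c + free_C d"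
  "free_C (c * d) = free_C c * free_C d" "free_C (- c) = - free_C c" "free_C (c - d) = free_C c - free_C d"
  by (simp_all add: free_C_def single_add mult_single single_uminus single_diff)

lemma free_C_comm: "free_C c * a = a * free_C c"
proof (induction a rule: poly_mapping_additive_induct)
  case (2 a b)
  then show ?case by (simp add: algebra_simps)
next
  case (3 k d)
  then show ?case by (simp add: free_C_def mult_single mult.commute)
qed simp

lemma free_algebra_induct [case_names C T X add mult]:
  fixes a :: free_algebra
  assumes C: "\<And>c. P (free_C c)" and T: "\<And>i. P (free_T i)" and X: "\<And>l. P (free_X l)"
    and add: "\<And>a b. P a \<Longrightarrow> P b \<Longrightarrow> P (a + b)" and mult: "\<And>a b. P a \<Longrightarrow> P b \<Longrightarrow> P (a * b)"
  shows "P a"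
proof (induction a rule: poly_mapping_additive_induct)
  case 1
  then show ?case using C[of 0] by (simp add: free_C_simps)
next
  case (2 a b)
  then show ?case by (rule add)
next
  case (3 w c)
  have "P (Poly_Mapping.single (Word gs) 1)" for gs
  proof (induction gs)
    case Nil
    then show ?case using C[of 1] by (simp add: free_C_def zero_free_monoid_def)
  next
    case (Cons g gs)
    have "P (Poly_Mapping.single (Word [g]) 1)"
      using T X by (cases g) (auto simp: free_T_def free_X_def)
    moreover have "Poly_Mapping.single (Word (g # gs)) 1
        = Poly_Mapping.single (Word [g]) 1 * Poly_Mapping.single (Word gs) (1::complex)"
      by (simp add: mult_single)
    ultimately show ?case using mult Cons by simp
  qed
  then have "P (free_C c * Poly_Mapping.single w 1)" using C mult by (cases w) auto
  then show ?case by (simp add: free_C_def mult_single)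
qed

lemma ring_free_algebra: "ring (class_ring :: free_algebra ring)"
  by (rule class_ring.ring_axioms)

lemma ideal_relator_ideal: "ideal (relator_ideal q) class_ring"
  unfolding relator_ideal_def by (rule ring.genideal_ideal[OF ring_free_algebra]) simp

lemma relators_subset: "relators q \<subseteq> relator_ideal q"
  unfolding relator_ideal_def by (rule ring.genideal_self[OF ring_free_algebra]) simp

lemma relator_ideal_minimal: "ideal I class_ring \<Longrightarrow> relators q \<subseteq> I \<Longrightarrow> relator_ideal q \<subseteq> I"
  unfolding relator_ideal_def by (rule ring.genideal_minimal[OF ring_free_algebra])

lemma relator_ideal_closed:
  "0 \<in> relator_ideal q" "a \<in> relator_ideal q \<Longrightarrow> b \<in> relator_ideal q \<Longrightarrow> a + b \<in> relator_ideal q"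
  "a \<in> relator_ideal q \<Longrightarrow> b * a \<in> relator_ideal q" "a \<in> relator_ideal q \<Longrightarrow> a * b \<in> relator_ideal q"
proof -
  interpret ideal "relator_ideal q" "class_ring" by (rule ideal_relator_ideal)
  show "0 \<in> relator_ideal q" using zero_closed by simp
  show "a \<in> relator_ideal q \<Longrightarrow> b \<in> relator_ideal q \<Longrightarrow> a + b \<in> relator_ideal q"
    using a_closed[of a b] by simp
  show "a \<in> relator_ideal q \<Longrightarrow> b * a \<in> relator_ideal q" using I_l_closed[of a b] by simp
  show "a \<in> relator_ideal q \<Longrightarrow> a * b \<in> relator_ideal q" using I_r_closed[of a b] by simp
qed

lemma relator_ideal_uminus: "a \<in> relator_ideal q \<Longrightarrow> - a \<in> relator_ideal q"
  using relator_ideal_closed(3)[of a q "- 1"] by simp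

lemma relator_ideal_diff: "a \<in> relator_ideal q \<Longrightarrow> b \<in> relator_ideal q \<Longrightarrow> a - b \<in> relator_ideal q"
  using relator_ideal_closed(2)[of a q "- b"] relator_ideal_uminus[of b q] by simp

lemma hecke_relations:
  "free_X 0 - 1 \<in> relator_ideal q"
  "free_X l * free_X m - free_X (l + m) \<in> relator_ideal q"
  "free_T i * free_T i - (free_C (q - inverse q) * free_T i + 1) \<in> relator_ideal q"
  "free_T N1 * free_T N2 * free_T N1 * free_T N2 * free_T N1 * free_T N2
      - free_T N2 * free_T N1 * free_T N2 * free_T N1 * free_T N2 * free_T N1 \<in> relator_ideal q"
  "f * (1 - Poly_Mapping.single (- simple_root i) 1) =
        Poly_Mapping.single l 1 - Poly_Mapping.single (reflection i l) 1 \<Longrightarrow>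
   free_X l * free_T i
      - (free_T i * free_X (reflection i l) + free_C (q - inverse q) * free_X_lin f) \<in> relator_ideal q"
proof -
  note sub = subsetD[OF relators_subset[of q]]
  show "free_X 0 - 1 \<in> relator_ideal q" by (rule sub) (simp add: relators_def)
  show "free_X l * free_X m - free_X (l + m) \<in> relator_ideal q"
    by (rule sub, unfold relators_def) blast
  show "free_T i * free_T i - (free_C (q - inverse q) * free_T i + 1) \<in> relator_ideal q"
    by (rule sub, unfold relators_def power2_eq_square) blast
  show "free_T N1 * free_T N2 * free_T N1 * free_T N2 * free_T N1 * free_T N2
      - free_T N2 * free_T N1 * free_T N2 * free_T N1 * free_T N2 * free_T N1 \<in> relator_ideal q"
    by (rule sub) (simp add: relators_def)
  assume "f * (1 - Poly_Mapping.single (- simple_root i) 1) =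
        Poly_Mapping.single l 1 - Poly_Mapping.single (reflection i l) 1"
  then show "free_X l * free_T i
      - (free_T i * free_X (reflection i l) + free_C (q - inverse q) * free_X_lin f) \<in> relator_ideal q"
    by (intro sub, unfold relators_def) blast
qed

lemma ring_hecke: "ring (hecke q)"
  unfolding hecke_def by (rule ideal.quotient_is_ring[OF ideal_relator_ideal])

lemma hecke_proj_hom: "hecke_proj q \<in> Ring.ring_hom class_ring (hecke q)"
  using ideal.rcos_ring_hom[OF ideal_relator_ideal[of q]] unfolding hecke_proj_def[abs_def] hecke_def .

lemma hecke_proj_closed [simp]: "hecke_proj q a \<in> carrier (hecke q)"
  using ring_hom_closed[OF hecke_proj_hom] by simp

lemma hecke_proj_simps:
  "hecke_proj q (a + b) = hecke_proj q a \<oplus>\<^bsub>hecke q\<^esub> hecke_proj q b"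
  "hecke_proj q (a * b) = hecke_proj q a \<otimes>\<^bsub>hecke q\<^esub> hecke_proj q b"
  "hecke_proj q 1 = \<one>\<^bsub>hecke q\<^esub>"
  using ring_hom_add[OF hecke_proj_hom, of a b q] ring_hom_mult[OF hecke_proj_hom, of a b q]
    ring_hom_one[OF hecke_proj_hom, of q] by simp_all

lemma hecke_proj_zero: "hecke_proj q 0 = \<zero>\<^bsub>hecke q\<^esub>"
  using ring_hom_zero[OF hecke_proj_hom class_ring.ring_axioms ring_hecke] by simp

lemma hecke_proj_uminus: "hecke_proj q (- a) = \<ominus>\<^bsub>hecke q\<^esub> hecke_proj q a"
proof -
  interpret ring "hecke q" by (rule ring_hecke)
  have "hecke_proj q (- a) \<oplus>\<^bsub>hecke q\<^esub> hecke_proj q a = \<zero>\<^bsub>hecke q\<^esub>"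
    by (metis hecke_proj_simps(1) hecke_proj_zero left_minus)
  then show ?thesis using minus_equality by simp
qed

lemma hecke_proj_power: "hecke_proj q (a ^ k) = hecke_proj q a [^]\<^bsub>hecke q\<^esub> (k::nat)"
proof -
  interpret ring "hecke q" by (rule ring_hecke)
  show ?thesis 
    by (induction k) (simp_all add: hecke_proj_simps power_Suc2 del: power_Suc)
qed

lemma hecke_proj_eq_iff: "hecke_proj q a = hecke_proj q b \<longleftrightarrow> a - b \<in> relator_ideal q"
proof -
  have mem: "x \<in> hecke_proj q a \<longleftrightarrow> x - a \<in> relator_ideal q" for x a
    by (auto simp: hecke_proj_def a_r_coset_def' intro!: bexI[of _ "x - a"])
  show ?thesis
  proof
    assume "hecke_proj q a = hecke_proj q b"
    then show "a - b \<in> relator_ideal q"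
      using mem[of a a] mem[of a b] relator_ideal_closed(1)[of q] by simp
  next
    assume ab: "a - b \<in> relator_ideal q"
    have "x - a \<in> relator_ideal q \<longleftrightarrow> x - b \<in> relator_ideal q" for x
      using relator_ideal_closed(2)[OF _ ab, of "x - a"] relator_ideal_diff[OF _ ab, of "x - b"]
      by auto
    then show "hecke_proj q a = hecke_proj q b" using mem by blast
  qed
qed

lemma hecke_proj_surj: "r \<in> carrier (hecke q) \<Longrightarrow> \<exists>a. r = hecke_proj q a"
  by (auto simp: hecke_def FactRing_def A_RCOSETS_def' hecke_proj_def)

text \<open>
  Modules are studied through the action of the free algebra, whose elements form a type with ring
  operations; two of its elements act alike if they differ by an element of the ideal of relators.
\<close>

definition hact :: "complex \<Rightarrow> (hecke_elem, 'm) module \<Rightarrow> free_algebra \<Rightarrow> 'm \<Rightarrow> 'm" where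
  "hact q M a x = hecke_proj q a \<odot>\<^bsub>M\<^esub> x"

locale hecke_module = left_module "hecke q" M for q :: complex and M :: "(hecke_elem, 'm) module"
begin

lemma hact_closed [simp]: "x \<in> carrier M \<Longrightarrow> hact q M a x \<in> carrier M"
  by (simp add: hact_def smult_closed)

lemma hact_simps:
  assumes "x \<in> carrier M"
  shows "hact q M (a + b) x = hact q M a x \<oplus>\<^bsub>M\<^esub> hact q M b x"
    and "hact q M (a * b) x = hact q M a (hact q M b x)"
    and "hact q M 1 x = x" and "hact q M 0 x = \<zero>\<^bsub>M\<^esub>"
    and "hact q M (- a) x = \<ominus>\<^bsub>M\<^esub> hact q M a x"
proof -
  show plus: "hact q M (a + b) x = hact q M a x \<oplus>\<^bsub>M\<^esub> hact q M b x" for a b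
    using assms by (simp add: hact_def hecke_proj_simps smult_l_distr)
  show "hact q M (a * b) x = hact q M a (hact q M b x)" "hact q M 1 x = x"
    using assms by (simp_all add: hact_def hecke_proj_simps smult_assoc smult_one)
  show zero: "hact q M 0 x = \<zero>\<^bsub>M\<^esub>"
    using assms by (simp add: hact_def hecke_proj_zero)
  show "hact q M (- a) x = \<ominus>\<^bsub>M\<^esub> hact q M a x"
    using plus[of "- a" a] zero assms by (simp add: M.minus_equality)
qed

lemma hact_diff: "x \<in> carrier M \<Longrightarrow> hact q M (a - b) x = hact q M a x \<oplus>\<^bsub>M\<^esub> \<ominus>\<^bsub>M\<^esub> hact q M b x"
  using hact_simps(1,5)[of x] by (metis diff_conv_add_uminus)

lemma hact_add_right: 
  "x \<in> carrier M \<Longrightarrow> y \<in> carrier M \<Longrightarrow> hact q M a (x \<oplus>\<^bsub>M\<^esub> y) = hact q M a x \<oplus>\<^bsub>M\<^esub> hact q M a y"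
  by (simp add: hact_def smult_r_distr)

lemma hact_zero_right [simp]: "hact q M a \<zero>\<^bsub>M\<^esub> = \<zero>\<^bsub>M\<^esub>"
  by (simp add: hact_def)

lemma hact_cong: "a - b \<in> relator_ideal q \<Longrightarrow> hact q M a x = hact q M b x"
  unfolding hact_def using hecke_proj_eq_iff[of q a b] by simp

lemma submoduleI_generators:
  assumes "N \<subseteq> carrier M" and "\<zero>\<^bsub>M\<^esub> \<in> N" and "\<And>x y. x \<in> N \<Longrightarrow> y \<in> N \<Longrightarrow> x \<oplus>\<^bsub>M\<^esub> y \<in> N"
    and C: "\<And>c x. x \<in> N \<Longrightarrow> hact q M (free_C c) x \<in> N"
    and T: "\<And>i x. x \<in> N \<Longrightarrow> hact q M (free_T i) x \<in> N"
    and X: "\<And>l x. x \<in> N \<Longrightarrow> hact q M (free_X l) x \<in> N"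
  shows "Module.submodule N (hecke q) M"
proof -
  have "\<forall>x\<in>N. hact q M a x \<in> N" for a
    by (induction a rule: free_algebra_induct) (use assms in \<open>auto simp: hact_simps subset_iff\<close>)
  then show ?thesis
    using assms(1-3) by (intro left_submoduleI) (auto simp: hact_def dest!: hecke_proj_surj)
qed

end

lemma module_homI_generators:
  assumes M: "hecke_module q M" and N: "hecke_module q N"
    and closed: "\<And>x. x \<in> carrier M \<Longrightarrow> f x \<in> carrier N"
    and add: "\<And>x y. x \<in> carrier M \<Longrightarrow> y \<in> carrier M \<Longrightarrow> f (x \<oplus>\<^bsub>M\<^esub> y) = f x \<oplus>\<^bsub>N\<^esub> f y"
    and gens: "\<And>c x. x \<in> carrier M \<Longrightarrow> f (hact q M (free_C c) x) = hact q N (free_C c) (f x)"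
      "\<And>i x. x \<in> carrier M \<Longrightarrow> f (hact q M (free_T i) x) = hact q N (free_T i) (f x)"
      "\<And>l x. x \<in> carrier M \<Longrightarrow> f (hact q M (free_X l) x) = hact q N (free_X l) (f x)"
  shows "f \<in> LinearCombinations.module_hom (hecke q) M N"
proof -
  interpret M: hecke_module q M by fact
  interpret N: hecke_module q N by fact
  have "\<forall>x\<in>carrier M. f (hact q M a x) = hact q N a (f x)" for a
    by (induction a rule: free_algebra_induct)
      (use gens closed add in \<open>auto simp: M.hact_simps N.hact_simps\<close>)
  then show ?thesis
    using closed add by (intro module_homI) (auto simp: hact_def dest!: hecke_proj_surj)
qed

lemma module_hom_hact:
  "f \<in> LinearCombinations.module_hom (hecke q) M N \<Longrightarrow> x \<in> carrier M \<Longrightarrow>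
   f (hact q M a x) = hact q N a (f x)"
  unfolding hact_def by (rule module_homD(3)[OF _ hecke_proj_closed])

section \<open>Dimensions\<close>

lemma complex_space_simps [simp]:
  "carrier (complex_space q M) = carrier M" "ring.add (complex_space q M) = ring.add M"
  "ring.zero (complex_space q M) = ring.zero M" "c \<odot>\<^bsub>complex_space q M\<^esub> x = hecke_C q c \<odot>\<^bsub>M\<^esub> x"
  by (simp_all add: complex_space_def)

lemma hecke_C_simps:
  "hecke_C q (c + d) = hecke_C q c \<oplus>\<^bsub>hecke q\<^esub> hecke_C q d"
  "hecke_C q (c * d) = hecke_C q c \<otimes>\<^bsub>hecke q\<^esub> hecke_C q d" "hecke_C q 1 = \<one>\<^bsub>hecke q\<^esub>"
  by (simp_all add: hecke_C_def free_C_simps hecke_proj_simps)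

text \<open>
  \<open>R\<close> is the Hecke algebra itself or one of its parabolic subalgebras.
\<close>

lemma vectorspace_complex_space:
  assumes M: "left_module R M" and sub: "range (hecke_C q) \<subseteq> carrier R"
    and ops: "ring.add R = ring.add (hecke q)" "monoid.mult R = monoid.mult (hecke q)" "\<one>\<^bsub>R\<^esub> = \<one>\<^bsub>hecke q\<^esub>"
  shows "vectorspace class_ring (complex_space q M)"
proof -
  interpret left_module R M by fact
  have C: "hecke_C q c \<in> carrier R" for c using sub by auto
  have "abelian_group (complex_space q M)"
  proof (rule abelian_groupI)
    fix x assume "x \<in> carrier (complex_space q M)"
    then show "\<exists>y\<in>carrier (complex_space q M). y \<oplus>\<^bsub>complex_space q M\<^esub> x = \<zero>\<^bsub>complex_space q M\<^esub>"
      by (auto intro!: bexI[of _ "\<ominus>\<^bsub>M\<^esub> x"] simp: M.l_neg)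
  qed (auto simp: M.a_ac)
  then show ?thesis
    unfolding vectorspace_def
    using smult_l_distr[OF C C] smult_r_distr[OF C] smult_assoc[OF C C] smult_closed[OF C] smult_one
    by (intro conjI moduleI class_field class_cring.cring_axioms)
      (auto simp: hecke_C_simps ops)
qed

lemma hecke_C_in [simp]: "hecke_C q c \<in> carrier (hecke q)" by (simp add: hecke_C_def)

lemma vectorspace_hecke_module:
  "left_module (hecke q) M \<Longrightarrow> vectorspace class_ring (complex_space q M)"
  by (rule vectorspace_complex_space) auto

lemma (in vectorspace) dim_one_criterion:
  assumes b: "b \<in> carrier V" "b \<noteq> \<zero>\<^bsub>V\<^esub>"
    and gen: "\<And>x. x \<in> carrier V \<Longrightarrow> \<exists>c\<in>carrier K. x = c \<odot>\<^bsub>V\<^esub> b"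
  shows "fin_dim \<and> dim = 1"
proof -
  have "x \<in> span {b}" if x: "x \<in> carrier V" for x
  proof -
    obtain c where c: "c \<in> carrier K" "x = c \<odot>\<^bsub>V\<^esub> b" using gen[OF x] by auto
    then have "x = lincomb (\<lambda>_. c) {b}" using b unfolding lincomb_def by simp
    then show ?thesis unfolding span_def using c by auto
  qed
  then have gs: "gen_set {b}" using span_is_subset2[of "{b}"] b by auto
  then have "fin_dim" unfolding fin_dim_def using b(1) by (intro exI[of _ "{b}"]) simp
  then show ?thesis using dim1I[OF gs] b by simp
qed

lemma (in vectorspace) dim_two_criterion:
  assumes b: "b \<in> carrier V" "b' \<in> carrier V" "b \<noteq> b'"
    and gen: "\<And>x. x \<in> carrier V \<Longrightarrow> \<exists>c\<in>carrier K. \<exists>d\<in>carrier K. x = c \<odot>\<^bsub>V\<^esub> b \<oplus>\<^bsub>V\<^esub> d \<odot>\<^bsub>V\<^esub> b'"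
    and indep: "\<And>c d. c \<in> carrier K \<Longrightarrow> d \<in> carrier K \<Longrightarrow>
      c \<odot>\<^bsub>V\<^esub> b \<oplus>\<^bsub>V\<^esub> d \<odot>\<^bsub>V\<^esub> b' = \<zero>\<^bsub>V\<^esub> \<Longrightarrow> c = \<zero>\<^bsub>K\<^esub> \<and> d = \<zero>\<^bsub>K\<^esub>"
  shows "fin_dim \<and> dim = 2"
proof -
  have lc: "lincomb a {b, b'} = a b \<odot>\<^bsub>V\<^esub> b \<oplus>\<^bsub>V\<^esub> a b' \<odot>\<^bsub>V\<^esub> b'"
    if "a b \<in> carrier K" "a b' \<in> carrier K" for a
    using that b unfolding lincomb_def by simp
  have "x \<in> span {b, b'}" if x: "x \<in> carrier V" for x
  proof -
    obtain c d where c: "c \<in> carrier K" "d \<in> carrier K" "x = c \<odot>\<^bsub>V\<^esub> b \<oplus>\<^bsub>V\<^esub> d \<odot>\<^bsub>V\<^esub> b'"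
      using gen[OF x] by auto
    let ?a = "\<lambda>u. if u = b then c else d"
    have "x = lincomb ?a {b, b'}" using lc[of ?a] c b(3) by simp
    then show ?thesis unfolding span_def using c by (auto intro!: exI[of _ ?a] exI[of _ "{b, b'}"])
  qed
  then have gs: "gen_set {b, b'}" using span_is_subset2[of "{b, b'}"] b by auto
  have "lin_indpt {b, b'}"
    by (rule finite_lin_indpt2) (use b indep lc in auto)
  then have "basis {b, b'}" using gs b unfolding basis_def by auto
  then have "dim = card {b, b'}" by (intro dim_basis) auto
  moreover have "fin_dim" unfolding fin_dim_def by (rule exI[of _ "{b, b'}"]) (use gs b in simp)
  ultimately show ?thesis using b(3) by simp
qed

lemma (in vectorspace) dim_one_span:
  assumes "fin_dim" "dim = 1" and b: "b \<in> carrier V" "b \<noteq> \<zero>\<^bsub>V\<^esub>" and x: "x \<in> carrier V"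
  shows "\<exists>c\<in>carrier K. x = c \<odot>\<^bsub>V\<^esub> b"
proof -
  have "lin_indpt {}" by (rule finite_lin_indpt2) auto
  then have "lin_indpt {b}"
    using lin_dep_iff_in_span[of "{}" b] b by (simp add: span_empty)
  then have "basis {b}" using dim_li_is_basis[of "{b}"] assms by auto
  then have "x \<in> span {b}" using x unfolding basis_def by auto
  then obtain A a where A: "A \<subseteq> {b}" "a \<in> A \<rightarrow> carrier K" "x = lincomb a A" unfolding span_def by auto
  then consider "A = {}" | "A = {b}" by auto
  then show ?thesis
  proof cases
    case 1
    then have "x = \<zero>\<^bsub>K\<^esub> \<odot>\<^bsub>V\<^esub> b" using A b by simp
    then show ?thesis by blast
  next
    case 2
    then show ?thesis using A b unfolding lincomb_def by auto
  qed
qed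

section \<open>Induced modules\<close>

locale induction_data =
  fixes A :: "'a ring" and B :: "'a ring" and V :: "('a, 'v) module"
  assumes ring_A: "ring A" and sub_B: "carrier B \<subseteq> carrier A"
    and V_add: "v \<in> carrier V \<Longrightarrow> v' \<in> carrier V \<Longrightarrow> v \<oplus>\<^bsub>V\<^esub> v' \<in> carrier V"
    and V_smult: "b \<in> carrier B \<Longrightarrow> v \<in> carrier V \<Longrightarrow> b \<odot>\<^bsub>V\<^esub> v \<in> carrier V"
begin

sublocale A: ring A by (rule ring_A)

abbreviation "S \<equiv> carrier A \<times> carrier V"
abbreviation "F \<equiv> free_Abelian_group S"
abbreviation "rels \<equiv> tensor_relations A B V"
abbreviation "K \<equiv> generate F rels"
abbreviation "Ind \<equiv> induced_module A B V"

text \<open>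
  Left multiplication by \<open>a\<close> on the free abelian group. It preserves the relations of the tensor
  product and therefore descends to the induced module.
\<close>

definition lmul :: "'a \<Rightarrow> ('a \<times> 'v \<Rightarrow>\<^sub>0 int) \<Rightarrow> ('a \<times> 'v \<Rightarrow>\<^sub>0 int)" where
  "lmul a = frag_extend (\<lambda>(a', v). frag_of (a \<otimes>\<^bsub>A\<^esub> a', v))"

definition tens :: "'a \<Rightarrow> 'v \<Rightarrow> ('a \<times> 'v \<Rightarrow>\<^sub>0 int) set" where
  "tens a v = K #>\<^bsub>F\<^esub> frag_of (a, v)"

lemma carrier_F_closed:
  "0 \<in> carrier F" "x \<in> carrier F \<Longrightarrow> y \<in> carrier F \<Longrightarrow> x + y \<in> carrier F"
  "x \<in> carrier F \<Longrightarrow> y \<in> carrier F \<Longrightarrow> x - y \<in> carrier F" "x \<in> carrier F \<Longrightarrow> - x \<in> carrier F"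
  "s \<in> S \<Longrightarrow> frag_of s \<in> carrier F"
  using keys_add[of x y] keys_diff[of x y] by auto

lemma F_inv: "x \<in> carrier F \<Longrightarrow> inv\<^bsub>F\<^esub> x = - x"
  by simp

declare carrier_free_Abelian_group_iff [simp del]

sublocale F: comm_group F by (rule abelian_free_Abelian_group)

lemma rels_sub: "rels \<subseteq> carrier F"
proof -
  have "B_elem \<in> carrier A" if "B_elem \<in> carrier B" for B_elem using that sub_B by auto
  then have "r \<in> carrier F" if "r \<in> rels" for r
    using that V_add V_smult unfolding tensor_relations_def
    by (elim UnE CollectE exE conjE) (simp_all only:, (intro carrier_F_closed(3,5); simp)+)
  then show ?thesis by blast
qed

lemma subgroup_K: "subgroup K F"
  by (rule F.generate_is_subgroup[OF rels_sub])

lemma normal_K: "normal K F"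
  by (rule F.subgroup_imp_normal[OF subgroup_K])

lemma K_sub: "K \<subseteq> carrier F" using subgroup.subset[OF subgroup_K] .

lemma K_closed: "0 \<in> K" "x \<in> K \<Longrightarrow> y \<in> K \<Longrightarrow> x + y \<in> K" "x \<in> K \<Longrightarrow> - x \<in> K"
proof -
  show "0 \<in> K" using subgroup.one_closed[OF subgroup_K] by simp
  show "x \<in> K \<Longrightarrow> y \<in> K \<Longrightarrow> x + y \<in> K" using subgroup.m_closed[OF subgroup_K, of x y] by simp
  show "x \<in> K \<Longrightarrow> - x \<in> K"
    using subgroup.m_inv_closed[OF subgroup_K, of x] K_sub F_inv by (auto simp: subset_iff)
qed

lemma coset_mem: "x \<in> carrier F \<Longrightarrow> y \<in> K #>\<^bsub>F\<^esub> x \<longleftrightarrow> y - x \<in> K"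
  by (auto simp: r_coset_def intro!: bexI[of _ "y - x"])

lemma coset_eq: 
  assumes "x \<in> carrier F" "y \<in> carrier F"
  shows "K #>\<^bsub>F\<^esub> x = K #>\<^bsub>F\<^esub> y \<longleftrightarrow> x - y \<in> K"
proof
  assume "K #>\<^bsub>F\<^esub> x = K #>\<^bsub>F\<^esub> y"
  then show "x - y \<in> K" using coset_mem[OF assms(1), of x] coset_mem[OF assms(2), of x] K_closed(1) by simp
next
  assume xy: "x - y \<in> K"
  have "z - x \<in> K \<longleftrightarrow> z - y \<in> K" for z
    using K_closed(2)[OF _ xy, of "z - x"] K_closed(2)[OF _ K_closed(3)[OF xy], of "z - y"] by auto
  then show "K #>\<^bsub>F\<^esub> x = K #>\<^bsub>F\<^esub> y"
    using coset_mem[OF assms(1)] coset_mem[OF assms(2)] by blast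
qed

lemma lmul_simps [simp]:
  "lmul a 0 = 0" "lmul a (x + y) = lmul a x + lmul a y" "lmul a (x - y) = lmul a x - lmul a y"
  "lmul a (- x) = - lmul a x" "lmul a (frag_of (a', v)) = frag_of (a \<otimes>\<^bsub>A\<^esub> a', v)"
  by (simp_all add: lmul_def frag_extend_add frag_extend_diff frag_extend_minus)

lemma F_induct [consumes 1, case_names zero diff frag]:
  assumes "x \<in> carrier F" and "P 0" and "\<And>x y. x \<in> carrier F \<Longrightarrow> y \<in> carrier F \<Longrightarrow> P x \<Longrightarrow> P y \<Longrightarrow> P (x - y)"
    and "\<And>a v. a \<in> carrier A \<Longrightarrow> v \<in> carrier V \<Longrightarrow> P (frag_of (a, v))"
  shows "P x"
  by (rule free_Abelian_group_induct[of x S P]) (use assms in \<open>auto simp: carrier_free_Abelian_group_iff\<close>)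

lemma lmul_closed: "a \<in> carrier A \<Longrightarrow> x \<in> carrier F \<Longrightarrow> lmul a x \<in> carrier F"
  by (rule F_induct[of x])
    (simp_all only: lmul_simps carrier_F_closed(1,3), auto intro!: carrier_F_closed(5))

lemma relsE:
  assumes "r \<in> rels"
  obtains a a' v where "a \<in> carrier A" "a' \<in> carrier A" "v \<in> carrier V"
      "r = frag_of (a \<oplus>\<^bsub>A\<^esub> a', v) - frag_of (a, v) - frag_of (a', v)"
    | a v v' where "a \<in> carrier A" "v \<in> carrier V" "v' \<in> carrier V"
      "r = frag_of (a, v \<oplus>\<^bsub>V\<^esub> v') - frag_of (a, v) - frag_of (a, v')"
    | a b v where "a \<in> carrier A" "b \<in> carrier B" "v \<in> carrier V"
      "r = frag_of (a \<otimes>\<^bsub>A\<^esub> b, v) - frag_of (a, b \<odot>\<^bsub>V\<^esub> v)"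
  using assms unfolding tensor_relations_def
  by (elim UnE CollectE exE conjE)
    ((rule that(1); assumption), (rule that(2); assumption), (rule that(3); assumption))

lemma relsI:
  assumes "a \<in> carrier A" "v \<in> carrier V"
  shows "a' \<in> carrier A \<Longrightarrow> frag_of (a \<oplus>\<^bsub>A\<^esub> a', v) - frag_of (a, v) - frag_of (a', v) \<in> K"
    and "v' \<in> carrier V \<Longrightarrow> frag_of (a, v \<oplus>\<^bsub>V\<^esub> v') - frag_of (a, v) - frag_of (a, v') \<in> K"
    and "b \<in> carrier B \<Longrightarrow> frag_of (a \<otimes>\<^bsub>A\<^esub> b, v) - frag_of (a, b \<odot>\<^bsub>V\<^esub> v) \<in> K"
proof -
  have sub: "rels \<subseteq> K" by (rule subsetI, rule generate.incl)
  { assume "a' \<in> carrier A"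
    have "frag_of (a \<oplus>\<^bsub>A\<^esub> a', v) - frag_of (a, v) - frag_of (a', v) \<in> rels"
      unfolding tensor_relations_def
      by (rule UnI1, rule UnI1, intro CollectI exI conjI) (rule refl assms \<open>a' \<in> carrier A\<close>)+
    then show "frag_of (a \<oplus>\<^bsub>A\<^esub> a', v) - frag_of (a, v) - frag_of (a', v) \<in> K" by (rule subsetD[OF sub]) }
  { assume "v' \<in> carrier V"
    have "frag_of (a, v \<oplus>\<^bsub>V\<^esub> v') - frag_of (a, v) - frag_of (a, v') \<in> rels"
      unfolding tensor_relations_def
      by (rule UnI1, rule UnI2, intro CollectI exI conjI) (rule refl assms \<open>v' \<in> carrier V\<close>)+
    then show "frag_of (a, v \<oplus>\<^bsub>V\<^esub> v') - frag_of (a, v) - frag_of (a, v') \<in> K" by (rule subsetD[OF sub]) }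
  { assume "b \<in> carrier B"
    have "frag_of (a \<otimes>\<^bsub>A\<^esub> b, v) - frag_of (a, b \<odot>\<^bsub>V\<^esub> v) \<in> rels"
      unfolding tensor_relations_def
      by (rule UnI2, intro CollectI exI conjI) (rule refl assms \<open>b \<in> carrier B\<close>)+
    then show "frag_of (a \<otimes>\<^bsub>A\<^esub> b, v) - frag_of (a, b \<odot>\<^bsub>V\<^esub> v) \<in> K" by (rule subsetD[OF sub]) }
qed

lemma lmul_rels:
  assumes a: "a \<in> carrier A" and r: "r \<in> rels"
  shows "lmul a r \<in> K"
  using r
proof (cases rule: relsE)
  case (1 c c' v)
  then show ?thesis using relsI(1)[of "a \<otimes>\<^bsub>A\<^esub> c" v "a \<otimes>\<^bsub>A\<^esub> c'"] a by (simp only: lmul_simps A.r_distr A.m_closed)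
next
  case (2 c v v')
  then show ?thesis using relsI(2)[of "a \<otimes>\<^bsub>A\<^esub> c" v v'] a by (simp only: lmul_simps A.m_closed)
next
  case (3 c b v)
  then have "b \<in> carrier A" using sub_B by auto
  then have "a \<otimes>\<^bsub>A\<^esub> c \<otimes>\<^bsub>A\<^esub> b = a \<otimes>\<^bsub>A\<^esub> (c \<otimes>\<^bsub>A\<^esub> b)" using 3 a A.m_assoc by simp
  then show ?thesis using 3 relsI(3)[of "a \<otimes>\<^bsub>A\<^esub> c" v b] a by (simp only: lmul_simps A.m_closed)
qed

lemma lmul_K:
  assumes a: "a \<in> carrier A" and x: "x \<in> K"
  shows "lmul a x \<in> K"
  using x
proof (induction x rule: generate.induct)
  case one
  then show ?case using K_closed(1) by simp
next
  case (incl h)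
  then show ?case by (rule lmul_rels[OF a])
next
  case (inv h)
  then have "inv\<^bsub>F\<^esub> h = - h" using rels_sub F_inv by (auto simp: subset_iff)
  then show ?case using K_closed(3)[OF lmul_rels[OF a inv]] by simp
next
  case (eng h1 h2)
  then show ?case using K_closed(2) by simp
qed

lemma Ind_carrier: "carrier Ind = (\<lambda>x. K #>\<^bsub>F\<^esub> x) ` carrier F"
  unfolding induced_module_def Let_def by (auto simp: FactGroup_def RCOSETS_def)

lemma Ind_zero: "\<zero>\<^bsub>Ind\<^esub> = K #>\<^bsub>F\<^esub> 0"
  using F.coset_join2[of 0 K] subgroup_K K_closed(1) carrier_F_closed(1)
  unfolding induced_module_def Let_def by (simp add: FactGroup_def)

lemma Ind_add:
  "x \<in> carrier F \<Longrightarrow> y \<in> carrier F \<Longrightarrow> (K #>\<^bsub>F\<^esub> x) \<oplus>\<^bsub>Ind\<^esub> (K #>\<^bsub>F\<^esub> y) = K #>\<^bsub>F\<^esub> (x + y)"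
  using normal.rcos_sum[OF normal_K, of x y]
  unfolding induced_module_def Let_def by (simp add: FactGroup_def)

lemma Ind_smult:
  assumes a: "a \<in> carrier A" and x: "x \<in> carrier F"
  shows "a \<odot>\<^bsub>Ind\<^esub> (K #>\<^bsub>F\<^esub> x) = K #>\<^bsub>F\<^esub> lmul a x"
proof -
  let ?C = "K #>\<^bsub>F\<^esub> x"
  have eq: "K #>\<^bsub>F\<^esub> lmul a z = K #>\<^bsub>F\<^esub> lmul a x" if z: "z \<in> ?C" for z
  proof -
    have d: "z - x \<in> K" using z coset_mem[OF x] by simp
    then have "z \<in> carrier F" using carrier_F_closed(2)[OF _ x, of "z - x"] K_sub by auto
    then show ?thesis
      using lmul_K[OF a d] coset_eq[of "lmul a z" "lmul a x"] lmul_closed[OF a] x by simp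
  qed
  have "?C \<noteq> {}" using coset_mem[OF x, of x] K_closed(1) by auto
  then have "(\<Union>z\<in>?C. K #>\<^bsub>F\<^esub> lmul a z) = K #>\<^bsub>F\<^esub> lmul a x" by (rule SUP_eq_const) (rule eq)
  then show ?thesis unfolding induced_module_def Let_def lmul_def by simp
qed

text \<open>
  On the free abelian group, unlike associativity, additivity in the acting ring holds only modulo
  the relations.
\<close>

lemma lmul_add_left:
  assumes "a \<in> carrier A" "b \<in> carrier A" and x: "x \<in> carrier F"
  shows "lmul (a \<oplus>\<^bsub>A\<^esub> b) x - (lmul a x + lmul b x) \<in> K"
  using x
proof (induction rule: F_induct)
  case zero
  then show ?case using K_closed(1) by simp
next
  case (diff x y)
  have eq: "lmul (a \<oplus>\<^bsub>A\<^esub> b) (x - y) - (lmul a (x - y) + lmul b (x - y))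
      = (lmul (a \<oplus>\<^bsub>A\<^esub> b) x - (lmul a x + lmul b x)) + - (lmul (a \<oplus>\<^bsub>A\<^esub> b) y - (lmul a y + lmul b y))"
    by simp
  show ?case unfolding eq by (rule K_closed(2)[OF diff(3) K_closed(3)[OF diff(4)]])
next
  case (frag c v)
  then show ?case
    using relsI(1)[of "a \<otimes>\<^bsub>A\<^esub> c" v "b \<otimes>\<^bsub>A\<^esub> c"] assms
    by (simp only: lmul_simps A.l_distr A.m_closed diff_diff_eq)
qed

lemma lmul_mult:
  assumes "a \<in> carrier A" "b \<in> carrier A" and x: "x \<in> carrier F"
  shows "lmul (a \<otimes>\<^bsub>A\<^esub> b) x = lmul a (lmul b x)"
  using x by (induction rule: F_induct) (simp_all add: assms A.m_assoc)

lemma lmul_one: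
  assumes x: "x \<in> carrier F"
  shows "lmul \<one>\<^bsub>A\<^esub> x = x"
  using x by (induction rule: F_induct) simp_all

lemma left_module_Ind: "left_module A Ind"
proof (intro left_module.intro left_module_axioms.intro)
  show "abelian_group Ind"
  proof (rule abelian_groupI)
    fix x assume "x \<in> carrier Ind"
    then obtain z where z: "z \<in> carrier F" "x = K #>\<^bsub>F\<^esub> z" using Ind_carrier by auto
    then have "(K #>\<^bsub>F\<^esub> (- z)) \<oplus>\<^bsub>Ind\<^esub> x = \<zero>\<^bsub>Ind\<^esub>"
      using Ind_add[of "- z" z] carrier_F_closed(4)[of z] by (simp add: Ind_zero)
    then show "\<exists>y\<in>carrier Ind. y \<oplus>\<^bsub>Ind\<^esub> x = \<zero>\<^bsub>Ind\<^esub>"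
      using z carrier_F_closed(4)[of z] Ind_carrier by blast
  qed (auto simp: Ind_carrier Ind_zero Ind_add carrier_F_closed(1,2) add_ac)
  show "ring A" by (rule ring_A)
  have ex: "\<exists>z\<in>carrier F. x = K #>\<^bsub>F\<^esub> z" if "x \<in> carrier Ind" for x
    using that Ind_carrier by auto
  show "a \<odot>\<^bsub>Ind\<^esub> x \<in> carrier Ind" if "a \<in> carrier A" "x \<in> carrier Ind" for a x
    using ex[OF that(2)] that(1) Ind_smult lmul_closed Ind_carrier by auto
  show "\<one>\<^bsub>A\<^esub> \<odot>\<^bsub>Ind\<^esub> x = x" if "x \<in> carrier Ind" for x
    using ex[OF that] Ind_smult[OF A.one_closed] lmul_one by auto
  show "(a \<oplus>\<^bsub>A\<^esub> b) \<odot>\<^bsub>Ind\<^esub> x = a \<odot>\<^bsub>Ind\<^esub> x \<oplus>\<^bsub>Ind\<^esub> b \<odot>\<^bsub>Ind\<^esub> x"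
    if ab: "a \<in> carrier A" "b \<in> carrier A" and x: "x \<in> carrier Ind" for a b x
  proof -
    obtain z where "z \<in> carrier F" "x = K #>\<^bsub>F\<^esub> z" using ex[OF x] by auto
    then show ?thesis
      using ab Ind_smult Ind_add lmul_closed lmul_add_left[of a b z]
        coset_eq[of "lmul (a \<oplus>\<^bsub>A\<^esub> b) z" "lmul a z + lmul b z"] carrier_F_closed(2)
      by simp
  qed
  show "(a \<otimes>\<^bsub>A\<^esub> b) \<odot>\<^bsub>Ind\<^esub> x = a \<odot>\<^bsub>Ind\<^esub> (b \<odot>\<^bsub>Ind\<^esub> x)"
    if "a \<in> carrier A" "b \<in> carrier A" "x \<in> carrier Ind" for a b x
    using ex[OF that(3)] that(1,2) Ind_smult lmul_closed lmul_mult by auto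
  show "a \<odot>\<^bsub>Ind\<^esub> (x \<oplus>\<^bsub>Ind\<^esub> y) = a \<odot>\<^bsub>Ind\<^esub> x \<oplus>\<^bsub>Ind\<^esub> a \<odot>\<^bsub>Ind\<^esub> y"
    if "a \<in> carrier A" "x \<in> carrier Ind" "y \<in> carrier Ind" for a x y
    using ex[OF that(2)] ex[OF that(3)] that(1) Ind_smult Ind_add lmul_closed carrier_F_closed(2) by auto
qed

lemma tens_closed: "a \<in> carrier A \<Longrightarrow> v \<in> carrier V \<Longrightarrow> tens a v \<in> carrier Ind"
  unfolding tens_def Ind_carrier by (intro imageI carrier_F_closed(5)) simp

lemma smult_tens:
  "a \<in> carrier A \<Longrightarrow> a' \<in> carrier A \<Longrightarrow> v \<in> carrier V \<Longrightarrow> a \<odot>\<^bsub>Ind\<^esub> tens a' v = tens (a \<otimes>\<^bsub>A\<^esub> a') v"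
  unfolding tens_def using Ind_smult[of a "frag_of (a', v)"] carrier_F_closed(5)[of "(a', v)"] by simp

lemma tens_balanced:
  assumes "a \<in> carrier A" "b \<in> carrier B" "v \<in> carrier V"
  shows "tens (a \<otimes>\<^bsub>A\<^esub> b) v = tens a (b \<odot>\<^bsub>V\<^esub> v)"
proof -
  have "b \<in> carrier A" using assms sub_B by auto
  then show ?thesis
    unfolding tens_def using assms relsI(3)[of a v b] V_smult
    by (subst coset_eq) (auto intro!: carrier_F_closed(5))
qed

text \<open>
  The elements $1 \otimes v$ generate, because $a \otimes v = a(1 \otimes v)$.
\<close>

lemma submodule_tens_carrier:
  assumes N: "Module.submodule N A Ind" and tens: "\<And>v. v \<in> carrier V \<Longrightarrow> tens \<one>\<^bsub>A\<^esub> v \<in> N"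
  shows "N = carrier Ind"
proof -
  interpret Ind: left_module A Ind by (rule left_module_Ind)
  note Np = Ind.submodule_props[OF N]
  have "K #>\<^bsub>F\<^esub> x \<in> N" if "x \<in> carrier F" for x
    using that
  proof (induction rule: F_induct)
    case zero
    then show ?case using Np(2) Ind_zero by simp
  next
    case (diff x y)
    have y: "- y \<in> carrier F" by (rule carrier_F_closed(4)[OF diff(2)])
    have "K #>\<^bsub>F\<^esub> (- y) = \<ominus>\<^bsub>Ind\<^esub> (K #>\<^bsub>F\<^esub> y)"
      using Ind.M.minus_equality[of "K #>\<^bsub>F\<^esub> (- y)" "K #>\<^bsub>F\<^esub> y"] Ind_add[OF y diff(2)] Ind_zero Ind_carrier diff(2) y
      by simp
    then have "K #>\<^bsub>F\<^esub> (- y) \<in> N" using Np(4) diff(4) by simp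
    then have "(K #>\<^bsub>F\<^esub> x) \<oplus>\<^bsub>Ind\<^esub> (K #>\<^bsub>F\<^esub> (- y)) \<in> N" using Np(3) diff(3) by blast
    then show ?case using Ind_add[OF diff(1) y] by simp
  next
    case (frag a v)
    have "a \<odot>\<^bsub>Ind\<^esub> tens \<one>\<^bsub>A\<^esub> v \<in> N" using Np(5) tens frag by simp
    then show ?case using smult_tens[of a "\<one>\<^bsub>A\<^esub>" v] frag by (simp add: tens_def)
  qed
  then show ?thesis using Np(1) Ind_carrier by auto
qed

text \<open>
  The rule $(a, v) \mapsto a\,g(v)$ extends to the free abelian group and annihilates each of the
  three kinds of relations.
\<close>

theorem induced_module_universal:
  fixes L :: "('a, 'l) module"
  assumes L: "left_module A L"
    and g: "\<And>v. v \<in> carrier V \<Longrightarrow> g v \<in> carrier L"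
    and g_add: "\<And>v v'. v \<in> carrier V \<Longrightarrow> v' \<in> carrier V \<Longrightarrow> g (v \<oplus>\<^bsub>V\<^esub> v') = g v \<oplus>\<^bsub>L\<^esub> g v'"
    and g_smult: "\<And>b v. b \<in> carrier B \<Longrightarrow> v \<in> carrier V \<Longrightarrow> g (b \<odot>\<^bsub>V\<^esub> v) = b \<odot>\<^bsub>L\<^esub> g v"
  obtains f where "f \<in> LinearCombinations.module_hom A Ind L"
    and "\<And>v. v \<in> carrier V \<Longrightarrow> f (tens \<one>\<^bsub>A\<^esub> v) = g v"
proof -
  interpret L: left_module A L by fact
  have cg: "comm_group (add_monoid L)" by (rule L.M.a_comm_group)
  have im: "(\<lambda>(a, v). a \<odot>\<^bsub>L\<^esub> g v) ` S \<subseteq> carrier (add_monoid L)" using g L.smult_closed by auto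
  obtain h where hom: "h \<in> hom F (add_monoid L)"
    and h': "\<And>s. s \<in> S \<Longrightarrow> h (frag_of s) = (case s of (a, v) \<Rightarrow> a \<odot>\<^bsub>L\<^esub> g v)"
    using comm_group.free_Abelian_group_universal[OF cg im] by metis
  have h_of: "h (frag_of (a, v)) = a \<odot>\<^bsub>L\<^esub> g v" if "a \<in> carrier A" "v \<in> carrier V" for a v
    using h'[of "(a, v)"] that by simp
  have h_closed: "h x \<in> carrier L" if "x \<in> carrier F" for x
    using hom that unfolding hom_def by auto
  have h_add: "h (x + y) = h x \<oplus>\<^bsub>L\<^esub> h y" if "x \<in> carrier F" "y \<in> carrier F" for x y
    using hom that unfolding hom_def by auto
  have h_0: "h 0 = \<zero>\<^bsub>L\<^esub>"
    using h_add[OF carrier_F_closed(1) carrier_F_closed(1)] h_closed[OF carrier_F_closed(1)]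
    by (simp add: L.M.add.l_cancel_one')
  have h_neg: "h (- x) = \<ominus>\<^bsub>L\<^esub> h x" if "x \<in> carrier F" for x
    using h_add[OF carrier_F_closed(4)[OF that] that] h_0 h_closed[OF that] h_closed[OF carrier_F_closed(4)[OF that]]
    by (simp add: L.M.minus_equality)
  have h_diff: "h (x - y) = h x \<oplus>\<^bsub>L\<^esub> \<ominus>\<^bsub>L\<^esub> h y" if "x \<in> carrier F" "y \<in> carrier F" for x y
    using h_add[OF that(1) carrier_F_closed(4)[OF that(2)]] h_neg[OF that(2)] by simp
  have cancel: "a \<oplus>\<^bsub>L\<^esub> b \<oplus>\<^bsub>L\<^esub> \<ominus>\<^bsub>L\<^esub> a \<oplus>\<^bsub>L\<^esub> \<ominus>\<^bsub>L\<^esub> b = \<zero>\<^bsub>L\<^esub>"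
    if "a \<in> carrier L" "b \<in> carrier L" for a b
  proof -
    have "a \<oplus>\<^bsub>L\<^esub> b \<oplus>\<^bsub>L\<^esub> \<ominus>\<^bsub>L\<^esub> a = b"
      using that by (metis L.M.a_assoc L.M.a_comm L.M.add.inv_closed L.M.r_neg L.M.r_zero)
    then show ?thesis using that by (simp add: L.M.r_neg)
  qed
  have h_rels: "h r = \<zero>\<^bsub>L\<^esub>" if "r \<in> rels" for r
    using that
  proof (cases rule: relsE)
    case (1 a a' v)
    then have "frag_of (a \<oplus>\<^bsub>A\<^esub> a', v) \<in> carrier F" "frag_of (a, v) \<in> carrier F" "frag_of (a', v) \<in> carrier F"
      by (auto intro!: carrier_F_closed(5))
    then show ?thesis
      using 1 g[OF 1(3)] cancel[of "a \<odot>\<^bsub>L\<^esub> g v" "a' \<odot>\<^bsub>L\<^esub> g v"]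
      by (simp only: h_diff carrier_F_closed(3) h_of L.smult_l_distr L.smult_closed A.add.m_closed)
  next
    case (2 a v v')
    then have "frag_of (a, v \<oplus>\<^bsub>V\<^esub> v') \<in> carrier F" "frag_of (a, v) \<in> carrier F" "frag_of (a, v') \<in> carrier F"
      by (auto intro!: carrier_F_closed(5) V_add)
    then show ?thesis
      using 2 g[OF 2(2)] g[OF 2(3)] cancel[of "a \<odot>\<^bsub>L\<^esub> g v" "a \<odot>\<^bsub>L\<^esub> g v'"]
      by (simp only: h_diff carrier_F_closed(3) h_of g_add L.smult_r_distr L.smult_closed V_add)
  next
    case (3 a b v)
    then have b: "b \<in> carrier A" using sub_B by auto
    then have "frag_of (a \<otimes>\<^bsub>A\<^esub> b, v) \<in> carrier F" "frag_of (a, b \<odot>\<^bsub>V\<^esub> v) \<in> carrier F"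
      using 3 by (auto intro!: carrier_F_closed(5) V_smult)
    then show ?thesis
      using 3 b g[OF 3(3)]
      by (simp add: h_diff h_of g_smult L.smult_assoc L.smult_closed V_smult L.M.r_neg)
  qed
  have h_K: "h x = \<zero>\<^bsub>L\<^esub>" if "x \<in> K" for x
  proof -
    have "x \<in> carrier F \<and> h x = \<zero>\<^bsub>L\<^esub>" using that
    proof (induction x rule: generate.induct)
      case one
      then show ?case using h_0 carrier_F_closed(1) by simp
    next
      case (incl r)
      then show ?case using h_rels rels_sub by auto
    next
      case (inv r)
      then have r: "r \<in> carrier F" using rels_sub by auto
      then have "inv\<^bsub>F\<^esub> r = - r" by (rule F_inv)
      then show ?case using h_neg[OF r] h_rels[OF inv] carrier_F_closed(4)[OF r] by simp
    next
      case (eng x y)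
      then show ?case using h_add[of x y] carrier_F_closed(2)[of x y] by simp
    qed
    then show ?thesis by simp
  qed
  define f where "f C = h (SOME x. x \<in> C)" for C
  have f_coset: "f (K #>\<^bsub>F\<^esub> x) = h x" if x: "x \<in> carrier F" for x
  proof -
    have "h z = h x" if "z \<in> K #>\<^bsub>F\<^esub> x" for z
    proof -
      have d: "z - x \<in> K" using that coset_mem[OF x] by simp
      then have "h ((z - x) + x) = h x"
        using h_add[of "z - x" x] x h_K[OF d] K_sub h_closed[OF x] by (auto)
      then show ?thesis by simp
    qed
    moreover have "x \<in> K #>\<^bsub>F\<^esub> x" using coset_mem[OF x, of x] K_closed(1) by simp
    ultimately show ?thesis unfolding f_def by (metis someI_ex)
  qed
  have h_lmul: "h (lmul a x) = a \<odot>\<^bsub>L\<^esub> h x" if a: "a \<in> carrier A" and x: "x \<in> carrier F" for a x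
    using x
  proof (induction rule: F_induct)
    case zero
    then show ?case using h_0 a by simp
  next
    case (diff x y)
    have neg: "a \<odot>\<^bsub>L\<^esub> (\<ominus>\<^bsub>L\<^esub> u) = \<ominus>\<^bsub>L\<^esub> (a \<odot>\<^bsub>L\<^esub> u)" if "u \<in> carrier L" for u
      using that a L.smult_r_distr[of a "\<ominus>\<^bsub>L\<^esub> u" u] L.smult_closed
      by (simp add: L.M.l_neg L.M.minus_equality)
    show ?case
      using diff a h_closed lmul_closed
      by (simp add: h_diff L.smult_r_distr neg)
  next
    case (frag c v)
    then show ?case using a g by (simp add: h_of L.smult_assoc)
  qed
  have "f \<in> LinearCombinations.module_hom A Ind L"
    by (rule module_homI)
      (auto simp: Ind_carrier f_coset Ind_add Ind_smult h_closed h_add h_lmul lmul_closed carrier_F_closed(2))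
  moreover have "f (tens \<one>\<^bsub>A\<^esub> v) = g v" if "v \<in> carrier V" for v
    using that f_coset[of "frag_of (\<one>\<^bsub>A\<^esub>, v)"] carrier_F_closed(5)[of "(\<one>\<^bsub>A\<^esub>, v)"]
      h_of[of "\<one>\<^bsub>A\<^esub>" v] g L.smult_one
    unfolding tens_def by (simp)
  ultimately show ?thesis using that by blast
qed

end

section \<open>The Bernstein relation\<close>

lemma reflection_simps:
  "reflection N1 (m, n) = (- m + 3 * n, n)" "reflection N2 (m, n) = (m, m - n)"
  by (simp_all add: reflection_def coroot_pairing_def)

lemma reflection_add: "reflection i (l + m) = reflection i l + reflection i m"
  by (cases i; cases l; cases m) (simp_all add: reflection_simps)

lemma reflection_uminus: "reflection i (- l) = - reflection i l"
  by (cases i; cases l) (simp_all add: reflection_simps)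

lemma reflection_reflection [simp]: "reflection i (reflection i l) = l"
  by (cases i; cases l) (simp_all add: reflection_simps)

lemma wlattice_induct [case_names one two add neg]:
  fixes l :: wlattice
  assumes "P (1, 0)" and "P (0, 1)" and add: "\<And>l m. P l \<Longrightarrow> P m \<Longrightarrow> P (l + m)"
    and neg: "\<And>l. P l \<Longrightarrow> P (- l)"
  shows "P l"
proof -
  have zero: "P 0" using add[OF assms(1) neg[OF assms(1)]] by (simp add: zero_prod_def)
  have nat: "P (int k * fst m, int k * snd m)" if "P m" for k m
  proof (induction k)
    case 0
    then show ?case using zero by (simp add: zero_prod_def)
  next
    case (Suc k)
    then show ?case using add[OF Suc that] by (cases m) (simp add: algebra_simps)
  qed
  have int: "P (k * fst m, k * snd m)" if "P m" for k m
    using nat[OF that, of "nat k"] neg[OF nat[OF that, of "nat (- k)"]] by (cases "k \<ge> 0") auto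
  obtain m n where "l = (m, n)" by (cases l)
  then show ?thesis using add[OF int[OF assms(1), of m] int[OF assms(2), of n]] by simp
qed

abbreviation mon :: "wlattice \<Rightarrow> group_algebra" where
  "mon l \<equiv> Poly_Mapping.single l 1"

text \<open>
  \<open>f\<close> is the quotient $(X^\lambda - X^{s_i\lambda})/(1 - X^{-\alpha_i})$.
\<close>

definition demazure :: "node \<Rightarrow> wlattice \<Rightarrow> group_algebra \<Rightarrow> bool" where
  "demazure i l f \<longleftrightarrow> f * (1 - mon (- simple_root i)) = mon l - mon (reflection i l)"

lemma mon_mult: "mon l * mon m = mon (l + m)"
  by (simp add: mult_single)

lemma mon_zero: "mon 0 = 1" by simp

text \<open>
  The quotient is a derivation twisted by $s_i$. Its existence, and the Bernstein relation below, thus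
  need to be checked only for $\lambda = \alpha_1, \alpha_2$.
\<close>

lemma demazure_add:
  assumes "demazure i l f" and "demazure i m g"
  shows "demazure i (l + m) (f * mon m + mon (reflection i l) * g)"
proof -
  have "(f * mon m + mon (reflection i l) * g) * (1 - mon (- simple_root i))
      = (f * (1 - mon (- simple_root i))) * mon m + mon (reflection i l) * (g * (1 - mon (- simple_root i)))"
    by (simp only: algebra_simps)
  also have "\<dots> = mon (l + m) - mon (reflection i (l + m))"
    unfolding assms[unfolded demazure_def]
    by (simp add: algebra_simps reflection_add flip: mon_mult)
  finally show ?thesis unfolding demazure_def .
qed

lemma demazure_uminus:
  assumes "demazure i l f"
  shows "demazure i (- l) (- (mon (- l) * mon (- reflection i l) * f))"
proof -
  have "- (mon (- l) * mon (- reflection i l) * f) * (1 - mon (- simple_root i))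
      = - (mon (- l) * mon (- reflection i l) * (f * (1 - mon (- simple_root i))))"
    by (simp only: mult.assoc mult_minus_left)
  also have "\<dots> = mon (- l) - mon (reflection i (- l))"
    unfolding assms[unfolded demazure_def]
    by (simp add: right_diff_distrib mon_mult reflection_uminus)
  finally show ?thesis unfolding demazure_def .
qed

lemma demazure_roots:
  "demazure N1 (1, 0) (mon (1, 0) + 1)"
  "demazure N1 (0, 1) (- (mon (3, 1) + mon (2, 1) + mon (1, 1)))"
  "demazure N2 (1, 0) (- mon (1, 1))"
  "demazure N2 (0, 1) (mon (0, 1) + 1)"
  unfolding demazure_def
  by (simp_all add: algebra_simps mon_mult reflection_simps mon_zero[unfolded zero_prod_def])

lemma demazure_exists: "\<exists>f. demazure i l f"
proof (induction l rule: wlattice_induct)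
  case one
  then show ?case using demazure_roots(1,3) by (cases i) blast+
next
  case two
  then show ?case using demazure_roots(2,4) by (cases i) blast+
next
  case (add l m)
  then show ?case using demazure_add by blast
next
  case (neg l)
  then show ?case using demazure_uminus by blast
qed

text \<open>
  If $g = gX^{-\alpha_i}$, then the support of $g$ is stable under the translation by $\alpha_i$,
  which no nonempty finite set is.
\<close>

lemma one_minus_mon_cancel:
  assumes "g * (1 - mon (- simple_root i)) = 0"
  shows "g = 0"
proof (rule ccontr)
  assume "g \<noteq> 0"
  then obtain k where k: "k \<in> Poly_Mapping.keys g" by (metis all_not_in_conv keys_eq_empty)
  have g: "g = g * mon (- simple_root i)" using assms by (simp add: right_diff_distrib)
  have "\<exists>l \<in> Poly_Mapping.keys g. k = l + (- (int n * fst (simple_root i)), - (int n * snd (simple_root i)))" for n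
  proof (induction n)
    case 0
    then show ?case using k by (intro bexI[of _ k]) (simp_all flip: zero_prod_def)
  next
    case (Suc n)
    then obtain l where l: "l \<in> Poly_Mapping.keys g"
      "k = l + (- (int n * fst (simple_root i)), - (int n * snd (simple_root i)))" by blast
    have "l \<in> Poly_Mapping.keys (g * mon (- simple_root i))" using l(1) g by simp
    then have "l \<in> {a + b |a b. a \<in> Poly_Mapping.keys g \<and> b \<in> Poly_Mapping.keys (mon (- simple_root i))}"
      using keys_mult by blast
    then obtain l' m where "l' \<in> Poly_Mapping.keys g" "l = l' + m"
      "m \<in> Poly_Mapping.keys (mon (- simple_root i))" by blast
    then have "l' \<in> Poly_Mapping.keys g" "l = l' + - simple_root i" by simp_all
    then show ?case using l(2)
      by (intro bexI[of _ l']) (cases l'; cases i; simp add: algebra_simps)+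
  qed
  then have "\<forall>n. \<exists>l. l \<in> Poly_Mapping.keys g \<and>
      k = l + (- (int n * fst (simple_root i)), - (int n * snd (simple_root i)))" by blast
  then obtain h where h: "\<And>n. h n \<in> Poly_Mapping.keys g"
    "\<And>n. k = h n + (- (int n * fst (simple_root i)), - (int n * snd (simple_root i)))"
    using choice[of "\<lambda>n l. l \<in> Poly_Mapping.keys g \<and>
      k = l + (- (int n * fst (simple_root i)), - (int n * snd (simple_root i)))"] by auto
  have "inj h"
  proof (rule injI)
    fix m n assume "h m = h n"
    then have "h n + (- (int m * fst (simple_root i)), - (int m * snd (simple_root i)))
        = h n + (- (int n * fst (simple_root i)), - (int n * snd (simple_root i)))"
      using h(2)[of m] h(2)[of n] by metis
    then show "m = n" by (cases i) simp_all
  qed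
  then have "infinite (range h)" by (rule range_inj_infinite)
  moreover have "finite (range h)" using h(1) by (intro finite_subset[OF _ finite_keys[of g]]) blast
  ultimately show False by contradiction
qed

lemma demazure_unique: "demazure i l f \<Longrightarrow> demazure i l g \<Longrightarrow> f = g"
  using one_minus_mon_cancel[of "f - g" i] unfolding demazure_def by (simp add: left_diff_distrib)

lemma hecke_bernstein:
  "demazure i l f \<Longrightarrow> free_X l * free_T i
      - (free_T i * free_X (reflection i l) + free_C (q - inverse q) * free_X_lin f) \<in> relator_ideal q"
  unfolding demazure_def by (rule hecke_relations(5))

text \<open>
  The linear extension of a monoid action to the monoid algebra. The monoid is the free monoid of
  words in the first use below, and the weight lattice in the others.
\<close>

locale complex_monoid_rep = vector_space scl
  for scl :: "complex \<Rightarrow> 'v::ab_group_add \<Rightarrow> 'v" +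
  fixes op :: "'k::monoid_add \<Rightarrow> 'v \<Rightarrow> 'v"
  assumes op_zero: "op 0 x = x" and op_plus: "op (k + l) x = op k (op l x)"
    and op_add: "op k (x + y) = op k x + op k y" and op_scl: "op k (scl c x) = scl c (op k x)"
begin

definition ext :: "('k \<Rightarrow>\<^sub>0 complex) \<Rightarrow> 'v \<Rightarrow> 'v" where
  "ext p x = (\<Sum>k\<in>Poly_Mapping.keys p. scl (Poly_Mapping.lookup p k) (op k x))"

lemma ext_superset:
  "finite S \<Longrightarrow> Poly_Mapping.keys p \<subseteq> S \<Longrightarrow> ext p x = (\<Sum>k\<in>S. scl (Poly_Mapping.lookup p k) (op k x))"
  unfolding ext_def by (rule sum.mono_neutral_left) (auto simp: in_keys_iff)

lemma ext_plus: "ext (p + r) x = ext p x + ext r x"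
proof -
  let ?S = "Poly_Mapping.keys p \<union> Poly_Mapping.keys r"
  have "ext (p + r) x = (\<Sum>k\<in>?S. scl (Poly_Mapping.lookup (p + r) k) (op k x))"
    by (rule ext_superset) (use keys_add[of p r] in auto)
  then show ?thesis
    using ext_superset[of ?S p x] ext_superset[of ?S r x]
    by (simp add: lookup_add scale_left_distrib sum.distrib)
qed

lemma ext_single: "ext (Poly_Mapping.single k c) x = scl c (op k x)"
  using ext_superset[of "{k}" "Poly_Mapping.single k c" x] by simp

lemma ext_zero [simp]: "ext 0 x = 0" by (simp add: ext_def)

lemma ext_one [simp]: "ext 1 x = x"
  using ext_single[of 0 1 x] by (simp add: op_zero)

lemma ext_add_right: "ext p (x + y) = ext p x + ext p y"
  by (simp add: ext_def op_add scale_right_distrib sum.distrib)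

lemma ext_zero_right [simp]: "ext p 0 = 0"
  using ext_add_right[of p 0 0] by simp

lemma ext_scl: "ext p (scl c x) = scl c (ext p x)"
  by (simp add: ext_def op_scl scale_sum_right mult.commute)

lemma ext_mult: "ext (p * r) x = ext p (ext r x)"
proof (induction p rule: poly_mapping_additive_induct)
  case (3 k c)
  show ?case
  proof (induction r rule: poly_mapping_additive_induct)
    case 1
    show ?case by simp
  next
    case (2 a b)
    then show ?case by (simp add: distrib_left ext_plus ext_add_right)
  next
    case (3 l d)
    show ?case by (simp only: mult_single ext_single op_plus op_scl scale_scale)
  qed
next
  case 1
  show ?case by simp
next
  case (2 a b)
  then show ?case by (simp add: distrib_right ext_plus)
qed

lemma ext_uminus: "ext (- p) x = - ext p x"
  using ext_plus[of "- p" p x] by (simp add: eq_neg_iff_add_eq_0)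

lemma ext_diff: "ext (p - r) x = ext p x - ext r x"
  using ext_plus[of p "- r" x] by (simp add: ext_uminus)

end

section \<open>Modules defined by operators\<close>

locale hecke_operators = vector_space scl
  for scl :: "complex \<Rightarrow> 'v::ab_group_add \<Rightarrow> 'v" +
  fixes q :: complex and T :: "node \<Rightarrow> 'v \<Rightarrow> 'v" and Y :: "wlattice \<Rightarrow> 'v \<Rightarrow> 'v"
  assumes T_add: "T i (x + y) = T i x + T i y" and T_scl: "T i (scl c x) = scl c (T i x)"
    and Y_add: "Y l (x + y) = Y l x + Y l y" and Y_scl: "Y l (scl c x) = scl c (Y l x)"
    and Y_zero: "Y 0 x = x" and Y_plus: "Y (l + m) x = Y l (Y m x)"
    and quadratic: "T i (T i x) = scl (q - inverse q) (T i x) + x"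
    and braid: "T N1 (T N2 (T N1 (T N2 (T N1 (T N2 x))))) = T N2 (T N1 (T N2 (T N1 (T N2 (T N1 x)))))"
    and bernstein:
      "Y (1, 0) (T N1 x) = T N1 (Y (- 1, 0) x) + scl (q - inverse q) (Y (1, 0) x + x)"
      "Y (0, 1) (T N1 x) = T N1 (Y (3, 1) x) - scl (q - inverse q) (Y (3, 1) x + Y (2, 1) x + Y (1, 1) x)"
      "Y (1, 0) (T N2 x) = T N2 (Y (1, 1) x) - scl (q - inverse q) (Y (1, 1) x)"
      "Y (0, 1) (T N2 x) = T N2 (Y (0, - 1) x) + scl (q - inverse q) (Y (0, 1) x + x)"
begin

definition letter :: "generator \<Rightarrow> 'v \<Rightarrow> 'v" where
  "letter g = (case g of GenT i \<Rightarrow> T i | GenX l \<Rightarrow> Y l)"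

definition word :: "generator free_monoid \<Rightarrow> 'v \<Rightarrow> 'v" where
  "word w = (case w of Word gs \<Rightarrow> foldr letter gs)"

lemma letter_linear: "letter g (x + y) = letter g x + letter g y" "letter g (scl c x) = scl c (letter g x)"
  by (simp_all add: letter_def T_add T_scl Y_add Y_scl split: generator.split)

sublocale W: complex_monoid_rep scl word
proof
  fix k l x y and c :: complex
  show "word 0 x = x" by (simp add: word_def zero_free_monoid_def)
  show "word (k + l) x = word k (word l x)" by (cases k; cases l) (simp add: word_def)
  have "foldr letter gs (x + y) = foldr letter gs x + foldr letter gs y" for gs
    by (induction gs) (simp_all add: letter_linear)
  then show "word k (x + y) = word k x + word k y" by (cases k) (simp add: word_def)
  have "foldr letter gs (scl c x) = scl c (foldr letter gs x)" for gs
    by (induction gs) (simp_all add: letter_linear)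
  then show "word k (scl c x) = scl c (word k x)" by (cases k) (simp add: word_def)
qed

sublocale L: complex_monoid_rep scl Y
  by unfold_locales (simp_all add: Y_zero Y_plus Y_add Y_scl)

lemma ext_gens:
  "W.ext (free_C c) x = scl c x" "W.ext (free_T i) x = T i x" "W.ext (free_X l) x = Y l x"
  by (simp_all add: free_C_def free_T_def free_X_def W.ext_single W.op_zero)
    (simp_all add: word_def letter_def)

lemma ext_free_X_lin: "W.ext (free_X_lin f) x = L.ext f x"
proof -
  have "W.ext (\<Sum>l\<in>S. free_C (Poly_Mapping.lookup f l) * free_X l) x
      = (\<Sum>l\<in>S. scl (Poly_Mapping.lookup f l) (Y l x))" if "finite S" for S
    using that by induction (simp_all add: W.ext_plus W.ext_mult ext_gens)
  then show ?thesis unfolding free_X_lin_def L.ext_def by simp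
qed

lemma Y_neg: "Y l (Y (- l) x) = x" "Y (- l) (Y l x) = x"
  by (simp_all add: Y_zero flip: Y_plus)

text \<open>
  The Bernstein relation passes to sums and negatives of weights along with the quotient \<open>f\<close>
  (\<open>demazure_add\<close>, \<open>demazure_uminus\<close>), so that the four relations of the locale imply it for all
  weights. Every \<open>f\<close> as in the relators is covered by \<open>demazure_unique\<close>.
\<close>

lemma bernstein_exists:
  "\<exists>f. demazure i l f \<and> (\<forall>x. Y l (T i x) = T i (Y (reflection i l) x) + scl (q - inverse q) (L.ext f x))"
proof (induction l rule: wlattice_induct)
  case one
  show ?case
  proof (cases i)
    case N1
    then show ?thesis using demazure_roots(1) bernstein(1)
      by (intro exI[of _ "mon (1, 0) + 1"]) (simp add: L.ext_plus L.ext_single reflection_simps)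
  next
    case N2
    then show ?thesis using demazure_roots(3) bernstein(3)
      by (intro exI[of _ "- mon (1, 1)"]) (simp add: L.ext_uminus L.ext_single reflection_simps)
  qed
next
  case two
  show ?case
  proof (cases i)
    case N1
    then show ?thesis using demazure_roots(2) bernstein(2)
      by (intro exI[of _ "- (mon (3, 1) + mon (2, 1) + mon (1, 1))"])
        (simp add: L.ext_uminus L.ext_plus L.ext_single reflection_simps del: minus_add_distrib)
  next
    case N2
    then show ?thesis using demazure_roots(4) bernstein(4)
      by (intro exI[of _ "mon (0, 1) + 1"]) (simp add: L.ext_plus L.ext_single reflection_simps)
  qed
next
  case (add l m)
  then obtain f g where f: "demazure i l f"
      "\<And>x. Y l (T i x) = T i (Y (reflection i l) x) + scl (q - inverse q) (L.ext f x)"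
    and g: "demazure i m g"
      "\<And>x. Y m (T i x) = T i (Y (reflection i m) x) + scl (q - inverse q) (L.ext g x)" by blast
  have comm: "Y k (L.ext p x) = L.ext p (Y k x)" for k p x
    using L.ext_mult[of "mon k" p x] L.ext_mult[of p "mon k" x] by (simp add: L.ext_single mult.commute)
  have "Y (l + m) (T i x) = T i (Y (reflection i (l + m)) x)
      + scl (q - inverse q) (L.ext (f * mon m + mon (reflection i l) * g) x)" for x
  proof -
    have "Y (l + m) (T i x) = Y m (Y l (T i x))" by (metis Y_plus add.commute)
    also have "\<dots> = Y m (T i (Y (reflection i l) x)) + scl (q - inverse q) (Y m (L.ext f x))"
      by (simp add: f(2) Y_add Y_scl)
    also have "Y m (T i (Y (reflection i l) x))
        = T i (Y (reflection i m) (Y (reflection i l) x)) + scl (q - inverse q) (L.ext g (Y (reflection i l) x))"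
      by (simp add: g(2))
    also have "Y (reflection i m) (Y (reflection i l) x) = Y (reflection i (l + m)) x"
      by (metis Y_plus add.commute reflection_add)
    finally show ?thesis
      by (simp add: L.ext_plus L.ext_mult L.ext_single comm scale_right_distrib)
  qed
  then show ?case using demazure_add[OF f(1) g(1)] by blast
next
  case (neg l)
  then obtain f where f: "demazure i l f"
      "\<And>x. Y l (T i x) = T i (Y (reflection i l) x) + scl (q - inverse q) (L.ext f x)" by blast
  have comm: "Y k (L.ext p x) = L.ext p (Y k x)" for k p x
    using L.ext_mult[of "mon k" p x] L.ext_mult[of p "mon k" x] by (simp add: L.ext_single mult.commute)
  have "Y (- l) (T i x) = T i (Y (reflection i (- l)) x)
      + scl (q - inverse q) (L.ext (- (mon (- l) * mon (- reflection i l) * f)) x)" for x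
  proof -
    let ?y = "Y (- reflection i l) x"
    have "Y l (T i ?y) = T i x + scl (q - inverse q) (L.ext f ?y)"
      by (simp add: f(2) Y_neg)
    then have "Y (- l) (Y l (T i ?y)) = Y (- l) (T i x) + scl (q - inverse q) (Y (- l) (L.ext f ?y))"
      by (simp add: Y_add Y_scl)
    then have "Y (- l) (T i x) = T i ?y - scl (q - inverse q) (Y (- l) (L.ext f ?y))"
      by (simp add: Y_neg)
    then show ?thesis
      by (simp add: L.ext_uminus L.ext_mult L.ext_single comm reflection_uminus)
  qed
  then show ?case using demazure_uminus[OF f(1)] by blast
qed

lemma ext_relators: "r \<in> relators q \<Longrightarrow> W.ext r x = 0"
  unfolding relators_def
  by (elim UnE CollectE exE conjE insertE emptyE)
    (simp_all add: W.ext_diff W.ext_plus W.ext_mult ext_gens Y_zero Y_plus quadratic braid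
      power2_eq_square ext_free_X_lin,
     metis bernstein_exists demazure_def demazure_unique)

lemma ext_relator_ideal: 
  assumes "a \<in> relator_ideal q"
  shows "W.ext a x = 0"
proof -
  have "ideal {a. \<forall>x. W.ext a x = 0} class_ring"
  proof (rule idealI[OF ring_free_algebra])
    show "subgroup {a. \<forall>x. W.ext a x = 0} (add_monoid class_ring)"
    proof (rule subgroup.intro)
      fix a assume a: "a \<in> {a. \<forall>x. W.ext a x = 0}"
      have "inv\<^bsub>add_monoid class_ring\<^esub> a = - a"
        using class_ring_simps by (metis a_inv_def)
      then show "inv\<^bsub>add_monoid class_ring\<^esub> a \<in> {a. \<forall>x. W.ext a x = 0}"
        using a by (simp add: W.ext_uminus)
    qed (auto simp: W.ext_plus)
  qed (auto simp: W.ext_mult)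
  then have "relator_ideal q \<subseteq> {a. \<forall>x. W.ext a x = 0}"
    by (rule relator_ideal_minimal) (use ext_relators in auto)
  then show ?thesis using assms by auto
qed

text \<open>
  An element of the Hecke algebra acts through an arbitrary preimage in the free algebra; the choice
  does not matter because the relators act as zero (\<open>ext_relator_ideal\<close>).
\<close>

definition rep :: "(hecke_elem, 'v) module" where
  "rep = \<lparr>carrier = UNIV, monoid.mult = undefined, one = undefined, ring.zero = 0, add = (+),
     smult = (\<lambda>a x. W.ext (SOME b. hecke_proj q b = a) x)\<rparr>"

lemma rep_simps [simp]:
  "carrier rep = UNIV" "\<zero>\<^bsub>rep\<^esub> = 0" "x \<oplus>\<^bsub>rep\<^esub> y = x + y"
  by (simp_all add: rep_def)

lemma rep_smult: "hecke_proj q a \<odot>\<^bsub>rep\<^esub> x = W.ext a x"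
proof -
  have "hecke_proj q (SOME b. hecke_proj q b = hecke_proj q a) = hecke_proj q a" by (rule someI) simp
  then have "(SOME b. hecke_proj q b = hecke_proj q a) - a \<in> relator_ideal q" by (simp add: hecke_proj_eq_iff)
  then show ?thesis using ext_relator_ideal[of _ x] by (fastforce simp: rep_def W.ext_diff)
qed

lemma hecke_module_rep: "hecke_module q rep"
proof (intro hecke_module.intro left_module.intro left_module_axioms.intro)
  show "ring (hecke q)" by (rule ring_hecke)
  show "abelian_group rep"
    by (rule abelian_groupI) (auto simp: add_ac intro!: exI[of _ "- x" for x])
qed (auto dest!: hecke_proj_surj simp: rep_smult W.ext_plus W.ext_mult W.ext_add_right
    simp flip: hecke_proj_simps)

lemma hact_rep: "hact q rep a x = W.ext a x"
  by (simp add: hact_def rep_smult)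

lemma hact_rep_gens [simp]:
  "hact q rep (free_C c) x = scl c x" "hact q rep (free_T i) x = T i x" "hact q rep (free_X l) x = Y l x"
  by (simp_all add: hact_rep ext_gens)

end

section \<open>Composition series from projections\<close>

lemma has_dim_iso:
  assumes M: "left_module (hecke q) M" and N: "left_module (hecke q) N"
    and f: "f \<in> LinearCombinations.module_hom (hecke q) M N" and bij: "bij_betw f (carrier M) (carrier N)"
    and dim: "has_dim q M n"
  shows "has_dim q N n"
proof -
  interpret V: vectorspace class_ring "complex_space q M" by (rule vectorspace_hecke_module[OF M])
  interpret W: vectorspace class_ring "complex_space q N" by (rule vectorspace_hecke_module[OF N])
  have "f \<in> LinearCombinations.module_hom class_ring (complex_space q M) (complex_space q N)"
    by (rule module_homI) (simp_all add: module_homD[OF f])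
  then interpret linear_map class_ring "complex_space q M" "complex_space q N" f
    by unfold_locales
  have "V.fin_dim" "V.dim = n" using dim unfolding has_dim_def by auto
  moreover have "inj_on f (carrier (complex_space q M))" "f ` carrier (complex_space q M) = carrier (complex_space q N)"
    using bij by (simp_all add: bij_betw_def)
  ultimately show ?thesis unfolding has_dim_def using surj_fin_dim dim_eq by simp
qed

text \<open>
  If each step of a filtration is the kernel of a projection from the next step onto an irreducible
  module, then these modules are the composition factors, together with their dimensions.
\<close>

theorem composition_series_by_projections:
  fixes M :: "(hecke_elem, 'm) module" and F :: "nat \<Rightarrow> (hecke_elem, 'n) module"
  assumes M: "left_module (hecke q) M"
    and U: "U 0 = {\<zero>\<^bsub>M\<^esub>}" "U (length ds) = carrier M"
      "\<And>i. i \<le> length ds \<Longrightarrow> Module.submodule (U i) (hecke q) M"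
      "\<And>i. i < length ds \<Longrightarrow> U i \<subseteq> U (Suc i)"
    and irr: "\<And>i. i < length ds \<Longrightarrow> irreducible_module (hecke q) (F i)"
    and dim: "\<And>i. i < length ds \<Longrightarrow> has_dim q (F i) (ds ! i)"
    and f: "\<And>i. i < length ds \<Longrightarrow> f i \<in> LinearCombinations.module_hom (hecke q) (M\<lparr>carrier := U (Suc i)\<rparr>) (F i)"
      "\<And>i. i < length ds \<Longrightarrow> f i ` U (Suc i) = carrier (F i)"
      "\<And>i. i < length ds \<Longrightarrow> {x \<in> U (Suc i). f i x = \<zero>\<^bsub>F i\<^esub>} = U i"
  defines "Ns \<equiv> map U [0..<Suc (length ds)]"
  shows "composition_series (hecke q) M Ns" and "list_all2 (has_dim q) (series_factors M Ns) ds"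
    and "i < length ds \<Longrightarrow> module_isomorphic (hecke q) (F i) (series_factors M Ns ! i)"
proof -
  interpret M: left_module "hecke q" M by (rule M)
  have nth: "Ns ! i = U i" if "i \<le> length ds" for i
    using that unfolding Ns_def by (simp del: upt_Suc)
  have len: "length Ns = Suc (length ds)" unfolding Ns_def by simp
  let ?Q = "\<lambda>i. quotient_module (M\<lparr>carrier := U (Suc i)\<rparr>) (U i)"
  have fac: "length (series_factors M Ns) = length ds"
    "\<And>i. i < length ds \<Longrightarrow> series_factors M Ns ! i = ?Q i"
    unfolding series_factors_def by (simp_all add: len nth)
  have iso: "\<exists>g. g \<in> LinearCombinations.module_hom (hecke q) (?Q i) (F i) \<and>
      bij_betw g (carrier (?Q i)) (carrier (F i)) \<and> left_module (hecke q) (?Q i)" if i: "i < length ds" for i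
  proof -
    have sub: "Module.submodule (U (Suc i)) (hecke q) M" "Module.submodule (U i) (hecke q) M"
      using U(3) i by auto
    then have "Module.submodule (U i) (hecke q) (M\<lparr>carrier := U (Suc i)\<rparr>)"
      using M.submodule_restrict_iff[OF sub(1)] sub(2) U(4)[OF i] by simp
    then have subi: "Module.submodule (U i) (hecke q) (M\<lparr>carrier := U (Suc i)\<rparr>)" .
    have lF: "left_module (hecke q) (F i)" using irr[OF i] unfolding irreducible_module_def by auto
    have surj: "f i ` carrier (M\<lparr>carrier := U (Suc i)\<rparr>) = carrier (F i)"
      and ker: "{x \<in> carrier (M\<lparr>carrier := U (Suc i)\<rparr>). f i x = \<zero>\<^bsub>F i\<^esub>} = U i"
      using f(2,3)[OF i] by simp_all
    show ?thesis
      by (rule quotient_module_iso[OF M.left_module_submodule[OF sub(1)] lF subi f(1)[OF i] surj ker])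
        (intro exI conjI; assumption)
  qed
  have lF: "left_module (hecke q) (F i)" if "i < length ds" for i
    using irr[OF that] unfolding irreducible_module_def by auto
  have irrQ: "irreducible_module (hecke q) (?Q i)" if "i < length ds" for i
    using iso[OF that] irreducible_module_iso irr[OF that] by blast
  show iso': "module_isomorphic (hecke q) (F i) (series_factors M Ns ! i)" if i: "i < length ds" for i
    using iso[OF i] module_isomorphic_sym unfolding fac(2)[OF i] module_isomorphic_def by blast
  have dimQ: "has_dim q (?Q i) (ds ! i)" if i: "i < length ds" for i
    using iso[OF i] iso'[OF i] has_dim_iso[OF lF[OF i] _ _ _ dim[OF i]]
    unfolding fac(2)[OF i] module_isomorphic_def by blast
  show "list_all2 (has_dim q) (series_factors M Ns) ds"
    using fac dimQ by (simp add: list_all2_conv_all_nth)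
  show "composition_series (hecke q) M Ns"
    unfolding composition_series_def
  proof (intro conjI allI impI ballI)
    show "Ns \<noteq> []" using len by auto
    then show "hd Ns = {\<zero>\<^bsub>M\<^esub>}" using nth[of 0] U(1) by (simp add: hd_conv_nth)
    show "last Ns = carrier M" using \<open>Ns \<noteq> []\<close> nth[of "length ds"] U(2) len by (simp add: last_conv_nth)
    show "Module.submodule N (hecke q) M" if "N \<in> set Ns" for N
      using that U(3) unfolding Ns_def by (auto simp del: upt_Suc)
    show "Ns ! i \<subseteq> Ns ! Suc i" if "Suc i < length Ns" for i
      using that U(4)[of i] nth[of i] nth[of "Suc i"] len by simp
    show "irreducible_module (hecke q) F" if "F \<in> set (series_factors M Ns)" for F
      using that fac irrQ by (auto simp: in_set_conv_nth)
  qed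
qed

section \<open>A family of six-dimensional modules\<close>

type_synonym six = "complex \<times> complex \<times> complex \<times> complex \<times> complex \<times> complex"

fun scale6 :: "complex \<Rightarrow> six \<Rightarrow> six" where
  "scale6 k (a1, a2, b, b', c1, c2) = (k * a1, k * a2, k * b, k * b', k * c1, k * c2)"

text \<open>
  \<open>tau \<mu> \<nu> i\<close> is $q^{-1}T_i$. The coordinates $a_1, a_2$ belong to the weight $t_{1,-1}$, the
  coordinates $b, b'$ to $t_{-1,-1}$, and $c_1, c_2$ to $t_{-1,1}$. For $\mu = \nu = 0$ the module
  is the direct sum of the planes $a$ and $c$ and the lines $b$ and $b'$; the parameters glue these
  together. The square of \<open>tau \<mu> \<nu> N1 - 1\<close> has the entry $\mu\nu$ between $c_2$ and $c_1$, which is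
  why $\mu\nu = 0$ is needed.
\<close>

fun tau :: "complex \<Rightarrow> complex \<Rightarrow> node \<Rightarrow> six \<Rightarrow> six" where
  "tau \<mu> \<nu> N1 (a1, a2, b, b', c1, c2) =
     (- a2, a1 + 2 * a2, b + \<nu> * c2, b' + \<mu> * c2, c1 - c2 + \<mu> * b, c2)"
| "tau \<mu> \<nu> N2 (a1, a2, b, b', c1, c2) =
     (a1 - 3 * a2 + \<nu> * b, a2, b + \<mu> * a2, b' + \<nu> * a2, - c2, c1 + 2 * c2)"

definition sign :: "int \<Rightarrow> complex" where
  "sign n = (if even n then 1 else - 1)"

text \<open>
  On the plane $a$ the operator $X^{m\alpha_1 + n\alpha_2}$ is $(-1)^n(1 + (4m - 6n)E)$, where $E$ is
  nilpotent with $E^2 = 0$; it depends additively on the weight because $4m - 6n$ does. The plane $c$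
  is similar, with $(-1)^m(1 + (4n - 2m)E)$. The coefficients are those forced by the Bernstein
  relation.
\<close>

fun xact :: "wlattice \<Rightarrow> six \<Rightarrow> six" where
  "xact (m, n) (a1, a2, b, b', c1, c2) =
     (sign n * (a1 + (4 * of_int m - 6 * of_int n) * a2), sign n * a2,
      sign (m + n) * b, sign (m + n) * b',
      sign m * (c1 + (4 * of_int n - 2 * of_int m) * c2), sign m * c2)"

lemma sign_add: "sign (m + n) = sign m * sign n"
  by (simp add: sign_def)

lemma sign_simps [simp]: "sign 0 = 1" "sign 1 = -1" "sign (- n) = sign n" "sign (numeral k) = (if even (numeral k :: int) then 1 else -1)"
  by (simp_all add: sign_def)

lemma hecke_operators_six:
  assumes q: "q\<^sup>2 = -1" and \<mu>\<nu>: "\<mu> * \<nu> = 0"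
  shows "hecke_operators scale6 q (\<lambda>i x. scale6 q (tau \<mu> \<nu> i x)) xact"
proof -
  have qq: "q * q = -1" "q \<noteq> 0" "inverse q = - q"
    using q by (auto simp: power2_eq_square inverse_eq_iff_eq intro!: inverse_unique)
  have qq': "q * (q * z) = - z" for z using qq(1) by (simp flip: mult.assoc)
  interpret vector_space scale6
    by unfold_locales (auto simp: algebra_simps)
  have tau_lin: "tau \<mu> \<nu> i (x + y) = tau \<mu> \<nu> i x + tau \<mu> \<nu> i y" "tau \<mu> \<nu> i (scale6 c x) = scale6 c (tau \<mu> \<nu> i x)"
    for i x y c
    by (cases i; cases x; cases y; simp add: algebra_simps)+
  have tau_quad: "tau \<mu> \<nu> i (tau \<mu> \<nu> i x) = scale6 2 (tau \<mu> \<nu> i x) - x" for i x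
    using \<mu>\<nu> by (cases i; cases x) (auto simp: algebra_simps)
  have tau_braid: "tau \<mu> \<nu> N1 (tau \<mu> \<nu> N2 (tau \<mu> \<nu> N1 (tau \<mu> \<nu> N2 (tau \<mu> \<nu> N1 (tau \<mu> \<nu> N2 x)))))
      = tau \<mu> \<nu> N2 (tau \<mu> \<nu> N1 (tau \<mu> \<nu> N2 (tau \<mu> \<nu> N1 (tau \<mu> \<nu> N2 (tau \<mu> \<nu> N1 x)))))" for x
    using \<mu>\<nu> by (cases x) (auto simp: algebra_simps)
  show ?thesis
  proof
    fix i x y l m and c :: complex
    show "scale6 q (tau \<mu> \<nu> i (x + y)) = scale6 q (tau \<mu> \<nu> i x) + scale6 q (tau \<mu> \<nu> i y)"
      by (simp add: tau_lin scale_right_distrib)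
    show "scale6 q (tau \<mu> \<nu> i (scale6 c x)) = scale6 c (scale6 q (tau \<mu> \<nu> i x))"
      by (simp add: tau_lin mult.commute)
    show "xact l (x + y) = xact l x + xact l y" "xact l (scale6 c x) = scale6 c (xact l x)"
      by (cases l; cases x; cases y; simp add: algebra_simps)+
    show "xact 0 x = x" by (cases x) (simp add: zero_prod_def)
    show "xact (l + m) x = xact l (xact m x)"
      by (cases l; cases m; cases x) (simp add: algebra_simps sign_add)
    show "scale6 q (tau \<mu> \<nu> i (scale6 q (tau \<mu> \<nu> i x))) = scale6 (q - inverse q) (scale6 q (tau \<mu> \<nu> i x)) + x"
    proof -
      have "scale6 q (tau \<mu> \<nu> i (scale6 q (tau \<mu> \<nu> i x))) = scale6 (q * q) (scale6 2 (tau \<mu> \<nu> i x) - x)"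
        by (simp only: tau_lin tau_quad scale_scale)
      then show ?thesis
        by (cases "tau \<mu> \<nu> i x"; cases x) (simp add: qq qq' algebra_simps)
    qed
    show "scale6 q (tau \<mu> \<nu> N1 (scale6 q (tau \<mu> \<nu> N2 (scale6 q (tau \<mu> \<nu> N1 (scale6 q (tau \<mu> \<nu> N2
          (scale6 q (tau \<mu> \<nu> N1 (scale6 q (tau \<mu> \<nu> N2 x)))))))))))
        = scale6 q (tau \<mu> \<nu> N2 (scale6 q (tau \<mu> \<nu> N1 (scale6 q (tau \<mu> \<nu> N2 (scale6 q (tau \<mu> \<nu> N1
          (scale6 q (tau \<mu> \<nu> N2 (scale6 q (tau \<mu> \<nu> N1 x)))))))))))"
      by (simp only: tau_lin tau_braid)
    show "xact (1, 0) (scale6 q (tau \<mu> \<nu> N1 x)) = scale6 q (tau \<mu> \<nu> N1 (xact (- 1, 0) x))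
        + scale6 (q - inverse q) (xact (1, 0) x + x)"
      "xact (0, 1) (scale6 q (tau \<mu> \<nu> N1 x)) = scale6 q (tau \<mu> \<nu> N1 (xact (3, 1) x))
        - scale6 (q - inverse q) (xact (3, 1) x + xact (2, 1) x + xact (1, 1) x)"
      "xact (1, 0) (scale6 q (tau \<mu> \<nu> N2 x)) = scale6 q (tau \<mu> \<nu> N2 (xact (1, 1) x))
        - scale6 (q - inverse q) (xact (1, 1) x)"
      "xact (0, 1) (scale6 q (tau \<mu> \<nu> N2 x)) = scale6 q (tau \<mu> \<nu> N2 (xact (0, - 1) x))
        + scale6 (q - inverse q) (xact (0, 1) x + x)"
      by (cases x; simp add: qq algebra_simps)+
  qed
qed

definition rep6 :: "complex \<Rightarrow> complex \<Rightarrow> complex \<Rightarrow> (hecke_elem, six) module" where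
  "rep6 q \<mu> \<nu> = hecke_operators.rep scale6 q (\<lambda>i x. scale6 q (tau \<mu> \<nu> i x)) xact"

context
  fixes q \<mu> \<nu> :: complex
  assumes q: "q\<^sup>2 = -1" and \<mu>\<nu>: "\<mu> * \<nu> = 0"
begin

interpretation six: hecke_operators scale6 q "\<lambda>i x. scale6 q (tau \<mu> \<nu> i x)" xact
  by (rule hecke_operators_six[OF q \<mu>\<nu>])

lemma hecke_module_rep6: "hecke_module q (rep6 q \<mu> \<nu>)"
  unfolding rep6_def by (rule six.hecke_module_rep)

lemma rep6_simps [simp]:
  "carrier (rep6 q \<mu> \<nu>) = UNIV" "\<zero>\<^bsub>rep6 q \<mu> \<nu>\<^esub> = 0" "x \<oplus>\<^bsub>rep6 q \<mu> \<nu>\<^esub> y = x + y"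
  "hact q (rep6 q \<mu> \<nu>) (free_C c) x = scale6 c x"
  "hact q (rep6 q \<mu> \<nu>) (free_T i) x = scale6 q (tau \<mu> \<nu> i x)"
  "hact q (rep6 q \<mu> \<nu>) (free_X l) x = xact l x"
  by (simp_all add: rep6_def)

lemma submodule_rep6I:
  assumes "0 \<in> N" and "\<And>x y. x \<in> N \<Longrightarrow> y \<in> N \<Longrightarrow> x + y \<in> N"
    and "\<And>c x. x \<in> N \<Longrightarrow> scale6 c x \<in> N" and "\<And>x. x \<in> N \<Longrightarrow> tau \<mu> \<nu> N1 x \<in> N" "\<And>x. x \<in> N \<Longrightarrow> tau \<mu> \<nu> N2 x \<in> N"
    and "\<And>l x. x \<in> N \<Longrightarrow> xact l x \<in> N"
  shows "Module.submodule N (hecke q) (rep6 q \<mu> \<nu>)"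
proof (rule hecke_module.submoduleI_generators[OF hecke_module_rep6])
  show "hact q (rep6 q \<mu> \<nu>) (free_T i) x \<in> N" if "x \<in> N" for i x
    using assms(3)[OF assms(4)[OF that]] assms(3)[OF assms(5)[OF that]] by (cases i) auto
qed (use assms in auto)

lemma submodule_rep6D:
  assumes N: "Module.submodule N (hecke q) (rep6 q \<mu> \<nu>)"
  shows "0 \<in> N" and "x \<in> N \<Longrightarrow> y \<in> N \<Longrightarrow> x + y \<in> N"
    and "x \<in> N \<Longrightarrow> scale6 c x \<in> N" and "x \<in> N \<Longrightarrow> tau \<mu> \<nu> i x \<in> N"
proof -
  interpret R: hecke_module q "rep6 q \<mu> \<nu>" by (rule hecke_module_rep6)
  note Np = R.submodule_props[OF N]
  have hact: "hact q (rep6 q \<mu> \<nu>) a x \<in> N" if "x \<in> N" for a x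
    using Np(5)[OF _ that] by (simp add: hact_def)
  show "0 \<in> N" using Np(2) by simp
  show "x \<in> N \<Longrightarrow> y \<in> N \<Longrightarrow> x + y \<in> N" using Np(3)[of x y] by simp
  show sc: "x \<in> N \<Longrightarrow> scale6 c x \<in> N" for c x using hact[of x "free_C c"] by simp
  have "q \<noteq> 0" using q by auto
  then have "scale6 (inverse q) (scale6 q y) = y" for y by (cases y) simp
  then show "x \<in> N \<Longrightarrow> tau \<mu> \<nu> i x \<in> N"
    using hact[of x "free_T i"] sc[of "scale6 q (tau \<mu> \<nu> i x)" "inverse q"] by simp
qed

end

lemma hact_restrict [simp]: "hact q (M\<lparr>carrier := N\<rparr>) a x = hact q M a x"
  by (simp add: hact_def)

text \<open>
  Submodules of the split module \<open>rep6 q 0 0\<close> serve as models of the irreducible modules. Its lines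
  \<open>b\<close> and \<open>b'\<close> are isomorphic; \<open>slot_b\<close> is the line \<open>b'\<close> and stands for both.
\<close>

definition slot_b :: "six set" where "slot_b = {(0, 0, 0, y, 0, 0) |y. True}"
definition slot_a :: "six set" where "slot_a = {(x, y, 0, 0, 0, 0) |x y. True}"
definition slot_c :: "six set" where "slot_c = {(0, 0, 0, 0, x, y) |x y. True}"

lemma slot_iff:
  "(a1, a2, b, b', c1, c2) \<in> slot_b \<longleftrightarrow> a1 = 0 \<and> a2 = 0 \<and> b = 0 \<and> c1 = 0 \<and> c2 = 0"
  "(a1, a2, b, b', c1, c2) \<in> slot_a \<longleftrightarrow> b = 0 \<and> b' = 0 \<and> c1 = 0 \<and> c2 = 0"
  "(a1, a2, b, b', c1, c2) \<in> slot_c \<longleftrightarrow> a1 = 0 \<and> a2 = 0 \<and> b = 0 \<and> b' = 0"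
  by (auto simp: slot_b_def slot_a_def slot_c_def)

definition simple_b :: "complex \<Rightarrow> (hecke_elem, six) module" where
  "simple_b q = (rep6 q 0 0)\<lparr>carrier := slot_b\<rparr>"
definition simple_a :: "complex \<Rightarrow> (hecke_elem, six) module" where
  "simple_a q = (rep6 q 0 0)\<lparr>carrier := slot_a\<rparr>"
definition simple_c :: "complex \<Rightarrow> (hecke_elem, six) module" where
  "simple_c q = (rep6 q 0 0)\<lparr>carrier := slot_c\<rparr>"

context
  fixes q :: complex
  assumes q: "q\<^sup>2 = -1"
begin

lemma split_parameters: "(0::complex) * 0 = 0" by simp

lemmas rep6_split_simps [simp] = rep6_simps[OF q split_parameters]

lemma submodule_slots:
  "Module.submodule slot_b (hecke q) (rep6 q 0 0)" "Module.submodule slot_a (hecke q) (rep6 q 0 0)"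
  "Module.submodule slot_c (hecke q) (rep6 q 0 0)"
  by (rule submodule_rep6I[OF q split_parameters]; auto simp: slot_iff zero_prod_def)+

lemma irreducible_slotI:
  assumes S: "Module.submodule S (hecke q) (rep6 q 0 0)" and e: "e \<in> S" "e \<noteq> 0"
    and gen: "\<And>N x. Module.submodule N (hecke q) (rep6 q 0 0) \<Longrightarrow> N \<subseteq> S \<Longrightarrow> x \<in> N \<Longrightarrow> x \<noteq> 0 \<Longrightarrow> S \<subseteq> N"
  shows "irreducible_module (hecke q) ((rep6 q 0 0)\<lparr>carrier := S\<rparr>)"
proof -
  interpret R: hecke_module q "rep6 q 0 0" by (rule hecke_module_rep6[OF q split_parameters])
  show ?thesis
    unfolding irreducible_module_def
  proof (intro conjI allI impI)
    show "left_module (hecke q) ((rep6 q 0 0)\<lparr>carrier := S\<rparr>)" by (rule R.left_module_submodule[OF S])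
    show "carrier ((rep6 q 0 0)\<lparr>carrier := S\<rparr>) \<noteq> {\<zero>\<^bsub>(rep6 q 0 0)\<lparr>carrier := S\<rparr>\<^esub>}" using e by auto
    fix N assume "Module.submodule N (hecke q) ((rep6 q 0 0)\<lparr>carrier := S\<rparr>)"
    then have N: "Module.submodule N (hecke q) (rep6 q 0 0)" "N \<subseteq> S"
      using R.submodule_restrict_iff[OF S] by auto
    have "0 \<in> N" using R.submodule_props(2)[OF N(1)] by simp
    then show "N = {\<zero>\<^bsub>(rep6 q 0 0)\<lparr>carrier := S\<rparr>\<^esub>} \<or> N = carrier ((rep6 q 0 0)\<lparr>carrier := S\<rparr>)"
      using gen[OF N] N(2) by (cases "\<exists>x\<in>N. x \<noteq> 0") auto
  qed
qed

lemma irreducible_simple_b: "irreducible_module (hecke q) (simple_b q)"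
  unfolding simple_b_def
proof (rule irreducible_slotI[OF submodule_slots(1), of "(0, 0, 0, 1, 0, 0)"])
  fix N x assume N: "Module.submodule N (hecke q) (rep6 q 0 0)" "N \<subseteq> slot_b" "x \<in> N" "x \<noteq> 0"
  then obtain y where y: "x = (0, 0, 0, y, 0, 0)" "y \<noteq> 0" by (auto simp: slot_b_def zero_prod_def)
  show "slot_b \<subseteq> N"
  proof
    fix z assume "z \<in> slot_b"
    then obtain w where "z = (0, 0, 0, w, 0, 0)" by (auto simp: slot_b_def)
    then have "z = scale6 (w / y) x" using y by simp
    then show "z \<in> N" using submodule_rep6D(3)[OF q split_parameters N(1) N(3)] by simp
  qed
qed (simp_all add: slot_iff zero_prod_def)

text \<open>
  A nonzero submodule contains $a_1$, since $\tau_2 - 1$ maps $u a_1 + v a_2$ to $-3v a_1$; and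
  $\tau_1 a_1 = a_2$.
\<close>

lemma irreducible_simple_a: "irreducible_module (hecke q) (simple_a q)"
  unfolding simple_a_def
proof (rule irreducible_slotI[OF submodule_slots(2), of "(1, 0, 0, 0, 0, 0)"])
  fix N x assume N: "Module.submodule N (hecke q) (rep6 q 0 0)" "N \<subseteq> slot_a" "x \<in> N" "x \<noteq> 0"
  note D = submodule_rep6D[OF q split_parameters N(1)]
  have "x \<in> slot_a" using N(2,3) by blast
  then obtain u v where uv: "x = (u, v, 0, 0, 0, 0)" by (auto simp: slot_a_def)
  then have x: "x = (u, v, 0, 0, 0, 0)" "u \<noteq> 0 \<or> v \<noteq> 0" using N(4) by (auto simp: zero_prod_def)
  have e1: "(1, 0, 0, 0, 0, 0) \<in> N"
  proof (cases "v = 0")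
    case True
    then show ?thesis using D(3)[OF N(3), of "1 / u"] x by simp
  next
    case False
    have "scale6 (- 1 / (3 * v)) (tau 0 0 N2 x + scale6 (- 1) x) \<in> N" using D(2-4) N(3) by blast
    then show ?thesis using x False by simp
  qed
  then have e2: "(0, 1, 0, 0, 0, 0) \<in> N" using D(4)[OF e1, of N1] by simp
  show "slot_a \<subseteq> N"
  proof
    fix z assume "z \<in> slot_a"
    then obtain u v where "z = (u, v, 0, 0, 0, 0)" by (auto simp: slot_a_def)
    then have "z = scale6 u (1, 0, 0, 0, 0, 0) + scale6 v (0, 1, 0, 0, 0, 0)" by simp
    then show "z \<in> N" using D(2)[OF D(3)[OF e1] D(3)[OF e2]] by metis
  qed
qed (simp_all add: slot_iff zero_prod_def)

text \<open>
  As for \<open>simple_a\<close>, with $(\tau_1 - 1)(u c_1 + v c_2) = -v c_1$ and $\tau_2 c_1 = c_2$.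
\<close>

lemma irreducible_simple_c: "irreducible_module (hecke q) (simple_c q)"
  unfolding simple_c_def
proof (rule irreducible_slotI[OF submodule_slots(3), of "(0, 0, 0, 0, 1, 0)"])
  fix N x assume N: "Module.submodule N (hecke q) (rep6 q 0 0)" "N \<subseteq> slot_c" "x \<in> N" "x \<noteq> 0"
  note D = submodule_rep6D[OF q split_parameters N(1)]
  have "x \<in> slot_c" using N(2,3) by blast
  then obtain u v where uv: "x = (0, 0, 0, 0, u, v)" by (auto simp: slot_c_def)
  then have x: "x = (0, 0, 0, 0, u, v)" "u \<noteq> 0 \<or> v \<noteq> 0" using N(4) by (auto simp: zero_prod_def)
  have e1: "(0, 0, 0, 0, 1, 0) \<in> N"
  proof (cases "v = 0")
    case True
    then show ?thesis using D(3)[OF N(3), of "1 / u"] x by simp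
  next
    case False
    have "scale6 (- 1 / v) (tau 0 0 N1 x + scale6 (- 1) x) \<in> N" using D(2-4) N(3) by blast
    then show ?thesis using x False by simp
  qed
  then have e2: "(0, 0, 0, 0, 0, 1) \<in> N" using D(4)[OF e1, of N2] by simp
  show "slot_c \<subseteq> N"
  proof
    fix z assume "z \<in> slot_c"
    then obtain u v where "z = (0, 0, 0, 0, u, v)" by (auto simp: slot_c_def)
    then have "z = scale6 u (0, 0, 0, 0, 1, 0) + scale6 v (0, 0, 0, 0, 0, 1)" by simp
    then show "z \<in> N" using D(2)[OF D(3)[OF e1] D(3)[OF e2]] by metis
  qed
qed (simp_all add: slot_iff zero_prod_def)

lemma left_module_simples:
  "left_module (hecke q) (simple_b q)" "left_module (hecke q) (simple_a q)" "left_module (hecke q) (simple_c q)"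
  using irreducible_simple_a irreducible_simple_b irreducible_simple_c unfolding irreducible_module_def by auto

lemma hecke_C_smult_rep6: "hecke_C q c \<odot>\<^bsub>rep6 q 0 0\<^esub> x = scale6 c x"
  using rep6_split_simps(4)[of c x] by (simp add: hact_def hecke_C_def)

lemma dim_simple_b: "has_dim q (simple_b q) 1"
proof -
  interpret vectorspace class_ring "complex_space q (simple_b q)"
    by (rule vectorspace_hecke_module[OF left_module_simples(1)])
  have "fin_dim \<and> dim = 1"
    by (rule dim_one_criterion[of "(0, 0, 0, 1, 0, 0)"])
      (auto simp: simple_b_def hecke_C_smult_rep6 slot_iff slot_b_def zero_prod_def)
  then show ?thesis unfolding has_dim_def .
qed

lemma dim_simple_a: "has_dim q (simple_a q) 2"
proof -
  interpret vectorspace class_ring "complex_space q (simple_a q)"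
    by (rule vectorspace_hecke_module[OF left_module_simples(2)])
  have "fin_dim \<and> dim = 2"
    by (rule dim_two_criterion[of "(1, 0, 0, 0, 0, 0)" "(0, 1, 0, 0, 0, 0)"])
      (auto simp: simple_a_def hecke_C_smult_rep6 slot_iff slot_a_def zero_prod_def)
  then show ?thesis unfolding has_dim_def .
qed

lemma dim_simple_c: "has_dim q (simple_c q) 2"
proof -
  interpret vectorspace class_ring "complex_space q (simple_c q)"
    by (rule vectorspace_hecke_module[OF left_module_simples(3)])
  have "fin_dim \<and> dim = 2"
    by (rule dim_two_criterion[of "(0, 0, 0, 0, 1, 0)" "(0, 0, 0, 0, 0, 1)"])
      (auto simp: simple_c_def hecke_C_smult_rep6 slot_iff slot_c_def zero_prod_def)
  then show ?thesis unfolding has_dim_def .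
qed

end

lemma hecke_module_left_module: "left_module (hecke q) M \<Longrightarrow> hecke_module q M"
  by (rule hecke_module.intro)

text \<open>
  A filtration of \<open>rep6 q \<mu> \<nu>\<close> and its projections are pulled back along an isomorphism.
\<close>

lemma series_by_filtration:
  fixes M :: "(hecke_elem, 'm) module" and S :: "nat \<Rightarrow> six set" and P :: "nat \<Rightarrow> six set"
  assumes q: "q\<^sup>2 = -1" and \<mu>\<nu>: "\<mu> * \<nu> = 0" and M: "left_module (hecke q) M"
    and \<phi>: "\<phi> \<in> LinearCombinations.module_hom (hecke q) M (rep6 q \<mu> \<nu>)" and bij: "bij_betw \<phi> (carrier M) UNIV"
    and S: "S 0 = {0}" "S (length ds) = UNIV"
      "\<And>i. i \<le> length ds \<Longrightarrow> Module.submodule (S i) (hecke q) (rep6 q \<mu> \<nu>)"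
      "\<And>i. i < length ds \<Longrightarrow> S i \<subseteq> S (Suc i)"
    and P: "\<And>i. i < length ds \<Longrightarrow> irreducible_module (hecke q) ((rep6 q 0 0)\<lparr>carrier := P i\<rparr>)"
      "\<And>i. i < length ds \<Longrightarrow> has_dim q ((rep6 q 0 0)\<lparr>carrier := P i\<rparr>) (ds ! i)"
    and p_add: "\<And>i x y. p i (x + y) = p i x + p i y" and p_scale: "\<And>i c x. p i (scale6 c x) = scale6 c (p i x)"
    and p_tau: "\<And>i x j. i < length ds \<Longrightarrow> x \<in> S (Suc i) \<Longrightarrow> p i (tau \<mu> \<nu> j x) = tau 0 0 j (p i x)"
    and p_xact: "\<And>i x l. i < length ds \<Longrightarrow> x \<in> S (Suc i) \<Longrightarrow> p i (xact l x) = xact l (p i x)"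
    and p_image: "\<And>i. i < length ds \<Longrightarrow> p i ` S (Suc i) = P i"
    and p_ker: "\<And>i. i < length ds \<Longrightarrow> {x \<in> S (Suc i). p i x = 0} = S i"
  obtains Ns where "composition_series (hecke q) M Ns" and "list_all2 (has_dim q) (series_factors M Ns) ds"
    and "\<And>i. i < length ds \<Longrightarrow>
      module_isomorphic (hecke q) ((rep6 q 0 0)\<lparr>carrier := P i\<rparr>) (series_factors M Ns ! i)"
proof -
  interpret M: hecke_module q M by (rule hecke_module_left_module[OF M])
  interpret R: hecke_module q "rep6 q \<mu> \<nu>" by (rule hecke_module_rep6[OF q \<mu>\<nu>])
  note [simp] = rep6_simps[OF q \<mu>\<nu>] rep6_simps[OF q, of 0 0, simplified]
  let ?U = "\<lambda>i. {x \<in> carrier M. \<phi> x \<in> S i}"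
  have surj: "\<exists>x\<in>carrier M. y = \<phi> x" for y using bij by (auto simp: bij_betw_def)
  have subU: "Module.submodule (?U i) (hecke q) M" if "i \<le> length ds" for i
    by (rule submodule_preimage[OF M _ \<phi> S(3)[OF that]]) (rule R.left_module_axioms)
  have hom: "(\<lambda>x. p i (\<phi> x)) \<in> LinearCombinations.module_hom (hecke q) (M\<lparr>carrier := ?U (Suc i)\<rparr>)
      ((rep6 q 0 0)\<lparr>carrier := P i\<rparr>)" if i: "i < length ds" for i
  proof (rule module_homI_generators)
    show "hecke_module q (M\<lparr>carrier := ?U (Suc i)\<rparr>)"
      using M.left_module_submodule[OF subU] i by (intro hecke_module_left_module) auto
    show "hecke_module q ((rep6 q 0 0)\<lparr>carrier := P i\<rparr>)"
      using P(1)[OF i] unfolding irreducible_module_def by (intro hecke_module_left_module) auto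
  qed (use i p_image[OF i] in
      \<open>auto simp: module_homD[OF \<phi>] module_hom_hact[OF \<phi>] p_add p_scale p_tau p_xact\<close>)
  have inj0: "\<phi> x = 0 \<longleftrightarrow> x = \<zero>\<^bsub>M\<^esub>" if "x \<in> carrier M" for x
    using module_hom_inj_iff[OF M R.left_module_axioms \<phi>] bij that
      module_hom_zero[OF M R.left_module_axioms \<phi>]
    unfolding bij_betw_def by (metis rep6_simps(2)[OF q \<mu>\<nu>])
  note series = composition_series_by_projections[OF M,
      where U = ?U and ds = ds and F = "\<lambda>i. (rep6 q 0 0)\<lparr>carrier := P i\<rparr>" and f = "\<lambda>i x. p i (\<phi> x)"]
  have prem1: "?U 0 = {\<zero>\<^bsub>M\<^esub>}"
    using S(1) inj0 by auto
  have prem2: "?U (length ds) = carrier M" using S(2) by auto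
  have prem3: "?U i \<subseteq> ?U (Suc i)" if "i < length ds" for i using S(4)[OF that] by auto
  have prem4: "(\<lambda>x. p i (\<phi> x)) ` ?U (Suc i) = carrier ((rep6 q 0 0)\<lparr>carrier := P i\<rparr>)" if i: "i < length ds" for i
  proof -
    have "\<phi> ` ?U (Suc i) = S (Suc i)"
    proof (intro subset_antisym subsetI)
      fix y assume "y \<in> S (Suc i)"
      moreover obtain x where "x \<in> carrier M" "y = \<phi> x" using surj[of y] by auto
      ultimately show "y \<in> \<phi> ` ?U (Suc i)" by simp
    qed auto
    moreover have "(\<lambda>x. p i (\<phi> x)) ` ?U (Suc i) = p i ` (\<phi> ` ?U (Suc i))" by (simp only: image_image)
    ultimately show ?thesis using p_image[OF i] by simp
  qed
  have prem5: "{x \<in> ?U (Suc i). p i (\<phi> x) = \<zero>\<^bsub>(rep6 q 0 0)\<lparr>carrier := P i\<rparr>\<^esub>} = ?U i" if i: "i < length ds" for i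
    using p_ker[OF i] by auto
  show ?thesis
    by (rule that[OF series(1,2,3)]) (use prem1 prem2 prem3 prem4 prem5 subU P hom in auto)
qed

text \<open>
  The $i$-th step of the filtration, as a condition on coordinates: $b'$ is free from step one on,
  $b$ from step three on, and \<open>A\<close> and \<open>C\<close> say from which step on the planes $a$ and $c$ are.
\<close>

fun filt :: "(nat \<Rightarrow> bool) \<Rightarrow> (nat \<Rightarrow> bool) \<Rightarrow> nat \<Rightarrow> six \<Rightarrow> bool" where
  "filt A C i (a1, a2, b, b', c1, c2) \<longleftrightarrow>
     (A i \<or> a1 = 0 \<and> a2 = 0) \<and> (i \<ge> 3 \<or> b = 0) \<and> (i \<ge> 1 \<or> b' = 0) \<and> (C i \<or> c1 = 0 \<and> c2 = 0)"

fun proj_a :: "six \<Rightarrow> six" where "proj_a (a1, a2, b, b', c1, c2) = (a1, a2, 0, 0, 0, 0)"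
fun proj_b :: "six \<Rightarrow> six" where "proj_b (a1, a2, b, b', c1, c2) = (0, 0, 0, b, 0, 0)"
fun proj_b' :: "six \<Rightarrow> six" where "proj_b' (a1, a2, b, b', c1, c2) = (0, 0, 0, b', 0, 0)"
fun proj_c :: "six \<Rightarrow> six" where "proj_c (a1, a2, b, b', c1, c2) = (0, 0, 0, 0, c1, c2)"

fun swap_b :: "six \<Rightarrow> six" where "swap_b (a1, a2, b, b', c1, c2) = (a1, a2, b', b, c1, c2)"

lemma proj_linear:
  "proj_a (x + y) = proj_a x + proj_a y" "proj_a (scale6 c x) = scale6 c (proj_a x)"
  "proj_b (x + y) = proj_b x + proj_b y" "proj_b (scale6 c x) = scale6 c (proj_b x)"
  "proj_b' (x + y) = proj_b' x + proj_b' y" "proj_b' (scale6 c x) = scale6 c (proj_b' x)"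
  "proj_c (x + y) = proj_c x + proj_c y" "proj_c (scale6 c x) = scale6 c (proj_c x)"
  by (cases x; cases y; simp)+

lemma proj_xact:
  "proj_a (xact l x) = xact l (proj_a x)" "proj_b (xact l x) = xact l (proj_b x)"
  "proj_b' (xact l x) = xact l (proj_b' x)" "proj_c (xact l x) = xact l (proj_c x)"
  by (cases l; cases x; simp)+

text \<open>
  With $\mu = 1$, $\nu = 0$ the operators are triangular for the order $b', c, b, a$, and with
  $\mu = 0$, $\nu = 1$ for the order $b', a, b, c$. The truth value \<open>s\<close> selects the first case.
\<close>

lemma series_rep6:
  fixes M :: "(hecke_elem, 'm) module"
  assumes q: "q\<^sup>2 = -1" and M: "left_module (hecke q) M"
    and \<phi>: "\<phi> \<in> LinearCombinations.module_hom (hecke q) M (rep6 q (of_bool s) (of_bool (\<not> s)))" and bij: "bij_betw \<phi> (carrier M) UNIV"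
  obtains Ns where "composition_series (hecke q) M Ns"
    and "list_all2 (has_dim q) (series_factors M Ns) [1, 2, 1, 2]"
    and "module_isomorphic (hecke q) (simple_b q) (series_factors M Ns ! 0)"
proof -
  let ?S = "\<lambda>i. {x. filt (\<lambda>i. i \<ge> (if s then 4 else 2)) (\<lambda>i. i \<ge> (if s then 2 else 4)) i x}"
  let ?P = "\<lambda>i. [slot_b, if s then slot_c else slot_a, slot_b, if s then slot_a else slot_c] ! i"
  (* The projections send both lines b and b' to slot_b. *)
  let ?p = "\<lambda>i. if i = 0 then proj_b' else if i = 2 then proj_b else if (i = 1) = s then proj_c else proj_a"
  have mn: "(of_bool s :: complex) * of_bool (\<not> s) = 0" by simp
  show ?thesis
  proof (rule series_by_filtration[OF q mn M \<phi> bij, where S = ?S and P = ?P and p = ?p and ds = "[1, 2, 1, 2]"])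
    show "?S 0 = {0}" by (auto simp: zero_prod_def)
    show "?S (length [1, 2, 1, 2 :: nat]) = UNIV" by auto
    fix i
    show "Module.submodule (?S i) (hecke q) (rep6 q (of_bool s) (of_bool (\<not> s)))"
      by (rule submodule_rep6I[OF q mn]) (cases s; auto simp: zero_prod_def)+
    show "?S i \<subseteq> ?S (Suc i)" by auto
    fix x y c l j
    show "?p i (x + y) = ?p i x + ?p i y" "?p i (scale6 c x) = scale6 c (?p i x)" "?p i (xact l x) = xact l (?p i x)"
      by (simp_all add: proj_linear proj_xact)
    assume i: "i < length [1, 2, 1, 2 :: nat]"
    then have i4: "i = 0 \<or> i = 1 \<or> i = 2 \<or> i = 3" by auto
    show "irreducible_module (hecke q) (rep6 q 0 0\<lparr>carrier := ?P i\<rparr>)"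
      using i4 irreducible_simple_a[OF q] irreducible_simple_b[OF q] irreducible_simple_c[OF q]
      unfolding simple_a_def simple_b_def simple_c_def by (elim disjE; cases s) simp_all
    show "has_dim q (rep6 q 0 0\<lparr>carrier := ?P i\<rparr>) ([1, 2, 1, 2] ! i)"
      using i4 dim_simple_a[OF q] dim_simple_b[OF q] dim_simple_c[OF q]
      unfolding simple_a_def simple_b_def simple_c_def by (elim disjE; cases s) (simp_all add: One_nat_def[symmetric] del: One_nat_def)
    show "?p i (tau (of_bool s) (of_bool (\<not> s)) j x) = tau 0 0 j (?p i x)" if "x \<in> ?S (Suc i)"
      using i4 that by (elim disjE; cases s; cases j; cases x) auto
    show "{x \<in> ?S (Suc i). ?p i x = 0} = ?S i"
      using i4 by (elim disjE; cases s) (auto simp: zero_prod_def)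
    have into: "?p i x \<in> ?P i" for x
      using i4 by (elim disjE; cases s; cases x) (auto simp: slot_iff)
    (* The projection onto the line b moves the coordinate b to the place of b', and so a preimage moves it back. *)
    let ?l = "\<lambda>x. if i = 2 then swap_b x else x"
    have onto: "?l x \<in> ?S (Suc i) \<and> ?p i (?l x) = x" if "x \<in> ?P i" for x
      using i4 that by (elim disjE; cases s; cases x) (auto simp: slot_iff)
    show "?p i ` ?S (Suc i) = ?P i"
    proof (intro subset_antisym subsetI)
      fix x assume "x \<in> ?P i"
      from onto[OF this] have "?l x \<in> ?S (Suc i)" "x = ?p i (?l x)" by simp_all
      then show "x \<in> ?p i ` ?S (Suc i)" by (rule rev_image_eqI)
    qed (use into in \<open>elim imageE; simp only:\<close>)
  next
    fix Ns assume "composition_series (hecke q) M Ns"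
      and "list_all2 (has_dim q) (series_factors M Ns) [1, 2, 1, 2]"
      and "\<And>i. i < length [1, 2, 1, 2 :: nat] \<Longrightarrow>
        module_isomorphic (hecke q) (rep6 q 0 0\<lparr>carrier := ?P i\<rparr>) (series_factors M Ns ! i)"
    then show thesis using that[of Ns] by (force simp: simple_b_def)
  qed
qed

section \<open>Vectors that afford a character of a parabolic subalgebra\<close>

fun other :: "node \<Rightarrow> node" where "other N1 = N2" | "other N2 = N1"

text \<open>
  The alternating products $1$, $T_j$, $T_iT_j$, $T_jT_iT_j$, \dots{} with $j \neq i$: the minimal
  representatives of the cosets of $\langle s_i\rangle$ in $W_0$ are those with at most five factors.
\<close>

fun chain :: "node \<Rightarrow> nat \<Rightarrow> free_algebra" where
  "chain i 0 = 1"
| "chain i (Suc k) = free_T (if even k then other i else i) * chain i k"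

locale character_vector = hecke_module q M for q :: complex and M :: "(hecke_elem, 'm) module" +
  fixes i :: node and t :: weight and v :: 'm
  assumes v: "v \<in> carrier M" and T_v: "hact q M (free_T i) v = hact q M (free_C q) v"
    and X_v: "hact q M (free_X l) v = hact q M (free_C (t l)) v"
begin

definition eqv :: "free_algebra \<Rightarrow> free_algebra \<Rightarrow> bool" where
  "eqv a b \<longleftrightarrow> hact q M a v = hact q M b v"

lemma eqv_refl [simp]: "eqv a a" by (simp add: eqv_def)
lemma eqv_trans: "eqv a b \<Longrightarrow> eqv b c \<Longrightarrow> eqv a c" by (simp add: eqv_def)
lemma eqv_add: "eqv a b \<Longrightarrow> eqv a' b' \<Longrightarrow> eqv (a + a') (b + b')"
  by (simp add: eqv_def hact_simps v)
lemma eqv_mult: "eqv a b \<Longrightarrow> eqv (g * a) (g * b)"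
  by (simp add: eqv_def hact_simps v)
lemma eqv_relator: "a - b \<in> relator_ideal q \<Longrightarrow> eqv (a * c) (b * c)"
  by (simp add: eqv_def hact_simps v hact_cong)

definition U :: "nat \<Rightarrow> free_algebra set" where
  "U n = {a. \<exists>c. eqv a (\<Sum>k<n. free_C (c k) * chain i k)}"

lemma U_eqv: "eqv a b \<Longrightarrow> b \<in> U n \<Longrightarrow> a \<in> U n"
  unfolding U_def using eqv_trans by blast

lemma U_add: 
  assumes "a \<in> U n" "b \<in> U n" shows "a + b \<in> U n"
proof -
  obtain c d where "eqv a (\<Sum>k<n. free_C (c k) * chain i k)" "eqv b (\<Sum>k<n. free_C (d k) * chain i k)"
    using assms unfolding U_def by blast
  then have "eqv (a + b) (\<Sum>k<n. free_C (c k + d k) * chain i k)"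
    by (simp add: eqv_add free_C_simps distrib_right sum.distrib)
  then show ?thesis unfolding U_def by (intro CollectI exI)
qed

lemma U_C: 
  assumes "a \<in> U n" shows "free_C d * a \<in> U n"
proof -
  obtain c where "eqv a (\<Sum>k<n. free_C (c k) * chain i k)" using assms unfolding U_def by blast
  from eqv_mult[OF this, of "free_C d"] have "eqv (free_C d * a) (\<Sum>k<n. free_C (d * c k) * chain i k)"
    by (simp add: free_C_simps sum_distrib_left mult.assoc)
  then show ?thesis unfolding U_def by (intro CollectI exI)
qed

lemma U_zero: "0 \<in> U n"
  unfolding U_def by (intro CollectI exI[of _ "\<lambda>_. 0"]) (simp add: free_C_simps)

lemma U_sum: "finite S \<Longrightarrow> (\<And>s. s \<in> S \<Longrightarrow> f s \<in> U n) \<Longrightarrow> sum f S \<in> U n"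
  by (induction S rule: finite_induct) (auto simp: U_zero U_add)

lemma U_chain: 
  assumes "k < n" shows "chain i k \<in> U n"
proof -
  have "(\<Sum>j<n. free_C (if j = k then 1 else 0) * chain i j) = (\<Sum>j<n. if j = k then chain i j else 0)"
    by (rule sum.cong) (auto simp: free_C_simps)
  then have "(\<Sum>j<n. free_C (if j = k then 1 else 0) * chain i j) = chain i k" using assms by simp
  then show ?thesis unfolding U_def by (intro CollectI exI[of _ "\<lambda>j. if j = k then 1 else 0"]) simp
qed

lemma U_map:
  assumes g: "\<And>k. k < n \<Longrightarrow> g * chain i k \<in> U m" and a: "a \<in> U n"
  shows "g * a \<in> U m"
proof -
  obtain c where "eqv a (\<Sum>k<n. free_C (c k) * chain i k)" using a unfolding U_def by blast
  from eqv_mult[OF this, of g] have "eqv (g * a) (\<Sum>k<n. g * (free_C (c k) * chain i k))"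
    by (simp add: sum_distrib_left)
  moreover have "g * (free_C c * b) = free_C c * (g * b)" for c b
    by (metis free_C_comm mult.assoc)
  ultimately have "eqv (g * a) (\<Sum>k<n. free_C (c k) * (g * chain i k))" by simp
  moreover have "(\<Sum>k<n. free_C (c k) * (g * chain i k)) \<in> U m"
    using g by (intro U_sum U_C) auto
  ultimately show ?thesis by (rule U_eqv)
qed

lemma U_mono: 
  assumes "n \<le> m" "a \<in> U n" shows "a \<in> U m"
  using U_map[of n 1 m a] U_chain assms by simp

lemma T_twice: "eqv (free_T j * (free_T j * a)) (free_C (q - inverse q) * (free_T j * a) + a)"
  using eqv_relator[OF hecke_relations(3)[of j q], of a] by (simp add: distrib_right mult.assoc)

text \<open>
  $T_j$ either prolongs an alternating product or meets the same factor $T_j$, where the quadratic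
  relation applies. The product of five factors cannot be prolonged: by the braid relation
  $T_i \cdot T_jT_iT_jT_iT_j v = T_jT_iT_jT_iT_j \cdot T_i v$, and $T_iv = qv$.
\<close>

lemma T_chain:
  assumes "k < 6" shows "free_T j * chain i k \<in> U (min (k + 2) 6)"
proof (cases k)
  case 0
  show ?thesis
  proof (cases "j = i")
    case True
    have "eqv (free_T j * chain i k) (free_C q * chain i 0)" using T_v True 0 by (simp add: eqv_def)
    then show ?thesis by (rule U_eqv) (use 0 in \<open>intro U_C U_chain, simp\<close>)
  next
    case False
    then have "j = other i" by (cases i; cases j) auto
    then have "free_T j * chain i k = chain i 1" using 0 by simp
    then show ?thesis using U_chain[of 1] 0 by simp
  qed
next
  case (Suc k')
  show ?thesis
  proof (cases "j = (if even k' then other i else i)")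
    case True
    then have "eqv (free_T j * chain i k) (free_C (q - inverse q) * chain i k + chain i k')"
      using Suc T_twice[of j "chain i k'"] by simp
    then show ?thesis by (rule U_eqv) (use Suc assms in \<open>intro U_add U_C U_chain; simp\<close>)
  next
    case False
    then have j: "j = (if even k then other i else i)" using Suc by (cases i; cases j) (auto split: if_splits)
    show ?thesis
    proof (cases "k = 5")
      case False
      then show ?thesis using j U_chain[of "Suc k" "min (k + 2) 6"] assms by simp
    next
      case True
      (* Here T_j would prolong the product of five factors. *)
      have ji: "j = i" using j True by simp
      let ?T = "free_T i" and ?S = "free_T (other i)"
      have "?T * (?S * (?T * (?S * (?T * ?S)))) - ?S * (?T * (?S * (?T * (?S * ?T)))) \<in> relator_ideal q"
        using hecke_relations(4)[of q] relator_ideal_uminus[OF hecke_relations(4)[of q]]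
        by (cases i) (simp_all add: mult.assoc)
      then have "eqv (?T * (?S * (?T * (?S * (?T * ?S))))) (?S * (?T * (?S * (?T * (?S * ?T)))))"
        using eqv_relator[of _ _ 1] by simp
      moreover have "eqv ?T (free_C q)" using T_v by (simp add: eqv_def)
      then have "eqv (?S * (?T * (?S * (?T * (?S * ?T))))) (?S * (?T * (?S * (?T * (?S * free_C q)))))"
        by (intro eqv_mult)
      moreover have "chain i 5 = chain i (Suc (Suc (Suc (Suc (Suc 0)))))"
        by (simp add: numeral_eq_Suc del: chain.simps)
      then have five: "chain i 5 = ?S * (?T * (?S * (?T * ?S)))" by simp
      moreover have "?S * (?T * (?S * (?T * (?S * free_C q)))) = free_C q * chain i 5"
        unfolding five free_C_comm by (simp add: mult.assoc)
      moreover have "free_T j * chain i k = ?T * (?S * (?T * (?S * (?T * ?S))))"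
        unfolding ji True five ..
      ultimately have "eqv (free_T j * chain i k) (free_C q * chain i 5)" using eqv_trans by metis
      then show ?thesis by (rule U_eqv) (use True in \<open>intro U_C U_chain, simp\<close>)
    qed
  qed
qed

text \<open>
  The Bernstein relation moves $X^\lambda$ past the first factor and leaves only shorter products
  behind.
\<close>

lemma X_chain: "k < 6 \<Longrightarrow> free_X l * chain i k \<in> U (Suc k)"
proof (induction k arbitrary: l)
  case 0
  have "eqv (free_X l * chain i 0) (free_C (t l) * chain i 0)" using X_v by (simp add: eqv_def)
  then show ?case by (rule U_eqv) (intro U_C U_chain, simp)
next
  case (Suc k)
  let ?j = "if even k then other i else i"
  have IH: "free_X m * chain i k \<in> U (Suc k)" for m using Suc by simp
  obtain f where "demazure ?j l f" using demazure_exists by blast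
  then have "eqv (free_X l * free_T ?j * chain i k)
      ((free_T ?j * free_X (reflection ?j l) + free_C (q - inverse q) * free_X_lin f) * chain i k)"
    by (intro eqv_relator hecke_bernstein)
  then have eq: "eqv (free_X l * chain i (Suc k))
      (free_T ?j * (free_X (reflection ?j l) * chain i k) + free_C (q - inverse q) * (free_X_lin f * chain i k))"
    by (simp add: distrib_right mult.assoc)
  have "free_T ?j * (free_X (reflection ?j l) * chain i k) \<in> U (Suc (Suc k))"
  proof (rule U_map[OF _ IH])
    fix k' assume "k' < Suc k"
    then show "free_T ?j * chain i k' \<in> U (Suc (Suc k))"
      using T_chain[of k' ?j] Suc.prems U_mono[of "min (k' + 2) 6" "Suc (Suc k)"] by simp
  qed
  moreover have "free_X_lin f * chain i k \<in> U (Suc (Suc k))"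
    unfolding free_X_lin_def sum_distrib_right mult.assoc
    by (intro U_sum U_C U_mono[OF _ IH]) auto
  ultimately show ?case by (intro U_eqv[OF eq] U_add U_C)
qed

theorem cyclic_span: "\<exists>c. hact q M a v = hact q M (\<Sum>k<6. free_C (c k) * chain i k) v"
proof -
  have "\<forall>b\<in>U 6. a * b \<in> U 6"
  proof (induction a rule: free_algebra_induct)
    case (C c)
    then show ?case using U_C by blast
  next
    case (T j)
    have "free_T j * chain i k \<in> U 6" if "k < 6" for k
      using T_chain[OF that] by (rule U_mono[rotated]) simp
    then show ?case using U_map by blast
  next
    case (X l)
    have "free_X l * chain i k \<in> U 6" if "k < 6" for k
      using X_chain[OF that] by (rule U_mono[rotated]) (use that in simp)
    then show ?case using U_map by blast
  next
    case (add a b)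
    then show ?case using U_add by (simp add: distrib_right)
  next
    case (mult a b)
    then show ?case by (simp add: mult.assoc)
  qed
  moreover have "1 \<in> U 6" using U_chain[of 0 6] by simp
  ultimately have "a \<in> U 6" by fastforce
  then show ?thesis unfolding U_def eqv_def by blast
qed

end

section \<open>Induction of a character\<close>

lemma parabolic_simps [simp]:
  "ring.add (parabolic q i) = ring.add (hecke q)" "monoid.mult (parabolic q i) = monoid.mult (hecke q)"
  "\<one>\<^bsub>parabolic q i\<^esub> = \<one>\<^bsub>hecke q\<^esub>" "\<zero>\<^bsub>parabolic q i\<^esub> = \<zero>\<^bsub>hecke q\<^esub>"
  by (simp_all add: parabolic_def)

lemma hecke_gens_in_carrier:
  "range (hecke_C q) \<union> {hecke_T q i} \<union> range (hecke_X q) \<subseteq> carrier (hecke q)"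
  by (auto simp: hecke_T_def hecke_X_def)

lemma parabolic_carrier:
  "carrier (parabolic q i) \<subseteq> carrier (hecke q)" "hecke_C q c \<in> carrier (parabolic q i)"
  "hecke_T q i \<in> carrier (parabolic q i)" "hecke_X q l \<in> carrier (parabolic q i)"
  using ring.generate_ring_incl[OF ring_hecke hecke_gens_in_carrier]
  by (auto simp: parabolic_def intro: generate_ring.incl)

locale character_module =
  fixes q :: complex and i :: node and t :: weight and V :: "(hecke_elem, 'v) module" and v :: 'v
  assumes char: "is_character_module q i t V v"
begin

sublocale V: left_module "parabolic q i" V
  using char unfolding is_character_module_def by auto

lemma v: "v \<in> carrier V" "v \<noteq> \<zero>\<^bsub>V\<^esub>"
  and T_v: "hecke_T q i \<odot>\<^bsub>V\<^esub> v = hecke_C q q \<odot>\<^bsub>V\<^esub> v"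
  and X_v: "hecke_X q l \<odot>\<^bsub>V\<^esub> v = hecke_C q (t l) \<odot>\<^bsub>V\<^esub> v"
  using char unfolding is_character_module_def by blast+

sublocale VS: vectorspace class_ring "complex_space q V"
  by (rule vectorspace_complex_space[OF V.left_module_axioms]) (auto simp: parabolic_carrier(2))

lemma span_v: "w \<in> carrier V \<Longrightarrow> \<exists>c. w = hecke_C q c \<odot>\<^bsub>V\<^esub> v"
  using VS.dim_one_span[of v w] char v unfolding is_character_module_def has_dim_def by auto

lemma C_v_inject: "hecke_C q c \<odot>\<^bsub>V\<^esub> v = hecke_C q d \<odot>\<^bsub>V\<^esub> v \<longleftrightarrow> c = d"
proof
  assume eq: "hecke_C q c \<odot>\<^bsub>V\<^esub> v = hecke_C q d \<odot>\<^bsub>V\<^esub> v"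
  show "c = d"
  proof (rule ccontr)
    assume "c \<noteq> d"
    have "hecke_C q (c - d) \<odot>\<^bsub>V\<^esub> v \<oplus>\<^bsub>V\<^esub> hecke_C q d \<odot>\<^bsub>V\<^esub> v = hecke_C q c \<odot>\<^bsub>V\<^esub> v"
      using V.smult_l_distr[OF parabolic_carrier(2) parabolic_carrier(2) v(1), of "c - d" d]
      by (simp flip: hecke_C_simps)
    then have "hecke_C q (c - d) \<odot>\<^bsub>V\<^esub> v = \<zero>\<^bsub>V\<^esub>"
      using eq v(1) V.smult_closed parabolic_carrier(2) by (metis V.M.add.r_cancel_one)
    then have "hecke_C q (inverse (c - d)) \<odot>\<^bsub>V\<^esub> (hecke_C q (c - d) \<odot>\<^bsub>V\<^esub> v) = \<zero>\<^bsub>V\<^esub>"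
      using parabolic_carrier(2) by simp
    then have "(hecke_C q (inverse (c - d) * (c - d))) \<odot>\<^bsub>V\<^esub> v = \<zero>\<^bsub>V\<^esub>"
      using V.smult_assoc[OF parabolic_carrier(2) parabolic_carrier(2) v(1)] by (simp add: hecke_C_simps(2))
    then show False using \<open>c \<noteq> d\<close> v V.smult_one by (simp add: hecke_C_simps(3))
  qed
qed simp

sublocale ind: induction_data "hecke q" "parabolic q i" V
  by (intro induction_data.intro ring_hecke parabolic_carrier(1) V.smult_closed V.M.a_closed)

definition gen :: "(hecke_elem \<times> 'v \<Rightarrow>\<^sub>0 int) set" where
  "gen = ind.tens \<one>\<^bsub>hecke q\<^esub> v"

abbreviation "M \<equiv> induced_module (hecke q) (parabolic q i) V"

sublocale M: hecke_module q M
  by (intro hecke_module.intro ind.left_module_Ind)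

lemma gen_closed: "gen \<in> carrier M"
  unfolding gen_def by (rule ind.tens_closed) (simp_all add: v)

text \<open>
  $b(1 \otimes v) = b \otimes v = 1 \otimes bv$.
\<close>

lemma parabolic_gen:
  assumes b: "b \<in> carrier (parabolic q i)"
  shows "b \<odot>\<^bsub>M\<^esub> gen = ind.tens \<one>\<^bsub>hecke q\<^esub> (b \<odot>\<^bsub>V\<^esub> v)"
proof -
  have b': "b \<in> carrier (hecke q)" using b parabolic_carrier(1) by auto
  show ?thesis
    using ind.smult_tens[OF b' ind.A.one_closed v(1)] ind.tens_balanced[OF ind.A.one_closed b v(1)] b'
    unfolding gen_def by simp
qed

lemma character_vector_gen: "character_vector q M i t gen"
proof unfold_locales
  show "gen \<in> carrier M" by (rule gen_closed)
  show "hact q M (free_T i) gen = hact q M (free_C q) gen"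
    using parabolic_gen[OF parabolic_carrier(3)] parabolic_gen[OF parabolic_carrier(2), of q] T_v
    by (simp add: hact_def hecke_T_def hecke_C_def)
  show "hact q M (free_X l) gen = hact q M (free_C (t l)) gen" for l
    using parabolic_gen[OF parabolic_carrier(4), of l] parabolic_gen[OF parabolic_carrier(2), of "t l"] X_v[of l]
    by (simp add: hact_def hecke_X_def hecke_C_def)
qed

lemma gen_generates:
  assumes N: "Module.submodule N (hecke q) M" and "gen \<in> N"
  shows "N = carrier M"
proof (rule ind.submodule_tens_carrier[OF N])
  fix w assume "w \<in> carrier V"
  then obtain c where "w = hecke_C q c \<odot>\<^bsub>V\<^esub> v" using span_v by auto
  then have "ind.tens \<one>\<^bsub>hecke q\<^esub> w = hecke_C q c \<odot>\<^bsub>M\<^esub> gen"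
    using parabolic_gen[OF parabolic_carrier(2), of c] by simp
  then show "ind.tens \<one>\<^bsub>hecke q\<^esub> w \<in> N" using M.submodule_props(5)[OF N] assms(2) by simp
qed

text \<open>
  The map $cv \mapsto cu$ is linear over the parabolic subalgebra: each of its elements acts on $v$
  and on $u$ by one and the same scalar, as the generators do.
\<close>

theorem frobenius_reciprocity:
  fixes L :: "(hecke_elem, 'l) module"
  assumes u: "character_vector q L i t u"
  obtains \<phi> where "\<phi> \<in> LinearCombinations.module_hom (hecke q) M L" and "\<phi> gen = u"
proof -
  interpret L: character_vector q L i t u by (rule u)
  define g where "g w = hecke_C q (THE c. w = hecke_C q c \<odot>\<^bsub>V\<^esub> v) \<odot>\<^bsub>L\<^esub> u" for w
  have g: "g (hecke_C q c \<odot>\<^bsub>V\<^esub> v) = hecke_C q c \<odot>\<^bsub>L\<^esub> u" for c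
    unfolding g_def by (simp add: C_v_inject)
  have scalar: "\<exists>c. b \<odot>\<^bsub>V\<^esub> v = hecke_C q c \<odot>\<^bsub>V\<^esub> v \<and> b \<odot>\<^bsub>L\<^esub> u = hecke_C q c \<odot>\<^bsub>L\<^esub> u"
    if b: "b \<in> carrier (parabolic q i)" for b
  proof -
    let ?gens = "range (hecke_C q) \<union> {hecke_T q i} \<union> range (hecke_X q)"
    (* On V only elements of the parabolic subalgebra act, on L all elements of the Hecke algebra. *)
    have par: "h \<in> carrier (parabolic q i)" "h \<in> carrier (hecke q)" if "h \<in> generate_ring (hecke q) ?gens" for h
      using that parabolic_carrier(1) by (auto simp: parabolic_def)
    have C_mult: "(hecke_C q c \<otimes>\<^bsub>hecke q\<^esub> h) \<odot>\<^bsub>V\<^esub> v = hecke_C q (c * d) \<odot>\<^bsub>V\<^esub> v"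
        "(hecke_C q c \<otimes>\<^bsub>hecke q\<^esub> h) \<odot>\<^bsub>L\<^esub> u = hecke_C q (c * d) \<odot>\<^bsub>L\<^esub> u"
      if "h \<in> generate_ring (hecke q) ?gens" "h \<odot>\<^bsub>V\<^esub> v = hecke_C q d \<odot>\<^bsub>V\<^esub> v"
        "h \<odot>\<^bsub>L\<^esub> u = hecke_C q d \<odot>\<^bsub>L\<^esub> u" for c d h
      using that par[OF that(1)] v L.v V.smult_assoc[OF parabolic_carrier(2)] parabolic_carrier(2)
        L.smult_assoc[OF hecke_C_in]
      by (simp_all add: hecke_C_simps(2))
    have "b \<in> generate_ring (hecke q) ?gens" using b by (simp add: parabolic_def)
    then show ?thesis
    proof induction
      case one
      then show ?case using v L.v V.smult_one L.smult_one by (intro exI[of _ 1]) (simp add: hecke_C_simps)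
    next
      case (incl h)
      then show ?case
        using T_v X_v L.T_v L.X_v by (auto simp: hact_def hecke_T_def hecke_X_def hecke_C_def)
    next
      case (a_inv h)
      obtain a where a: "h = hecke_proj q a" using hecke_proj_surj[OF par(2)[OF a_inv.hyps]] by blast
      have "hecke_proj q (- a) = hecke_C q (- 1) \<otimes>\<^bsub>hecke q\<^esub> hecke_proj q a"
        unfolding hecke_C_def by (simp add: free_C_simps flip: hecke_proj_simps(2))
      then have "\<ominus>\<^bsub>hecke q\<^esub> h = hecke_C q (- 1) \<otimes>\<^bsub>hecke q\<^esub> h"
        unfolding a hecke_proj_uminus .
      then show ?case using a_inv C_mult by metis
    next
      case (eng_add h1 h2)
      then obtain c d where "h1 \<odot>\<^bsub>V\<^esub> v = hecke_C q c \<odot>\<^bsub>V\<^esub> v" "h1 \<odot>\<^bsub>L\<^esub> u = hecke_C q c \<odot>\<^bsub>L\<^esub> u"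
        "h2 \<odot>\<^bsub>V\<^esub> v = hecke_C q d \<odot>\<^bsub>V\<^esub> v" "h2 \<odot>\<^bsub>L\<^esub> u = hecke_C q d \<odot>\<^bsub>L\<^esub> u" by blast
      then show ?case
        using par[OF eng_add.hyps(1)] par[OF eng_add.hyps(2)] v L.v V.smult_l_distr parabolic_carrier(2)
        by (intro exI[of _ "c + d"]) (simp add: hecke_C_simps L.smult_l_distr)
    next
      case (eng_mult h1 h2)
      then obtain c d where cd: "h1 \<odot>\<^bsub>V\<^esub> v = hecke_C q c \<odot>\<^bsub>V\<^esub> v" "h1 \<odot>\<^bsub>L\<^esub> u = hecke_C q c \<odot>\<^bsub>L\<^esub> u"
        "h2 \<odot>\<^bsub>V\<^esub> v = hecke_C q d \<odot>\<^bsub>V\<^esub> v" "h2 \<odot>\<^bsub>L\<^esub> u = hecke_C q d \<odot>\<^bsub>L\<^esub> u" by blast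
      note p1 = par[OF eng_mult.hyps(1)] and p2 = par[OF eng_mult.hyps(2)]
      have "(h1 \<otimes>\<^bsub>hecke q\<^esub> h2) \<odot>\<^bsub>V\<^esub> v = (h1 \<otimes>\<^bsub>hecke q\<^esub> hecke_C q d) \<odot>\<^bsub>V\<^esub> v"
        using V.smult_assoc[OF p1(1) p2(1) v(1)] V.smult_assoc[OF p1(1) parabolic_carrier(2) v(1)] cd by simp
      moreover have "(h1 \<otimes>\<^bsub>hecke q\<^esub> h2) \<odot>\<^bsub>L\<^esub> u = (h1 \<otimes>\<^bsub>hecke q\<^esub> hecke_C q d) \<odot>\<^bsub>L\<^esub> u"
        using L.smult_assoc[OF p1(2) p2(2) L.v] L.smult_assoc[OF p1(2) hecke_C_in L.v] cd by simp
      moreover obtain a where "h1 = hecke_proj q a" using hecke_proj_surj[OF p1(2)] by blast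
      then have "h1 \<otimes>\<^bsub>hecke q\<^esub> hecke_C q d = hecke_C q d \<otimes>\<^bsub>hecke q\<^esub> h1"
        unfolding hecke_C_def by (simp add: free_C_comm flip: hecke_proj_simps(2))
      ultimately show ?case using C_mult[OF eng_mult.hyps(1) cd(1,2)] by metis
    qed
  qed
  obtain \<phi> where \<phi>: "\<phi> \<in> LinearCombinations.module_hom (hecke q) M L"
    "\<And>w. w \<in> carrier V \<Longrightarrow> \<phi> (ind.tens \<one>\<^bsub>hecke q\<^esub> w) = g w"
  proof (rule ind.induced_module_universal[OF L.left_module_axioms, of g])
    show "g w \<in> carrier L" if w: "w \<in> carrier V" for w
      using span_v[OF w] g L.v L.smult_closed by auto
    show "g (w \<oplus>\<^bsub>V\<^esub> w') = g w \<oplus>\<^bsub>L\<^esub> g w'" if w: "w \<in> carrier V" "w' \<in> carrier V" for w w'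
    proof -
      obtain c d where cd: "w = hecke_C q c \<odot>\<^bsub>V\<^esub> v" "w' = hecke_C q d \<odot>\<^bsub>V\<^esub> v"
        using span_v[OF w(1)] span_v[OF w(2)] by auto
      then have "w \<oplus>\<^bsub>V\<^esub> w' = hecke_C q (c + d) \<odot>\<^bsub>V\<^esub> v"
        using V.smult_l_distr[OF parabolic_carrier(2) parabolic_carrier(2) v(1)] by (simp add: hecke_C_simps)
      then have "g (w \<oplus>\<^bsub>V\<^esub> w') = hecke_C q (c + d) \<odot>\<^bsub>L\<^esub> u" using g by simp
      then show ?thesis
        unfolding cd g using L.smult_l_distr[OF hecke_C_in hecke_C_in L.v] by (simp add: hecke_C_simps)
    qed
    show "g (b \<odot>\<^bsub>V\<^esub> w) = b \<odot>\<^bsub>L\<^esub> g w" if b: "b \<in> carrier (parabolic q i)" and w: "w \<in> carrier V" for b w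
    proof -
      obtain c where c: "w = hecke_C q c \<odot>\<^bsub>V\<^esub> v" using span_v[OF w] by auto
      have "b \<otimes>\<^bsub>hecke q\<^esub> hecke_C q c \<in> carrier (parabolic q i)"
        using V.R.m_closed[OF b parabolic_carrier(2)] by simp
      then obtain d where d: "(b \<otimes>\<^bsub>hecke q\<^esub> hecke_C q c) \<odot>\<^bsub>V\<^esub> v = hecke_C q d \<odot>\<^bsub>V\<^esub> v"
        "(b \<otimes>\<^bsub>hecke q\<^esub> hecke_C q c) \<odot>\<^bsub>L\<^esub> u = hecke_C q d \<odot>\<^bsub>L\<^esub> u" using scalar by blast
      have "b \<odot>\<^bsub>V\<^esub> w = hecke_C q d \<odot>\<^bsub>V\<^esub> v"
        using V.smult_assoc[OF b parabolic_carrier(2) v(1), of c] d(1) c by simp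
      moreover have "b \<in> carrier (hecke q)" using b parabolic_carrier(1) by auto
      then have "b \<odot>\<^bsub>L\<^esub> g w = hecke_C q d \<odot>\<^bsub>L\<^esub> u"
        using L.smult_assoc[of b "hecke_C q c" u] L.v d(2) c g by simp
      ultimately show ?thesis using g by simp
    qed
  qed blast
  have "g v = hecke_C q 1 \<odot>\<^bsub>L\<^esub> u" using g[of 1] V.smult_one[OF v(1)] by (simp add: hecke_C_simps)
  then have "\<phi> gen = u"
    unfolding gen_def using \<phi>(2)[OF v(1)] L.smult_one[OF L.v] by (simp add: hecke_C_simps)
  then show ?thesis using that \<phi>(1) by blast
qed

end

section \<open>The induced modules as members of the family\<close>

lemma torus_point_sign:
  "torus_point 1 (- 1) = (\<lambda>(m, n). sign n)" "torus_point (- 1) 1 = (\<lambda>(m, n). sign m)"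
  "torus_point (- 1) (- 1) = (\<lambda>(m, n). sign (m + n))"
  by (auto simp: torus_point_def sign_def power_int_minus_left)

text \<open>
  The truth value \<open>s\<close> distinguishes $M$ (true) from $N$ (false) throughout.
\<close>

abbreviation model :: "complex \<Rightarrow> bool \<Rightarrow> (hecke_elem, six) module" where
  "model q s \<equiv> rep6 q (of_bool s) (of_bool (\<not> s))"

definition base_node :: "bool \<Rightarrow> node" where
  "base_node s = (if s then N2 else N1)"
definition base_weight :: "bool \<Rightarrow> weight" where
  "base_weight s = (if s then torus_point 1 (- 1) else torus_point (- 1) 1)"
definition base_vec :: "bool \<Rightarrow> six" where
  "base_vec s = (if s then (1, 0, 0, 0, 0, 0) else (0, 0, 0, 0, 1, 0))"

context
  fixes q :: complex and s :: bool
  assumes q: "q\<^sup>2 = -1"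
begin

lemma induced_parameters: "of_bool s * of_bool (\<not> s) = (0 :: complex)" by simp

interpretation R: hecke_module q "model q s" by (rule hecke_module_rep6[OF q induced_parameters])

lemmas [simp] = rep6_simps[OF q induced_parameters]

lemma character_vector_base: "character_vector q (model q s) (base_node s) (base_weight s) (base_vec s)"
proof unfold_locales
  show "base_vec s \<in> carrier (model q s)" by simp
  show "hact q (model q s) (free_T (base_node s)) (base_vec s) = hact q (model q s) (free_C q) (base_vec s)"
    by (simp, cases s) (simp_all add: base_node_def base_vec_def)
  show "hact q (model q s) (free_X l) (base_vec s) = hact q (model q s) (free_C (base_weight s l)) (base_vec s)" for l
    by (simp, cases s; cases l) (simp_all add: base_weight_def base_vec_def torus_point_sign)
qed

text \<open>
  The six vectors are triangular with respect to a suitable order of the coordinates, with powers of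
  $q$ on the diagonal.
\<close>

lemma chain_independent:
  assumes "hact q (model q s) (\<Sum>k<6. free_C (c k) * chain (base_node s) k) (base_vec s) = 0" and "k < 6"
  shows "c k = 0"
proof -
  have q0: "q \<noteq> 0" using q by auto
  define w where "w k = hact q (model q s) (chain (base_node s) k) (base_vec s)" for k
  have w_Suc: "w (Suc k) = scale6 q (tau (of_bool s) (of_bool (\<not> s)) (if even k then other (base_node s) else (base_node s)) (w k))" for k
    by (simp add: w_def R.hact_simps)
  have w0: "w 0 = base_vec s" by (simp add: w_def R.hact_simps)
  have "scale6 (c 0) (w 0) + scale6 (c 1) (w 1) + scale6 (c 2) (w 2) + scale6 (c 3) (w 3)
      + scale6 (c 4) (w 4) + scale6 (c 5) (w 5) = 0"
    using assms(1) by (simp add: w_def R.hact_simps numeral_eq_Suc del: chain.simps)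
  moreover have "w 1 = scale6 q (tau (of_bool s) (of_bool (\<not> s)) (other (base_node s)) (w 0))" using w_Suc[of 0] by simp
  moreover have "w 2 = scale6 q (tau (of_bool s) (of_bool (\<not> s)) (base_node s) (w 1))" using w_Suc[of 1] by (simp only: Suc_1 odd_one if_False)
  moreover have "w 3 = scale6 q (tau (of_bool s) (of_bool (\<not> s)) (other (base_node s)) (w 2))" using w_Suc[of 2] by simp
  moreover have "w 4 = scale6 q (tau (of_bool s) (of_bool (\<not> s)) (base_node s) (w 3))" using w_Suc[of 3] by simp
  moreover have "w 5 = scale6 q (tau (of_bool s) (of_bool (\<not> s)) (other (base_node s)) (w 4))" using w_Suc[of 4] by simp
  ultimately have "c 0 = 0 \<and> c 1 = 0 \<and> c 2 = 0 \<and> c 3 = 0 \<and> c 4 = 0 \<and> c 5 = 0"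
    using q0 by (cases s) (auto simp: w0 base_node_def base_vec_def zero_prod_def)
  moreover have "k = 0 \<or> k = 1 \<or> k = 2 \<or> k = 3 \<or> k = 4 \<or> k = 5" using assms(2) by auto
  ultimately show ?thesis by blast
qed

text \<open>
  The basis vectors are obtained from the generator one after another: for $M$ in the order
  $a_1, a_2, b, c_1, c_2, b'$, and for $N$ in the order $c_1, c_2, b, a_1, a_2, b'$.
\<close>

lemma base_generates:
  assumes N: "Module.submodule N (hecke q) (model q s)" and "base_vec s \<in> N"
  shows "N = UNIV"
proof -
  note D = submodule_rep6D[OF q induced_parameters N]
  have diff: "tau (of_bool s) (of_bool (\<not> s)) i x + scale6 c x \<in> N" if "x \<in> N" for i x c
    using D(2)[OF D(4)[OF that] D(3)[OF that]] .
  have "(1,0,0,0,0,0) \<in> N \<and> (0,1,0,0,0,0) \<in> N \<and> (0,0,1,0,0,0) \<in> N \<and> (0,0,0,1,0,0) \<in> N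
      \<and> (0,0,0,0,1,0) \<in> N \<and> (0,0,0,0,0,1) \<in> N"
  proof (cases s)
    case True
    have a1: "(1,0,0,0,0,0) \<in> N" using assms(2) True by (simp add: base_vec_def)
    have a2: "(0,1,0,0,0,0) \<in> N" using D(4)[OF a1, of N1] True by simp
    have "(-3,0,1,0,0,0) \<in> N" using diff[OF a2, of N2 "-1"] True by simp
    from D(2)[OF this D(3)[OF a1, of 3]] have b: "(0,0,1,0,0,0) \<in> N" by simp
    have c1: "(0,0,0,0,1,0) \<in> N" using diff[OF b, of N1 "-1"] True by simp
    have c2: "(0,0,0,0,0,1) \<in> N" using D(4)[OF c1, of N2] True by simp
    have "(0,0,0,1,-1,0) \<in> N" using diff[OF c2, of N1 "-1"] True by simp
    from D(2)[OF this c1] have "(0,0,0,1,0,0) \<in> N" by simp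
    then show ?thesis using a1 a2 b c1 c2 by simp
  next
    case False
    have c1: "(0,0,0,0,1,0) \<in> N" using assms(2) False by (simp add: base_vec_def)
    have c2: "(0,0,0,0,0,1) \<in> N" using D(4)[OF c1, of N2] False by simp
    have "(0,0,1,0,-1,0) \<in> N" using diff[OF c2, of N1 "-1"] False by simp
    from D(2)[OF this c1] have b: "(0,0,1,0,0,0) \<in> N" by simp
    have a1: "(1,0,0,0,0,0) \<in> N" using diff[OF b, of N2 "-1"] False by simp
    have a2: "(0,1,0,0,0,0) \<in> N" using D(4)[OF a1, of N1] False by simp
    have "(-3,0,0,1,0,0) \<in> N" using diff[OF a2, of N2 "-1"] False by simp
    from D(2)[OF this D(3)[OF a1, of 3]] have "(0,0,0,1,0,0) \<in> N" by simp
    then show ?thesis using a1 a2 b c1 c2 by simp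
  qed
  note e = this
  have "(a1, a2, b, b', c1, c2) \<in> N" for a1 a2 b b' c1 c2
  proof -
    have "scale6 a1 (1,0,0,0,0,0) + scale6 a2 (0,1,0,0,0,0) + scale6 b (0,0,1,0,0,0)
        + scale6 b' (0,0,0,1,0,0) + scale6 c1 (0,0,0,0,1,0) + scale6 c2 (0,0,0,0,0,1) \<in> N"
      using e by (intro D(2) D(3)) simp_all
    then show ?thesis by simp
  qed
  then show ?thesis by auto
qed

text \<open>
  The homomorphism of Frobenius reciprocity is onto because the image contains a generator. It is
  one-to-one because the six spanning vectors of \<open>cyclic_span\<close> have linearly independent images.
\<close>

theorem induced_iso_rep6:
  fixes V :: "(hecke_elem, 'v) module"
  assumes char: "is_character_module q (base_node s) (base_weight s) V v"
  obtains \<phi> where "\<phi> \<in> LinearCombinations.module_hom (hecke q) (induced_module (hecke q) (parabolic q (base_node s)) V) (model q s)"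
    and "bij_betw \<phi> (carrier (induced_module (hecke q) (parabolic q (base_node s)) V)) UNIV"
proof -
  interpret character_module q "base_node s" "base_weight s" V v by unfold_locales (rule char)
  obtain \<phi> where \<phi>: "\<phi> \<in> LinearCombinations.module_hom (hecke q) M (model q s)" "\<phi> gen = base_vec s"
    by (rule frobenius_reciprocity[OF character_vector_base])
  interpret x: character_vector q M "base_node s" "base_weight s" gen by (rule character_vector_gen)
  have surj: "\<phi> ` carrier M = UNIV"
    by (rule base_generates[OF submodule_image[OF M.left_module_axioms R.left_module_axioms \<phi>(1) M.submodule_carrier]])
      (use \<phi>(2) gen_closed in \<open>metis imageI\<close>)
  have cyc: "\<exists>a. y = hact q M a gen" if "y \<in> carrier M" for y
  proof -
    have "Module.submodule (range (\<lambda>a. hact q M a gen)) (hecke q) M"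
    proof (rule M.left_submoduleI)
      show "range (\<lambda>a. hact q M a gen) \<subseteq> carrier M" using gen_closed by auto
      show "\<zero>\<^bsub>M\<^esub> \<in> range (\<lambda>a. hact q M a gen)" using M.hact_simps(4)[OF gen_closed] by (metis rangeI)
      show "x \<oplus>\<^bsub>M\<^esub> y \<in> range (\<lambda>a. hact q M a gen)"
        if "x \<in> range (\<lambda>a. hact q M a gen)" "y \<in> range (\<lambda>a. hact q M a gen)" for x y
        using that by (auto simp flip: M.hact_simps(1)[OF gen_closed])
      show "b \<odot>\<^bsub>M\<^esub> x \<in> range (\<lambda>a. hact q M a gen)"
        if bx: "b \<in> carrier (hecke q)" "x \<in> range (\<lambda>a. hact q M a gen)" for b x
      proof -
        obtain a a' where "b = hecke_proj q a" "x = hact q M a' gen"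
          using hecke_proj_surj[OF bx(1)] bx(2) by auto
        then have "b \<odot>\<^bsub>M\<^esub> x = hact q M (a * a') gen"
          by (simp add: M.hact_simps(2)[OF gen_closed]) (simp add: hact_def)
        then show ?thesis by simp
      qed
    qed
    moreover have "gen \<in> range (\<lambda>a. hact q M a gen)" using M.hact_simps(3)[OF gen_closed] by (metis rangeI)
    ultimately show ?thesis using gen_generates that by blast
  qed
  have "y = \<zero>\<^bsub>M\<^esub>" if y: "y \<in> carrier M" "\<phi> y = 0" for y
  proof -
    obtain c where c: "y = hact q M (\<Sum>k<6. free_C (c k) * chain (base_node s) k) gen"
      using cyc[OF y(1)] x.cyclic_span by blast
    then have "hact q (model q s) (\<Sum>k<6. free_C (c k) * chain (base_node s) k) (base_vec s) = 0"
      using module_hom_hact[OF \<phi>(1) gen_closed] \<phi>(2) y(2) by simp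
    then have "c k = 0" if "k < 6" for k using chain_independent that by blast
    then have "(\<Sum>k<6. free_C (c k) * chain (base_node s) k) = 0"
      by (intro sum.neutral) (simp add: free_C_simps)
    then show ?thesis using c M.hact_simps(4)[OF gen_closed] by simp
  qed
  then have "inj_on \<phi> (carrier M)"
    using module_hom_inj_iff[OF M.left_module_axioms R.left_module_axioms \<phi>(1)] by simp
  then show ?thesis using that \<phi>(1) surj by (auto simp: bij_betw_def)
qed

end

section \<open>The orbit of the central character\<close>

definition central_orbit :: "weight set" where
  "central_orbit = {torus_point 1 (- 1), torus_point (- 1) (- 1), torus_point (- 1) 1}"

lemma bij_reflection: "bij (reflection i)"
  by (rule involuntory_imp_bij) simp

lemma weyl_act_reflection: "weyl_act (reflection i) t = (\<lambda>l. t (reflection i l))"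
proof -
  have "inv_into UNIV (reflection i) = reflection i"
    by (rule inv_unique_comp) (auto simp: fun_eq_iff)
  then show ?thesis by (simp add: weyl_act_def)
qed

lemma weyl_act_comp: "bij v \<Longrightarrow> bij w \<Longrightarrow> weyl_act (v \<circ> w) t = weyl_act v (weyl_act w t)"
  by (simp add: weyl_act_def o_inv_distrib fun_eq_iff)

lemma reflection_orbit:
  "(\<lambda>l. torus_point 1 (- 1) (reflection N1 l)) = torus_point 1 (- 1)"
  "(\<lambda>l. torus_point 1 (- 1) (reflection N2 l)) = torus_point (- 1) (- 1)"
  "(\<lambda>l. torus_point (- 1) (- 1) (reflection N1 l)) = torus_point (- 1) 1"
  "(\<lambda>l. torus_point (- 1) (- 1) (reflection N2 l)) = torus_point 1 (- 1)"
  "(\<lambda>l. torus_point (- 1) 1 (reflection N1 l)) = torus_point (- 1) (- 1)"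
  "(\<lambda>l. torus_point (- 1) 1 (reflection N2 l)) = torus_point (- 1) 1"
  by (auto simp: torus_point_sign reflection_simps sign_def fun_eq_iff)

lemma carrier_BijGroup_UNIV: "w \<in> carrier (BijGroup UNIV) \<longleftrightarrow> bij w"
  by (simp add: BijGroup_def Bij_def)

lemma mult_BijGroup_UNIV: "bij v \<Longrightarrow> bij w \<Longrightarrow> v \<otimes>\<^bsub>BijGroup UNIV\<^esub> w = v \<circ> w"
  by (auto simp: BijGroup_def Bij_def compose_def fun_eq_iff)

lemma one_BijGroup_UNIV: "\<one>\<^bsub>BijGroup UNIV\<^esub> = id"
  by (auto simp: BijGroup_def)

text \<open>
  The three points are permuted by the reflections, and each is the image of $t_{1,-1}$ under one of
  $s_1$, $s_2$, $s_1s_2$.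
\<close>

lemma weyl_orbit: "(\<lambda>w. weyl_act w (torus_point 1 (- 1))) ` weyl_group = central_orbit"
proof (intro subset_antisym subsetI)
  have refl_orbit: "weyl_act (reflection i) t \<in> central_orbit" if "t \<in> central_orbit" for i t
    using that reflection_orbit by (cases i) (auto simp: central_orbit_def weyl_act_reflection)
  have "bij w \<and> (\<forall>t\<in>central_orbit. weyl_act w t \<in> central_orbit)" if "w \<in> weyl_group" for w
    using that unfolding weyl_group_def
  proof (induction w rule: generate.induct)
    case one
    show ?case unfolding one_BijGroup_UNIV using bij_id by (simp add: weyl_act_def id_def)
  next
    case (incl w)
    then show ?case using refl_orbit bij_reflection by auto
  next
    case (inv w)
    then obtain i where w: "w = reflection i" by auto
    have "inv\<^bsub>BijGroup UNIV\<^esub> w = w"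
      by (rule group.inv_equality[OF group_BijGroup])
        (simp_all add: w carrier_BijGroup_UNIV bij_reflection mult_BijGroup_UNIV one_BijGroup_UNIV fun_eq_iff)
    then show ?case using refl_orbit bij_reflection w by auto
  next
    case (eng v w)
    then have "bij v" "bij w" by simp_all
    then show ?case
      unfolding mult_BijGroup_UNIV[OF \<open>bij v\<close> \<open>bij w\<close>] using eng.IH bij_comp weyl_act_comp by metis
  qed
  then show "t \<in> central_orbit" if "t \<in> (\<lambda>w. weyl_act w (torus_point 1 (- 1))) ` weyl_group" for t
    using that by (auto simp: central_orbit_def)
next
  have gens: "reflection i \<in> weyl_group" for i unfolding weyl_group_def by (rule generate.incl) simp
  have "reflection N2 \<circ> reflection N2 = id" by (auto simp: fun_eq_iff)
  have mult: "v \<circ> w \<in> weyl_group" if "v \<in> range reflection" "w \<in> range reflection" for v w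
    using that generate.eng[OF generate.incl generate.incl, of v "range reflection" w "BijGroup UNIV"] bij_reflection
    by (auto simp: weyl_group_def mult_BijGroup_UNIV)
  fix t assume "t \<in> central_orbit"
  then consider "t = weyl_act (reflection N1) (torus_point 1 (- 1))"
    | "t = weyl_act (reflection N2) (torus_point 1 (- 1))"
    | "t = weyl_act (reflection N1 \<circ> reflection N2) (torus_point 1 (- 1))"
    by (auto simp: central_orbit_def weyl_act_comp bij_reflection weyl_act_reflection reflection_orbit)
  then show "t \<in> (\<lambda>w. weyl_act w (torus_point 1 (- 1))) ` weyl_group"
    using gens mult by cases auto
qed

lemma base_weight_eq:
  "base_weight True = torus_point 1 (- 1)"
  "base_weight False = weyl_act (reflection N1 \<circ> reflection N2) (torus_point 1 (- 1))"
  by (simp_all add: base_weight_def weyl_act_comp bij_reflection weyl_act_reflection reflection_orbit)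

lemma torus_point_gens: "torus_point a b (1, 0) = a" "torus_point a b (0, 1) = b"
  by (simp_all add: torus_point_def)

lemma torus_point_add:
  "a \<noteq> 0 \<Longrightarrow> b \<noteq> 0 \<Longrightarrow> torus_point a b (l + m) = torus_point a b l * torus_point a b m"
  by (cases l; cases m) (simp add: torus_point_def power_int_add)

lemma torus_point_neg: "torus_point a b (- l) = inverse (torus_point a b l)"
  by (cases l) (simp add: torus_point_def power_int_minus)

lemma torus_point_nonzero: "a \<noteq> 0 \<Longrightarrow> b \<noteq> 0 \<Longrightarrow> torus_point a b l \<noteq> 0"
  by (cases l) (simp add: torus_point_def)

lemma torus_point_in_torus: "a \<noteq> 0 \<Longrightarrow> b \<noteq> 0 \<Longrightarrow> torus_point a b \<in> torus"
  unfolding torus_def by (intro CollectI conjI allI torus_point_add torus_point_nonzero)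

lemma torus_eq_torus_point:
  assumes "t \<in> torus" shows "t = torus_point (t (1, 0)) (t (0, 1))"
proof
  have nz: "t l \<noteq> 0" and add: "t (l + m) = t l * t m" for l m
    using assms unfolding torus_def by blast+
  have t0: "t 0 = 1" using add[of 0 0] nz[of 0] by simp
  have neg: "t (- l) = inverse (t l)" for l
    using add[of l "- l"] t0 inverse_unique[of "t l" "t (- l)"] by simp
  show "t l = torus_point (t (1, 0)) (t (0, 1)) l" for l
    by (induction l rule: wlattice_induct)
      (simp_all add: torus_point_gens torus_point_add torus_point_neg add neg nz)
qed

section \<open>Weight vectors\<close>

context hecke_module
begin

definition weight_vector :: "weight \<Rightarrow> 'm \<Rightarrow> bool" where
  "weight_vector t x \<longleftrightarrow> x \<in> carrier M \<and> x \<noteq> \<zero>\<^bsub>M\<^esub> \<and>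
     (\<forall>l. hact q M (free_X l) x = hact q M (free_C (t l)) x)"

text \<open>
  Commutation in the Hecke algebra, expressed for representatives in the free algebra.
\<close>

definition commutes :: "free_algebra \<Rightarrow> free_algebra \<Rightarrow> bool" where
  "commutes a b \<longleftrightarrow> a * b - b * a \<in> relator_ideal q"

lemma hact_commutes:
  "commutes a b \<Longrightarrow> x \<in> carrier M \<Longrightarrow> hact q M a (hact q M b x) = hact q M b (hact q M a x)"
  unfolding commutes_def using hact_cong[of "a * b" "b * a" x] by (simp add: hact_simps)

lemma commutes_X: "commutes (free_X l) (free_X m)"
proof -
  have "free_X l * free_X m - free_X m * free_X l
      = (free_X l * free_X m - free_X (l + m)) - (free_X m * free_X l - free_X (m + l))"
    by (simp add: add.commute)
  then show ?thesis unfolding commutes_def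
    using relator_ideal_diff[OF hecke_relations(2) hecke_relations(2)] by metis
qed

lemma commutes_C: "commutes a (free_C c)"
  using relator_ideal_closed(1) by (simp add: commutes_def free_C_comm)

lemma commutes_add: "commutes a b \<Longrightarrow> commutes a c \<Longrightarrow> commutes a (b + c)"
  unfolding commutes_def using relator_ideal_closed(2)[of "a * b - b * a" q "a * c - c * a"]
  by (simp add: algebra_simps)

lemma commutes_mult:
  assumes "commutes a b" "commutes a c" shows "commutes a (b * c)"
proof -
  have "(a * b - b * a) * c + b * (a * c - c * a) \<in> relator_ideal q"
    using assms unfolding commutes_def by (intro relator_ideal_closed)
  then show ?thesis unfolding commutes_def by (simp add: algebra_simps)
qed

text \<open>
  A product of linear factors in $X^\lambda$: powers of one factor express generalized weight spaces,
  and products of different ones the annihilation of the module.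
\<close>

definition factors :: "wlattice \<Rightarrow> complex list \<Rightarrow> free_algebra" where
  "factors l as = prod_list (map (\<lambda>a. free_X l + free_C (- a)) as)"

lemma commutes_factors: "commutes (free_X m) (factors l as)"
  unfolding factors_def
proof (induction as)
  case Nil
  show ?case using commutes_C[of _ 1] by (simp add: free_C_simps)
next
  case (Cons a as)
  then show ?case by (simp add: commutes_mult commutes_add commutes_X commutes_C del: minus_add_distrib)
qed

lemma shift_eq_zero_iff:
  assumes "x \<in> carrier M"
  shows "hact q M (a + free_C (- c)) x = \<zero>\<^bsub>M\<^esub> \<longleftrightarrow> hact q M a x = hact q M (free_C c) x"
proof -
  have "hact q M (a + free_C (- c)) x = hact q M a x \<oplus>\<^bsub>M\<^esub> \<ominus>\<^bsub>M\<^esub> hact q M (free_C c) x"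
    using assms by (simp add: hact_diff free_C_simps)
  then show ?thesis
    using assms M.minus_equality[of "hact q M a x" "\<ominus>\<^bsub>M\<^esub> hact q M (free_C c) x"] by (auto simp: M.r_neg)
qed

text \<open>
  Apply the factors one at a time, from the right; the last nonzero vector is an eigenvector. The set
  \<open>S\<close> keeps track of further properties that the factors preserve.
\<close>

lemma eigenvector_in:
  assumes sub: "S \<subseteq> carrier M" and inv: "\<And>y c. y \<in> S \<Longrightarrow> hact q M (free_X l + free_C c) y \<in> S"
    and x: "x \<in> S" "x \<noteq> \<zero>\<^bsub>M\<^esub>" "hact q M (factors l as) x = \<zero>\<^bsub>M\<^esub>"
  shows "\<exists>y\<in>S. y \<noteq> \<zero>\<^bsub>M\<^esub> \<and> (\<exists>a\<in>set as. hact q M (free_X l) y = hact q M (free_C a) y)"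
  using x
proof (induction as arbitrary: x rule: rev_induct)
  case Nil
  then show ?case using sub by (auto simp: factors_def hact_simps)
next
  case (snoc a as)
  let ?x = "hact q M (free_X l + free_C (- a)) x"
  have xM: "x \<in> carrier M" using snoc.prems sub by auto
  show ?case
  proof (cases "?x = \<zero>\<^bsub>M\<^esub>")
    case True
    then show ?thesis using shift_eq_zero_iff[OF xM] snoc.prems by auto
  next
    case False
    have "hact q M (factors l as) ?x = \<zero>\<^bsub>M\<^esub>"
      using snoc.prems(3) xM by (simp add: factors_def hact_simps(2))
    then show ?thesis using snoc.IH[OF inv[OF snoc.prems(1)] False] by auto
  qed
qed

text \<open>
  First find an eigenvector of $X^l$ in the kernel of the second product, then an eigenvector of
  $X^m$ in the eigenspace so found.
\<close>

lemma joint_eigenvector: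
  assumes x: "x \<in> carrier M" "x \<noteq> \<zero>\<^bsub>M\<^esub>"
    and fac: "hact q M (factors l as) x = \<zero>\<^bsub>M\<^esub>" "hact q M (factors m bs) x = \<zero>\<^bsub>M\<^esub>"
  obtains a b y where "a \<in> set as" "b \<in> set bs" "y \<in> carrier M" "y \<noteq> \<zero>\<^bsub>M\<^esub>"
    "hact q M (free_X l) y = hact q M (free_C a) y" "hact q M (free_X m) y = hact q M (free_C b) y"
proof -
  let ?S = "{y \<in> carrier M. hact q M (factors m bs) y = \<zero>\<^bsub>M\<^esub>}"
  have "\<exists>y\<in>?S. y \<noteq> \<zero>\<^bsub>M\<^esub> \<and> (\<exists>a\<in>set as. hact q M (free_X l) y = hact q M (free_C a) y)"
  proof (rule eigenvector_in[OF _ _ _ x(2) fac(1)])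
    fix y c assume y: "y \<in> ?S"
    have "hact q M (factors m bs) (hact q M (free_X l + free_C c) y)
        = hact q M (free_X l) (hact q M (factors m bs) y) \<oplus>\<^bsub>M\<^esub> hact q M (free_C c) (hact q M (factors m bs) y)"
      using y by (simp add: hact_simps hact_add_right hact_commutes[OF commutes_factors, symmetric]
          hact_commutes[OF commutes_C])
    then show "hact q M (free_X l + free_C c) y \<in> ?S" using y by simp
  qed (use x fac in auto)
  then obtain y a where y: "y \<in> carrier M" "hact q M (factors m bs) y = \<zero>\<^bsub>M\<^esub>" "y \<noteq> \<zero>\<^bsub>M\<^esub>" "a \<in> set as"
    "hact q M (free_X l) y = hact q M (free_C a) y" by blast
  let ?E = "{z \<in> carrier M. hact q M (free_X l) z = hact q M (free_C a) z}"
  have "\<exists>z\<in>?E. z \<noteq> \<zero>\<^bsub>M\<^esub> \<and> (\<exists>b\<in>set bs. hact q M (free_X m) z = hact q M (free_C b) z)"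
  proof (rule eigenvector_in[OF _ _ _ y(3) y(2)])
    fix z c assume z: "z \<in> ?E"
    have "hact q M (free_X l) (hact q M (free_X m + free_C c) z)
        = hact q M (free_X m + free_C c) (hact q M (free_X l) z)"
      using z by (intro hact_commutes commutes_add commutes_X commutes_C) auto
    also have "\<dots> = hact q M (free_X m + free_C c) (hact q M (free_C a) z)" using z by simp
    also have "\<dots> = hact q M (free_C a) (hact q M (free_X m + free_C c) z)"
      using z by (intro hact_commutes commutes_C) auto
    finally show "hact q M (free_X m + free_C c) z \<in> ?E" using z by simp
  qed (use y in auto)
  then show ?thesis using that y(4) by blast
qed

lemma weight_vector_torus_point:
  assumes y: "y \<in> carrier M" "y \<noteq> \<zero>\<^bsub>M\<^esub>" and ab: "a \<noteq> 0" "b \<noteq> 0"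
    and X: "hact q M (free_X (1, 0)) y = hact q M (free_C a) y" "hact q M (free_X (0, 1)) y = hact q M (free_C b) y"
  shows "weight_vector (torus_point a b) y"
proof -
  have C_C: "hact q M (free_C c) (hact q M (free_C d) y) = hact q M (free_C (c * d)) y" for c d
    using y by (simp add: free_C_simps hact_simps)
  have X_X: "hact q M (free_X l) (hact q M (free_X m) y) = hact q M (free_X (l + m)) y" for l m
    using y hact_cong[OF hecke_relations(2)] by (simp flip: hact_simps(2))
  have X_0: "hact q M (free_X 0) y = y"
    using hact_cong[OF hecke_relations(1), of y] y by (simp add: hact_simps)
  have X_C: "hact q M (free_X l) (hact q M (free_C c) y) = hact q M (free_C c) (hact q M (free_X l) y)" for l c
    using y by (intro hact_commutes commutes_C)
  have "hact q M (free_X l) y = hact q M (free_C (torus_point a b l)) y" for l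
  proof (induction l rule: wlattice_induct)
    case (add l m)
    have "hact q M (free_X (l + m)) y = hact q M (free_X l) (hact q M (free_C (torus_point a b m)) y)"
      using add by (simp flip: X_X)
    also have "\<dots> = hact q M (free_C (torus_point a b m)) (hact q M (free_C (torus_point a b l)) y)"
      using add by (simp add: X_C)
    finally show ?case by (simp add: C_C torus_point_add[OF ab] mult.commute)
  next
    case (neg l)
    let ?c = "torus_point a b l"
    have "hact q M (free_C (inverse ?c)) (hact q M (free_X (- l)) (hact q M (free_X l) y))
        = hact q M (free_C (inverse ?c)) y" by (simp add: X_X X_0)
    moreover have "hact q M (free_C (inverse ?c)) (hact q M (free_X (- l)) (hact q M (free_X l) y))
        = hact q M (free_C (inverse ?c)) (hact q M (free_C ?c) (hact q M (free_X (- l)) y))"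
      by (simp add: neg X_C)
    moreover have "\<dots> = hact q M (free_C (inverse ?c * ?c)) (hact q M (free_X (- l)) y)"
      using y by (simp add: free_C_simps hact_simps)
    ultimately show ?case
      using torus_point_nonzero[OF ab, of l] y by (simp add: torus_point_neg free_C_simps hact_simps)
  qed (use X in \<open>simp_all add: torus_point_gens\<close>)
  then show ?thesis using y by (simp add: weight_vector_def)
qed

lemma gen_weight_space_iff:
  "x \<in> gen_weight_space q M t \<longleftrightarrow>
     x \<in> carrier M \<and> (\<forall>l. \<exists>k>0. hact q M (factors l (replicate k (t l))) x = \<zero>\<^bsub>M\<^esub>)"
proof -
  have minus: "hecke_X q l \<ominus>\<^bsub>hecke q\<^esub> hecke_C q c = hecke_proj q (free_X l + free_C (- c))" for l c
    unfolding hecke_X_def hecke_C_def a_minus_def free_C_simps(5) hecke_proj_simps(1) hecke_proj_uminus ..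
  have power: "factors l (replicate k c) = (free_X l + free_C (- c)) ^ k" for l k c
    unfolding factors_def by (induction k) simp_all
  show ?thesis
    unfolding gen_weight_space_def hact_def minus power hecke_proj_power by simp
qed

lemma weights_iff: "t \<in> weights q M \<longleftrightarrow> t \<in> torus \<and> (\<exists>y. weight_vector t y)"
proof
  assume t: "t \<in> weights q M"
  then have torus: "t \<in> torus" by (simp add: weights_def)
  have "\<zero>\<^bsub>M\<^esub> \<in> gen_weight_space q M t"
    unfolding gen_weight_space_iff by (auto intro!: exI[of _ "Suc 0"])
  then obtain x where x: "x \<in> gen_weight_space q M t" "x \<noteq> \<zero>\<^bsub>M\<^esub>"
    using t unfolding weights_def by blast
  have xM: "x \<in> carrier M" using x(1) unfolding gen_weight_space_iff by blast
  obtain k k' where "hact q M (factors (1, 0) (replicate k (t (1, 0)))) x = \<zero>\<^bsub>M\<^esub>"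
    "hact q M (factors (0, 1) (replicate k' (t (0, 1)))) x = \<zero>\<^bsub>M\<^esub>"
    using x(1) unfolding gen_weight_space_iff by meson
  from joint_eigenvector[OF xM x(2) this] obtain a b y where y:
    "a \<in> set (replicate k (t (1, 0)))" "b \<in> set (replicate k' (t (0, 1)))" "y \<in> carrier M" "y \<noteq> \<zero>\<^bsub>M\<^esub>"
    "hact q M (free_X (1, 0)) y = hact q M (free_C a) y" "hact q M (free_X (0, 1)) y = hact q M (free_C b) y"
    by blast
  then have ab: "a = t (1, 0)" "b = t (0, 1)" by (simp_all add: in_set_replicate)
  have nz: "t (1, 0) \<noteq> 0" "t (0, 1) \<noteq> 0" using torus unfolding torus_def by blast+
  have "weight_vector (torus_point (t (1, 0)) (t (0, 1))) y"
    using y nz unfolding ab by (intro weight_vector_torus_point)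
  then have "weight_vector t y" using torus_eq_torus_point[OF torus] by metis
  then show "t \<in> torus \<and> (\<exists>y. weight_vector t y)" using torus by blast
next
  assume "t \<in> torus \<and> (\<exists>y. weight_vector t y)"
  then obtain y where t: "t \<in> torus" and y: "weight_vector t y" by blast
  have yM: "y \<in> carrier M" "y \<noteq> \<zero>\<^bsub>M\<^esub>" "\<And>l. hact q M (free_X l) y = hact q M (free_C (t l)) y"
    using y unfolding weight_vector_def by blast+
  have "hact q M (factors l (replicate (Suc 0) (t l))) y = \<zero>\<^bsub>M\<^esub>" for l
    using shift_eq_zero_iff[OF yM(1)] yM(3) by (simp add: factors_def)
  then have "y \<in> gen_weight_space q M t"
    unfolding gen_weight_space_iff using yM(1) zero_less_Suc by blast
  then show "t \<in> weights q M" using t yM(2) unfolding weights_def by blast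
qed

end

section \<open>Intertwiners\<close>

text \<open>
  The quotient \<open>f\<close> is evaluated at a point of the torus, which is an algebra homomorphism
  $\mathbb{C}[X] \to \mathbb{C}$.
\<close>

lemma weyl_eval_demazure:
  assumes t: "t \<in> torus" and f: "demazure i l f"
  shows "(\<Sum>k\<in>Poly_Mapping.keys f. Poly_Mapping.lookup f k * t k) * (1 - t (- simple_root i))
    = t l - t (reflection i l)"
proof -
  have t0: "t 0 = 1" and t_add: "t (k + m) = t k * t m" for k m
  proof -
    have nz: "t k \<noteq> 0" and add: "t (k + m) = t k * t m" for k m using t unfolding torus_def by blast+
    show "t (k + m) = t k * t m" by (rule add)
    show "t 0 = 1" using add[of 0 0] nz[of 0] by simp
  qed
  interpret E: complex_monoid_rep "(*)" "\<lambda>k z. t k * z"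
    by unfold_locales (simp_all add: t0 t_add algebra_simps)
  have single: "E.ext (mon k) z = t k * z" for k z by (simp add: E.ext_single)
  have "E.ext (f * (1 - mon (- simple_root i))) 1 = E.ext f ((1 - t (- simple_root i)) * 1)"
    by (simp add: E.ext_mult E.ext_diff single)
  also have "\<dots> = (1 - t (- simple_root i)) * E.ext f 1" by (rule E.ext_scl)
  finally have "(1 - t (- simple_root i)) * E.ext f 1 = t l - t (reflection i l)"
    using f unfolding demazure_def by (simp add: E.ext_diff single)
  moreover have "E.ext f 1 = (\<Sum>k\<in>Poly_Mapping.keys f. Poly_Mapping.lookup f k * t k)"
    by (simp add: E.ext_def)
  ultimately show ?thesis by (simp only: mult.commute)
qed

context hecke_module
begin

lemma hact_free_X_lin:
  assumes x: "x \<in> carrier M" "\<And>l. hact q M (free_X l) x = hact q M (free_C (t l)) x"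
  shows "hact q M (free_X_lin f) x
    = hact q M (free_C (\<Sum>k\<in>Poly_Mapping.keys f. Poly_Mapping.lookup f k * t k)) x"
proof -
  have "hact q M (\<Sum>k\<in>S. free_C (Poly_Mapping.lookup f k) * free_X k) x
      = hact q M (free_C (\<Sum>k\<in>S. Poly_Mapping.lookup f k * t k)) x" if "finite S" for S
    using that by induction (simp_all add: x free_C_simps hact_simps)
  then show ?thesis unfolding free_X_lin_def by simp
qed

text \<open>
  When $t(X^{\alpha_i}) = -1$, the quotient in the Bernstein relation takes the value
  $\frac{1}{2}(t(X^\lambda) - t(X^{s_i\lambda}))$, and its factor is $q - q^{-1} = 2q$. So
  $X^\lambda(T_i - q)x = t(X^{s_i\lambda})(T_i - q)x$. Moreover $(T_i - q)^2 = 0$.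
\<close>

lemma intertwiner:
  assumes q: "q\<^sup>2 = -1" and t: "t \<in> torus" "t (simple_root i) = -1"
    and x: "x \<in> carrier M" "\<And>l. hact q M (free_X l) x = hact q M (free_C (t l)) x"
  defines "y \<equiv> hact q M (free_T i + free_C (- q)) x"
  shows "hact q M (free_X l) y = hact q M (free_C (t (reflection i l))) y"
    and "hact q M (free_T i) y = hact q M (free_C q) y"
proof -
  let ?h = "\<lambda>a. hact q M a x"
  have qq: "inverse q = - q" "q * q = -1" using q by (auto simp: power2_eq_square intro!: inverse_unique)
  have tneg: "t (- simple_root i) = -1"
  proof -
    have nz: "t k \<noteq> 0" and add: "t (k + m) = t k * t m" for k m using t(1) unfolding torus_def by blast+
    have "t 0 = 1" using add[of 0 0] nz[of 0] by simp
    then have "- t (- simple_root i) = 1" using add[of "- simple_root i" "simple_root i"] t(2) by simp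
    then show ?thesis by (metis add.inverse_inverse)
  qed
  obtain f where f: "demazure i l f" using demazure_exists by blast
  let ?f = "\<Sum>k\<in>Poly_Mapping.keys f. Poly_Mapping.lookup f k * t k"
  have two_f: "2 * ?f = t l - t (reflection i l)"
    using weyl_eval_demazure[OF t(1) f] tneg by (simp add: mult.commute)
  have C: "hact q M a (?h (free_C c)) = ?h (free_C c * a)" for a c
    using x(1) by (simp add: free_C_comm hact_simps)
  have "hact q M (free_X l) y = ?h (free_X l * free_T i + free_X l * free_C (- q))"
    unfolding y_def using x(1) by (simp add: distrib_left flip: hact_simps(2))
  also have "\<dots> = ?h (free_T i * free_X (reflection i l) + free_C (q - inverse q) * free_X_lin f
      + free_C (- q) * free_X l)"
    using hact_cong[OF hecke_bernstein[OF f, of q], of x] x(1) by (simp add: hact_simps(1) free_C_comm[of "- q"])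
  also have "\<dots> = ?h (free_C (t (reflection i l)) * free_T i + free_C (2 * q * ?f) + free_C (- q * t l))"
  proof -
    (* The three terms are evaluated separately on x. *)
    have two_q: "q - inverse q = 2 * q" using qq by simp
    have "?h (free_T i * free_X (reflection i l)) = ?h (free_C (t (reflection i l)) * free_T i)"
      using x(1) by (simp add: hact_simps(2) x(2)) (simp add: C hact_simps(2))
    moreover have "?h (free_C (2 * q) * free_X_lin f) = ?h (free_C (2 * q * ?f))"
      unfolding free_C_simps(4)[of "2 * q" ?f] hact_simps(2)[OF x(1)] hact_free_X_lin[OF x] ..
    moreover have "?h (free_C (- q) * free_X l) = ?h (free_C (- q * t l))"
      unfolding free_C_simps(4)[of "- q" "t l"] hact_simps(2)[OF x(1)] x(2) ..
    ultimately show ?thesis unfolding two_q by (simp only: hact_simps(1)[OF x(1)])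
  qed
  also have "free_C (t (reflection i l)) * free_T i + free_C (2 * q * ?f) + free_C (- q * t l)
      = free_C (t (reflection i l)) * (free_T i + free_C (- q))"
  proof -
    have "2 * q * ?f = q * (2 * ?f)" by (simp only: mult.assoc mult.left_commute)
    then have "2 * q * ?f + - q * t l = t (reflection i l) * - q"
      unfolding two_f by (simp add: algebra_simps)
    then have "free_C (2 * q * ?f) + free_C (- q * t l) = free_C (t (reflection i l)) * free_C (- q)"
      unfolding free_C_simps(3)[symmetric] free_C_simps(4)[symmetric] by (rule arg_cong)
    then show ?thesis by (simp only: distrib_left add.assoc)
  qed
  also have "?h (free_C (t (reflection i l)) * (free_T i + free_C (- q)))
      = hact q M (free_C (t (reflection i l))) y"
    unfolding y_def using x(1) by (rule hact_simps(2))
  finally show "hact q M (free_X l) y = hact q M (free_C (t (reflection i l))) y" .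
  have "free_T i * (free_T i + free_C (- q)) - free_C q * (free_T i + free_C (- q))
      = free_T i * free_T i - (free_C (q - inverse q) * free_T i + 1)"
  proof -
    have "free_T i * free_C (- q) = - (free_C q * free_T i)"
      unfolding free_C_comm[of "- q" "free_T i", symmetric] by (simp add: free_C_simps(5))
    moreover have "free_C q * free_C (- q) = 1"
      unfolding free_C_simps(4)[symmetric] using qq(2) by (simp add: free_C_simps(2))
    moreover have "free_C (q - inverse q) = free_C q + free_C q"
      unfolding qq(1) free_C_simps(3)[symmetric] by simp
    ultimately show ?thesis by (simp add: distrib_left distrib_right)
  qed
  then have "free_T i * (free_T i + free_C (- q)) - free_C q * (free_T i + free_C (- q)) \<in> relator_ideal q"
    using hecke_relations(3) by simp
  from hact_cong[OF this, of x] show "hact q M (free_T i) y = hact q M (free_C q) y"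
    unfolding y_def hact_simps(2)[OF x(1)] .
qed

end

context hecke_module
begin

text \<open>
  From a vector of weight $b$ the two intertwiners lead to the weights $c$ and $a$; if both vanish,
  then $T_1$ and $T_2$ act by $q$. From a vector of weight $a$ or $c$ the one intertwiner that is
  available either vanishes or leads to the weight $b$.
\<close>

lemma weight_vector_trichotomy:
  assumes q: "q\<^sup>2 = -1" and t: "t \<in> central_orbit" and x: "weight_vector t x"
  obtains (induced) s u where "u \<noteq> \<zero>\<^bsub>M\<^esub>" "character_vector q M (base_node s) (base_weight s) u"
    | (one_dimensional) u where "u \<in> carrier M" "u \<noteq> \<zero>\<^bsub>M\<^esub>" "\<And>i. hact q M (free_T i) u = hact q M (free_C q) u"
      "\<And>l. hact q M (free_X l) u = hact q M (free_C (torus_point (- 1) (- 1) l)) u"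
proof -
  have char: "character_vector q M i t u"
    if "u \<in> carrier M" "hact q M (free_T i) u = hact q M (free_C q) u"
      "\<And>l. hact q M (free_X l) u = hact q M (free_C (t l)) u" for i t u
    using that by unfold_locales auto
  have torus: "torus_point a b \<in> torus" if "a = 1 \<or> a = -1" "b = 1 \<or> b = -1" for a b
    using that by (intro torus_point_in_torus) auto
  have closed: "hact q M (free_T i + free_C (- q)) y \<in> carrier M" if "y \<in> carrier M" for i y
    using that by simp
  have middle: thesis if z: "weight_vector (torus_point (- 1) (- 1)) z" for z
  proof -
    have zM: "z \<in> carrier M" "z \<noteq> \<zero>\<^bsub>M\<^esub>"
      "\<And>l. hact q M (free_X l) z = hact q M (free_C (torus_point (- 1) (- 1) l)) z"
      using z unfolding weight_vector_def by blast+
    let ?y = "\<lambda>i. hact q M (free_T i + free_C (- q)) z"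
    have I: "hact q M (free_X l) (?y i) = hact q M (free_C (torus_point (- 1) (- 1) (reflection i l))) (?y i)"
        "hact q M (free_T i) (?y i) = hact q M (free_C q) (?y i)" for i l
      using intertwiner[OF q torus _ zM(1,3), of i] by (cases i; simp add: torus_point_gens)+
    have refl: "torus_point (- 1) (- 1) (reflection N1 l) = base_weight False l"
      "torus_point (- 1) (- 1) (reflection N2 l) = base_weight True l" for l
      using reflection_orbit(3,4)[THEN fun_cong, of l] by (simp_all add: base_weight_def)
    consider "?y N1 \<noteq> \<zero>\<^bsub>M\<^esub>" | "?y N2 \<noteq> \<zero>\<^bsub>M\<^esub>" | "?y N1 = \<zero>\<^bsub>M\<^esub>" "?y N2 = \<zero>\<^bsub>M\<^esub>" by blast
    then show thesis
    proof cases
      case 1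
      have "character_vector q M (base_node False) (base_weight False) (?y N1)"
        using I(1)[of _ N1] I(2)[of N1] closed[OF zM(1)] unfolding refl by (intro char) (simp_all add: base_node_def)
      then show thesis using induced 1 by blast
    next
      case 2
      have "character_vector q M (base_node True) (base_weight True) (?y N2)"
        using I(1)[of _ N2] I(2)[of N2] closed[OF zM(1)] unfolding refl by (intro char) (simp_all add: base_node_def)
      then show thesis using induced 2 by blast
    next
      case 3
      then have "hact q M (free_T i) z = hact q M (free_C q) z" for i
        using shift_eq_zero_iff[OF zM(1)] by (cases i) auto
      then show thesis using one_dimensional zM by blast
    qed
  qed
  have xM: "x \<in> carrier M" "x \<noteq> \<zero>\<^bsub>M\<^esub>" "\<And>l. hact q M (free_X l) x = hact q M (free_C (t l)) x"
    using x unfolding weight_vector_def by blast+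
  have step: thesis
    if s: "t = base_weight s" "t (simple_root (base_node s)) = - 1"
      "\<And>l. t (reflection (base_node s) l) = torus_point (- 1) (- 1) l" "t \<in> torus" for s
  proof -
    let ?y = "hact q M (free_T (base_node s) + free_C (- q)) x"
    show thesis
    proof (cases "?y = \<zero>\<^bsub>M\<^esub>")
      case True
      then have "character_vector q M (base_node s) (base_weight s) x"
        using shift_eq_zero_iff[OF xM(1)] xM s(1) by (intro char) auto
      then show thesis using induced xM(2) by blast
    next
      case False
      have "weight_vector (torus_point (- 1) (- 1)) ?y"
        unfolding weight_vector_def
        using False closed[OF xM(1)] intertwiner(1)[OF q s(4,2) xM(1,3)] unfolding s(3) by blast
      then show thesis by (rule middle)
    qed
  qed
  consider "t = torus_point (- 1) (- 1)" | "t = base_weight True" | "t = base_weight False"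
    using t by (auto simp: central_orbit_def base_weight_def)
  then show thesis
  proof cases
    case 1
    then show thesis using middle x by simp
  next
    case 2
    show thesis
      by (rule step[OF 2])
        (use 2 torus reflection_orbit(2)[THEN fun_cong] in \<open>simp_all add: base_weight_def base_node_def torus_point_gens\<close>)
  next
    case 3
    show thesis
      by (rule step[OF 3])
        (use 3 torus reflection_orbit(5)[THEN fun_cong] in \<open>simp_all add: base_weight_def base_node_def torus_point_gens\<close>)
  qed
qed

end

section \<open>The annihilator of the induced modules\<close>

text \<open>
  The elements $(X^{2\alpha_1} - 1)^2$, $(X^{2\alpha_2} - 1)^2$ and
  $(X^{\alpha_1} + 1)^2(X^{\alpha_2} + 1)^2$. Their common zeros have
  $X^{\alpha_1}, X^{\alpha_2} \in \{1, -1\}$, not both $1$; the squares account for the Jordan blocks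
  of size two.
\<close>

definition orbit_annihilators :: "free_algebra list" where
  "orbit_annihilators =
     [prod_list (map (\<lambda>a. free_X (1, 0) + free_C (- a)) [1, -1, 1, -1]),
      prod_list (map (\<lambda>a. free_X (0, 1) + free_C (- a)) [1, -1, 1, -1]),
      (free_X (1, 0) + free_C 1) * (free_X (0, 1) + free_C 1) * (free_X (1, 0) + free_C 1) * (free_X (0, 1) + free_C 1)]"

lemma orbit_annihilators_rep6:
  assumes q: "q\<^sup>2 = -1" and mn: "m * n = 0" and z: "z \<in> set orbit_annihilators"
  shows "hact q (rep6 q m n) z x = 0"
proof -
  interpret R: hecke_module q "rep6 q m n" by (rule hecke_module_rep6[OF q mn])
  show ?thesis
    using z by (cases x) (auto simp: orbit_annihilators_def R.hact_simps rep6_simps[OF q mn] algebra_simps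
      zero_prod_def simp del: minus_add_distrib)
qed

lemma (in hecke_module) central_character_if_annihilated:
  assumes nz: "carrier M \<noteq> {\<zero>\<^bsub>M\<^esub>}"
    and ann: "\<And>z x. z \<in> set orbit_annihilators \<Longrightarrow> x \<in> carrier M \<Longrightarrow> hact q M z x = \<zero>\<^bsub>M\<^esub>"
  shows "has_central_character q M (torus_point 1 (- 1))"
proof -
  have in_orbit: "torus_point a b \<in> central_orbit"
    if y: "y \<in> carrier M" "y \<noteq> \<zero>\<^bsub>M\<^esub>" "hact q M (free_X (1, 0)) y = hact q M (free_C a) y"
      "hact q M (free_X (0, 1)) y = hact q M (free_C b) y" for a b y
  proof -
    have C: "hact q M (free_C c) (hact q M (free_C d) y) = hact q M (free_C (c * d)) y" for c d
      using y(1) by (simp add: free_C_simps hact_simps)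
    have C0: "c = 0" if "hact q M (free_C c) y = \<zero>\<^bsub>M\<^esub>" for c
    proof (rule ccontr)
      assume "c \<noteq> 0"
      then have "hact q M (free_C (inverse c)) (hact q M (free_C c) y) = y"
        using y(1) unfolding C by (simp add: free_C_simps hact_simps)
      then show False using that y(2) by simp
    qed
    have lin: "hact q M (free_X l + free_C c) (hact q M (free_C d) y) = hact q M (free_C ((e + c) * d)) y"
      if "hact q M (free_X l) y = hact q M (free_C e) y" for l c d e
    proof -
      have "hact q M (free_X l + free_C c) (hact q M (free_C d) y)
          = hact q M (free_C d) (hact q M (free_X l + free_C c) y)"
        using y(1) by (intro hact_commutes commutes_C)
      also have "hact q M (free_X l + free_C c) y = hact q M (free_C (e + c)) y"
        using y(1) that by (simp add: free_C_simps hact_simps)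
      finally show ?thesis by (simp add: C mult.commute)
    qed
    have lin1: "hact q M (free_X l + free_C c) y = hact q M (free_C (e + c)) y"
      if "hact q M (free_X l) y = hact q M (free_C e) y" for l c e
      using y(1) that by (simp add: free_C_simps hact_simps)
    note eval = hact_simps(2) lin1[OF y(3)] lin1[OF y(4)] lin[OF y(3)] lin[OF y(4)]
    have "hact q M (free_C ((a - 1) * ((a + 1) * ((a - 1) * (a + 1))))) y = \<zero>\<^bsub>M\<^esub>"
      using ann[of "orbit_annihilators ! 0" y] y(1) by (simp add: orbit_annihilators_def eval del: hact_simps(1))
    then have a: "a = 1 \<or> a = -1" using C0 by (force simp: eq_neg_iff_add_eq_0)
    have "hact q M (free_C ((b - 1) * ((b + 1) * ((b - 1) * (b + 1))))) y = \<zero>\<^bsub>M\<^esub>"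
      using ann[of "orbit_annihilators ! 1" y] y(1) by (simp add: orbit_annihilators_def eval)
    then have b: "b = 1 \<or> b = -1" using C0 by (force simp: eq_neg_iff_add_eq_0)
    have "hact q M (free_C ((a + 1) * ((b + 1) * ((a + 1) * (b + 1))))) y = \<zero>\<^bsub>M\<^esub>"
      using ann[of "orbit_annihilators ! 2" y] y(1) by (simp add: orbit_annihilators_def eval mult.assoc)
    then have "a \<noteq> 1 \<or> b \<noteq> 1" using C0 by force
    then show ?thesis using a b by (auto simp: central_orbit_def)
  qed
  have "weights q M \<subseteq> central_orbit"
  proof
    fix t assume "t \<in> weights q M"
    then obtain y where t: "t \<in> torus" and y: "weight_vector t y" unfolding weights_iff by blast
    have "torus_point (t (1, 0)) (t (0, 1)) \<in> central_orbit"
      using y by (intro in_orbit[of y]) (auto simp: weight_vector_def)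
    then show "t \<in> central_orbit" using torus_eq_torus_point[OF t] by simp
  qed
  moreover have "weights q M \<noteq> {}"
  proof -
    obtain x where x: "x \<in> carrier M" "x \<noteq> \<zero>\<^bsub>M\<^esub>" using nz by blast
    have "hact q M (factors (1, 0) [1, -1, 1, -1]) x = \<zero>\<^bsub>M\<^esub>" "hact q M (factors (0, 1) [1, -1, 1, -1]) x = \<zero>\<^bsub>M\<^esub>"
      using ann[of _ x] x(1) unfolding factors_def orbit_annihilators_def by simp_all
    from joint_eigenvector[OF x this] obtain a b y where y: "a \<in> set [1, -1, 1, -1]" "b \<in> set [1, -1, 1, -1]"
      "y \<in> carrier M" "y \<noteq> \<zero>\<^bsub>M\<^esub>"
      "hact q M (free_X (1, 0)) y = hact q M (free_C a) y" "hact q M (free_X (0, 1)) y = hact q M (free_C b) y"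
      by blast
    then have nz: "a \<noteq> 0" "b \<noteq> 0" by auto
    then have "weight_vector (torus_point a b) y" using y by (intro weight_vector_torus_point)
    then show ?thesis using torus_point_in_torus[OF nz] weights_iff by blast
  qed
  ultimately show ?thesis unfolding has_central_character_def weyl_orbit by blast
qed

section \<open>The composition factors\<close>

lemma irreducible_carrier_nonzero: "irreducible_module R L \<Longrightarrow> carrier L \<noteq> {\<zero>\<^bsub>L\<^esub>}"
  unfolding irreducible_module_def by blast

lemma induced_series:
  fixes V :: "(hecke_elem, 'v) module"
  assumes q: "q\<^sup>2 = -1" and char: "is_character_module q (base_node s) (base_weight s) V v"
  defines "M \<equiv> induced_module (hecke q) (parabolic q (base_node s)) V"
  obtains Ns where "composition_series (hecke q) M Ns"
    and "list_all2 (has_dim q) (series_factors M Ns) [1, 2, 1, 2]"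
    and "module_isomorphic (hecke q) (simple_b q) (series_factors M Ns ! 0)"
proof -
  interpret character_module q "base_node s" "base_weight s" V v by unfold_locales (rule char)
  obtain \<phi> where "\<phi> \<in> LinearCombinations.module_hom (hecke q) M (model q s)"
    "bij_betw \<phi> (carrier M) UNIV"
    unfolding M_def by (rule induced_iso_rep6[OF q char])
  then show ?thesis
    using series_rep6[OF q, of M \<phi> s] that M.left_module_axioms unfolding M_def by blast
qed

text \<open>
  \<open>L\<close> inherits the annihilator of the induced module, and this contains \<open>orbit_annihilators\<close>.
\<close>

lemma factor_of_induced_central_character:
  fixes V :: "(hecke_elem, 'v) module" and L :: "(hecke_elem, 'l) module"
  assumes q: "q\<^sup>2 = -1" and char: "is_character_module q (base_node s) (base_weight s) V v"
    and L: "irreducible_module (hecke q) L"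
    and factor: "composition_factor (hecke q) (induced_module (hecke q) (parabolic q (base_node s)) V) L"
  shows "has_central_character q L (torus_point 1 (- 1))"
proof -
  interpret character_module q "base_node s" "base_weight s" V v by unfold_locales (rule char)
  have lL: "left_module (hecke q) L" using L unfolding irreducible_module_def by blast
  interpret L: hecke_module q L by (rule hecke_module_left_module[OF lL])
  have mn: "(of_bool s :: complex) * of_bool (\<not> s) = 0" by simp
  interpret R: hecke_module q "model q s" by (rule hecke_module_rep6[OF q mn])
  obtain \<phi> where \<phi>: "\<phi> \<in> LinearCombinations.module_hom (hecke q) M (model q s)"
    "bij_betw \<phi> (carrier M) UNIV"
    by (rule induced_iso_rep6[OF q char])
  have "hact q M z x = \<zero>\<^bsub>M\<^esub>" if "z \<in> set orbit_annihilators" "x \<in> carrier M" for z x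
  proof -
    have "\<phi> (hact q M z x) = \<zero>\<^bsub>model q s\<^esub>"
      using module_hom_hact[OF \<phi>(1) that(2)] orbit_annihilators_rep6[OF q mn that(1)] rep6_simps(2)[OF q mn] by simp
    moreover have "inj_on \<phi> (carrier M)" using \<phi>(2) by (simp add: bij_betw_def)
    ultimately show ?thesis
      using module_hom_inj_iff[OF M.left_module_axioms R.left_module_axioms \<phi>(1)] M.hact_closed[OF that(2)] by blast
  qed
  then have "hact q L z y = \<zero>\<^bsub>L\<^esub>" if "z \<in> set orbit_annihilators" "y \<in> carrier L" for z y
    using annihilator_factor[OF M.left_module_axioms lL factor hecke_proj_closed, of z y] that
    unfolding hact_def by blast
  then show ?thesis by (intro L.central_character_if_annihilated irreducible_carrier_nonzero[OF L])
qed

lemma quotient_of_induced_is_factor: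
  fixes V :: "(hecke_elem, 'v) module" and L :: "(hecke_elem, 'l) module"
  assumes q: "q\<^sup>2 = -1" and char: "is_character_module q (base_node s) (base_weight s) V v"
    and L: "irreducible_module (hecke q) L"
    and u: "character_vector q L (base_node s) (base_weight s) u" "u \<noteq> \<zero>\<^bsub>L\<^esub>"
  shows "composition_factor (hecke q) (induced_module (hecke q) (parabolic q (base_node s)) V) L"
proof -
  interpret character_module q "base_node s" "base_weight s" V v by unfold_locales (rule char)
  obtain \<phi> where \<phi>: "\<phi> \<in> LinearCombinations.module_hom (hecke q) M L" "\<phi> gen = u"
    by (rule frobenius_reciprocity[OF u(1)])
  obtain Ns where Ns: "composition_series (hecke q) M Ns" by (rule induced_series[OF q char])
  have "\<phi> gen \<noteq> \<zero>\<^bsub>L\<^esub>" using \<phi>(2) u(2) by simp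
  from irreducible_image_is_factor[OF M.left_module_axioms L Ns \<phi>(1) gen_closed this]
  show ?thesis using Ns unfolding composition_factor_def by blast
qed

text \<open>
  The multiples of \<open>u\<close> are a copy of \<open>simple_b\<close>, which is the first factor of the series of
  \<open>induced_series\<close>.
\<close>

lemma one_dimensional_is_factor:
  fixes V :: "(hecke_elem, 'v) module" and L :: "(hecke_elem, 'l) module"
  assumes q: "q\<^sup>2 = -1" and char: "is_character_module q (base_node s) (base_weight s) V v"
    and L: "irreducible_module (hecke q) L"
    and u: "u \<in> carrier L" "u \<noteq> \<zero>\<^bsub>L\<^esub>" "\<And>i. hact q L (free_T i) u = hact q L (free_C q) u"
      "\<And>l. hact q L (free_X l) u = hact q L (free_C (torus_point (- 1) (- 1) l)) u"
  shows "composition_factor (hecke q) (induced_module (hecke q) (parabolic q (base_node s)) V) L"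
proof -
  have lL: "left_module (hecke q) L" using L unfolding irreducible_module_def by blast
  interpret L: hecke_module q L by (rule hecke_module_left_module[OF lL])
  note lb = left_module_simples(1)[OF q]
  let ?f = "\<lambda>(a1, a2, b, b', c1, c2). hact q L (free_C b') u"
  have slot: "\<exists>y. x = (0, 0, 0, y, 0, 0)" if "x \<in> slot_b" for x using that by (auto simp: slot_b_def)
  have C: "hact q L (free_C c) (hact q L (free_C d) u) = hact q L (free_C (c * d)) u" for c d
    using u(1) by (simp add: free_C_simps L.hact_simps)
  have f: "?f \<in> LinearCombinations.module_hom (hecke q) (simple_b q) L"
  proof (rule module_homI_generators[OF hecke_module_left_module[OF lb] hecke_module_left_module[OF lL]])
    fix x assume "x \<in> carrier (simple_b q)"
    then have "x \<in> slot_b" by (simp add: simple_b_def)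
    then obtain y where x: "x = (0, 0, 0, y, 0, 0)" using slot by blast
    show "?f x \<in> carrier L" using u(1) x by simp
    show "?f (hact q (simple_b q) (free_C c) x) = hact q L (free_C c) (?f x)" for c
      by (simp add: simple_b_def x rep6_simps[OF q] C)
    have T_u: "hact q L (free_T i) (hact q L (free_C y) u) = hact q L (free_C (q * y)) u" for i
      using L.hact_commutes[OF L.commutes_C u(1), of "free_T i" y] u(3)[of i] C by (simp add: mult.commute)
    show "?f (hact q (simple_b q) (free_T i) x) = hact q L (free_T i) (?f x)" for i
      by (cases i) (simp_all add: simple_b_def x rep6_simps[OF q] T_u)
    have X_u: "hact q L (free_X l) (hact q L (free_C y) u) = hact q L (free_C (torus_point (- 1) (- 1) l * y)) u" for l
      using L.hact_commutes[OF L.commutes_C u(1), of "free_X l" y] u(4)[of l] C by (simp add: mult.commute)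
    show "?f (hact q (simple_b q) (free_X l) x) = hact q L (free_X l) (?f x)" for l
      by (cases l) (simp add: simple_b_def x rep6_simps[OF q] X_u torus_point_sign)
    fix x' assume "x' \<in> carrier (simple_b q)"
    then have "x' \<in> slot_b" by (simp add: simple_b_def)
    then obtain y' where "x' = (0, 0, 0, y', 0, 0)" using slot by blast
    then show "?f (x \<oplus>\<^bsub>simple_b q\<^esub> x') = ?f x \<oplus>\<^bsub>L\<^esub> ?f x'"
      using x u(1) by (simp add: simple_b_def rep6_simps[OF q] free_C_simps L.hact_simps)
  qed
  have "bij_betw ?f (carrier (simple_b q)) (carrier L)"
  proof (rule schur_lemma[OF irreducible_simple_b[OF q] L f])
    show "(0, 0, 0, 1, 0, 0) \<in> carrier (simple_b q)" by (simp add: simple_b_def slot_iff)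
    show "?f (0, 0, 0, 1, 0, 0) \<noteq> \<zero>\<^bsub>L\<^esub>" using u(1,2) by (simp add: free_C_simps L.hact_simps)
  qed
  then have "module_isomorphic (hecke q) (simple_b q) L" using f unfolding module_isomorphic_def by blast
  then have iso: "module_isomorphic (hecke q) L (simple_b q)" by (rule module_isomorphic_sym[OF lb])
  let ?M = "induced_module (hecke q) (parabolic q (base_node s)) V"
  obtain Ns where Ns: "composition_series (hecke q) ?M Ns"
    "list_all2 (has_dim q) (series_factors ?M Ns) [1, 2, 1, 2]"
    "module_isomorphic (hecke q) (simple_b q) (series_factors ?M Ns ! 0)"
    by (rule induced_series[OF q char])
  have "series_factors ?M Ns ! 0 \<in> set (series_factors ?M Ns)"
    using list_all2_lengthD[OF Ns(2)] by (intro nth_mem) simp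
  then show ?thesis
    unfolding composition_factor_def using Ns(1) module_isomorphic_trans[OF iso Ns(3)] by blast
qed

theorem proposition26:
  fixes q :: complex and t :: weight
    and V :: "(hecke_elem, 'v) module" and v\<^sub>t :: 'v
    and U :: "(hecke_elem, 'u) module" and u :: 'u
    and M :: "(hecke_elem, (hecke_elem \<times> 'v \<Rightarrow>\<^sub>0 int) set) module"
    and N :: "(hecke_elem, (hecke_elem \<times> 'u \<Rightarrow>\<^sub>0 int) set) module"
  assumes "q\<^sup>2 = -1"
    and "t = torus_point 1 (q\<^sup>2)"
    and "is_character_module q N2 t V v\<^sub>t"
    and "is_character_module q N1 (weyl_act (reflection N1 \<circ> reflection N2) t) U u"
    and "M = induced_module (hecke q) (parabolic q N2) V"
    and "N = induced_module (hecke q) (parabolic q N1) U"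
  shows
    "(\<exists>Ns ds. composition_series (hecke q) M Ns \<and>
        list_all2 (has_dim q) (series_factors M Ns) ds \<and> mset ds = {#1, 1, 2, 2#}) \<and>
     (\<exists>Ns ds. composition_series (hecke q) N Ns \<and>
        list_all2 (has_dim q) (series_factors N Ns) ds \<and> mset ds = {#1, 1, 2, 2#}) \<and>
     (\<forall>L :: (hecke_elem, 'l) module. irreducible_module (hecke q) L \<longrightarrow>
        (has_central_character q L t \<longleftrightarrow>
         composition_factor (hecke q) M L \<or> composition_factor (hecke q) N L))"
proof -
  note q = assms(1)
  have t: "t = torus_point 1 (- 1)" using assms(1,2) by simp
  have V: "is_character_module q (base_node True) (base_weight True) V v\<^sub>t"
    using assms(3) t by (simp add: base_node_def base_weight_eq)
  have U: "is_character_module q (base_node False) (base_weight False) U u"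
    using assms(4) t unfolding base_weight_eq(2) by (simp add: base_node_def)
  have M: "M = induced_module (hecke q) (parabolic q (base_node True)) V"
    and N: "N = induced_module (hecke q) (parabolic q (base_node False)) U"
    using assms(5,6) by (simp_all add: base_node_def)
  have dims: "mset [1, 2, 1, 2] = {#1, 1, 2, 2 :: nat#}" by simp
  show ?thesis
  proof (intro conjI allI impI)
    show "\<exists>Ns ds. composition_series (hecke q) M Ns \<and>
        list_all2 (has_dim q) (series_factors M Ns) ds \<and> mset ds = {#1, 1, 2, 2#}"
      using induced_series[OF q V] dims unfolding M by metis
    show "\<exists>Ns ds. composition_series (hecke q) N Ns \<and>
        list_all2 (has_dim q) (series_factors N Ns) ds \<and> mset ds = {#1, 1, 2, 2#}"
      using induced_series[OF q U] dims unfolding N by metis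
    fix L :: "(hecke_elem, 'l) module"
    assume L: "irreducible_module (hecke q) L"
    have lL: "left_module (hecke q) L" using L unfolding irreducible_module_def by blast
    interpret L: hecke_module q L by (rule hecke_module_left_module[OF lL])
    show "has_central_character q L t \<longleftrightarrow> composition_factor (hecke q) M L \<or> composition_factor (hecke q) N L"
    proof
      assume "has_central_character q L t"
      then obtain t' x where "t' \<in> central_orbit" "L.weight_vector t' x"
        unfolding has_central_character_def t weyl_orbit using L.weights_iff by blast
      with q show "composition_factor (hecke q) M L \<or> composition_factor (hecke q) N L"
      proof (cases rule: L.weight_vector_trichotomy)
        case (induced s u)
        then show ?thesis
          using quotient_of_induced_is_factor[OF q V L] quotient_of_induced_is_factor[OF q U L]
          unfolding M N by (cases s) auto
      next
        case (one_dimensional u)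
        then show ?thesis using one_dimensional_is_factor[OF q V L] unfolding M by blast
      qed
    next
      assume "composition_factor (hecke q) M L \<or> composition_factor (hecke q) N L"
      then show "has_central_character q L t"
        using factor_of_induced_central_character[OF q V L] factor_of_induced_central_character[OF q U L]
        unfolding M N t by blast
    qed
  qed
qed

end
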